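(* Let $X$ be a finite regular cell decomposition of the sphere $S^2$ with Poincaré dual cell decomposition $\tilde X$. Suppose that $(X,p)$ and $(\tilde X,q)$ are planar reciprocal diagrams in $\mathbb{R}^2$. Then the following real vector spaces are isomorphic: (i) the space of mechanisms and global rotations of $(X,p)$; (ii) the space of parallel deformations of $(X,p)$ up to global translation; (iii) the space of impossible edge rotations over $(\tilde X,q)$; (iv) the space of axial self stresses over $(\tilde X,q)$; (v) the space of pure self shear stresses over $(\tilde X,q)$; (vi) the space of vertical polyhedral lifts of $(\tilde X,q)$ up to shifts of a global affine function.
   Context: **Cells and dual.** A finite regular cell complex has cells that are topological disks whose boundaries consist of incident lower dimensional cells; $c\lhd d$ denotes that $c$ is a cell in the boundary of $d$. A signed incidence relation $[c:d]\in\{-1,0,1\}$ is fixed, nonzero iff $c\lhd d$ and $\dim d=\dim c+1$, with $[u:e][v:e]=-1$ for the two endpoints $u,v$ of an edge $e$, and $\sum_c[b:c][c:d]=0$ for all $b\lhd d$; it is induced by local orientations of the cells, with all 2-cells (faces) oriented consistently with the orientation of $S^2$. The dual $\tilde X$ is the cell decomposition of $S^2$ having a vertex $\tilde f$ for each face $f$ of $X$, an edge $\tilde e$ for each edge $e$, and a face $\tilde v$ for each vertex $v$, with incidences reversed and $[\tilde d:\tilde c]=[c:d]$. **Diagrams.** A diagram $(Y,r)$ in $\mathbb{R}^2$ is a cell complex $Y$ with an injective map $r$ from its vertex set to $\mathbb{R}^2$, written $v\mapsto r_v$. For an edge $e$ with endpoints $u,v$, let $\tau_e$ be the unit vector in the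 direction of $[u:e]r_u+[v:e]r_v$, and let $\mathbf{e}=\operatorname{span}\{\tau_e\}\subset\mathbb{R}^2$. **Reciprocal diagrams.** $(X,p)$ and $(\tilde X,q)$ are planar reciprocal diagrams if both are diagrams in $\mathbb{R}^2$ (so $p$ and $q$ are injective on vertices) and corresponding edges are parallel: for each edge $e$ of $X$ with incident faces $f,g$, the vector $q_{\tilde f}-q_{\tilde g}$ lies in the line $\mathbf e$ determined by $p$. **The spaces.** For a diagram $(Y,r)$ in $\mathbb{R}^2$ with vertex set $V$ and edge set $E$: - The force boundary map $\partial:\mathbb{R}^{E}\to(\mathbb{R}^2)^{V}$ is $(\partial w)_v=\sum_{e:\,v\lhd e}[v:e]\,w_e\,\tau_e$. The space of axial self stresses is $\ker\partial$ (this is $H_1$ of the force cosheaf $\mathcal F$). Let $H_0\mathcal{F}=\operatorname{coker}\partial$. The space of mechanisms and global rotations is the kernel of the map $H_0\mathcal F\to\mathbb{R}^2$ induced by $(b_v)_v\mapsto\sum_v b_v$ (the degrees of freedom with no net translation). - The position coboundary map is $\delta:(\mathbb{R}^2)^V\to\bigoplus_{e\in E}\mathbb{R}^2/\mathbf{e}$, $(\delta\xi)_e=[u:e]\xi_u+[v:e]\xi_v \bmod \mathbf{e}$ for $e$ with endpoints $u,v$ (here $(\mathbb{R}^2)^\vee$ is identified with $\mathbb{R}^2$ using the Euclidean inner product). The space of parallel deformations is $\ker\delta$; up to global translation it is the quotient of $\ker\delta$ by the 2-dimensional subspace of constant assignments $\xi_v=c$. The space of impossible edge rotations is $\operatorname{coker}\delta$.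 - The space of pure self shear stresses is the kernel of $\bigoplus_{e\in E}\mathbf{e}^\perp\to(\mathbb{R}^2)^V$, $(s_e)_e\mapsto\left(\sum_{e:\,v\lhd e}[v:e]\,s_e\right)_v$. - A vertical polyhedral lift is an assignment of an affine function $h_f:\mathbb{R}^2\to\mathbb{R}$ to each face $f$ of $Y$ such that for any edge $e$ with endpoints $u,v$ and incident faces $f,g$ one has $h_f(r_u)=h_g(r_u)$ and $h_f(r_v)=h_g(r_v)$. Lifts form a vector space; "up to shifts of a global affine function" means the quotient by the assignments $h_f=h$ for all $f$, with $h$ a single affine function. *)

theory Defs
  imports "HOL-Analysis.Analysis" "HOL-Algebra.Algebraic_Closure_Type"
begin

section \<open>Real vector spaces with explicit carriers\<close>

text \<open>
  The quotients and subspaces below have carriers that depend on the diagram, so they are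
  modules in the sense of HOL-Algebra over the field of real numbers.  The record type of
  modules extends that of rings; the fields \<open>mult\<close> and \<open>one\<close> play no role for a module and are
  left undefined.
\<close>

type_synonym 'v real_space = "(real, 'v) module"

definition vec_space :: "'v::real_vector set \<Rightarrow> 'v real_space" where
  "vec_space S = \<lparr>carrier = S, mult = undefined, one = undefined,
                  zero = 0, add = (+), smult = (*\<^sub>R)\<rparr>"

definition prod_space :: "'i set \<Rightarrow> ('i \<Rightarrow> 'v real_space) \<Rightarrow> ('i \<Rightarrow> 'v) real_space" where
  "prod_space I M = \<lparr>carrier = (\<Pi>\<^sub>E i\<in>I. carrier (M i)), mult = undefined, one = undefined,
                     zero = (\<lambda>i\<in>I. \<zero>\<^bsub>M i\<^esub>),
                     add = (\<lambda>x y. \<lambda>i\<in>I. x i \<oplus>\<^bsub>M i\<^esub> y i),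
                     smult = (\<lambda>a x. \<lambda>i\<in>I. a \<odot>\<^bsub>M i\<^esub> x i)\<rparr>"

definition quot_space :: "'v real_space \<Rightarrow> 'v set \<Rightarrow> 'v set real_space" where
  "quot_space M H = \<lparr>carrier = a_rcosets\<^bsub>M\<^esub> H, mult = undefined, one = undefined,
                     zero = H, add = (<+>\<^bsub>M\<^esub>),
                     smult = (\<lambda>a A. \<Union>x\<in>A. H +>\<^bsub>M\<^esub> (a \<odot>\<^bsub>M\<^esub> x))\<rparr>"

definition ker_space :: "'v real_space \<Rightarrow> 'w real_space \<Rightarrow> ('v \<Rightarrow> 'w) \<Rightarrow> 'v real_space" where
  "ker_space M N f = M\<lparr>carrier := a_kernel M N f\<rparr>"

definition coker_space :: "'v real_space \<Rightarrow> 'w real_space \<Rightarrow> ('v \<Rightarrow> 'w) \<Rightarrow> 'w set real_space" where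
  "coker_space M N f = quot_space N (f ` carrier M)"

text \<open>The map induced on cosets by a map that is constant on each coset.\<close>

definition induced_map :: "('v \<Rightarrow> 'w) \<Rightarrow> 'v set \<Rightarrow> 'w" where
  "induced_map f A = the_elem (f ` A)"

definition linear_isos :: "'v real_space \<Rightarrow> 'w real_space \<Rightarrow> ('v \<Rightarrow> 'w) set" where
  "linear_isos M N = {\<phi>. bij_betw \<phi> (carrier M) (carrier N) \<and>
     (\<forall>x\<in>carrier M. \<forall>y\<in>carrier M. \<phi> (x \<oplus>\<^bsub>M\<^esub> y) = \<phi> x \<oplus>\<^bsub>N\<^esub> \<phi> y) \<and>
     (\<forall>a. \<forall>x\<in>carrier M. \<phi> (a \<odot>\<^bsub>M\<^esub> x) = a \<odot>\<^bsub>N\<^esub> \<phi> x)}"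

definition isomorphic_spaces :: "'v real_space \<Rightarrow> 'w real_space \<Rightarrow> bool" (infix \<open>\<cong>\<^sub>V\<close> 50) where
  "M \<cong>\<^sub>V N \<longleftrightarrow> Module.module (ring_of_type_algebra :: real ring) M \<and>
               Module.module (ring_of_type_algebra :: real ring) N \<and>
               linear_isos M N \<noteq> {}"


section \<open>Regular cell decompositions of the sphere and their duals\<close>

text \<open>Cells are the open cells, as subsets of the ambient space; a vertex is a singleton.\<close>

record 'a cell_complex =
  verts :: "'a set set"
  edges :: "'a set set"
  faces :: "'a set set"
  incid :: "'a set \<Rightarrow> 'a set \<Rightarrow> int"

definition cells :: "'a cell_complex \<Rightarrow> 'a set set" where
  "cells K = verts K \<union> edges K \<union> faces K"

definition cell_dim :: "'a cell_complex \<Rightarrow> 'a set \<Rightarrow> nat" where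
  "cell_dim K c = (if c \<in> verts K then 0 else if c \<in> edges K then 1 else 2)"

definition in_boundary :: "'a::topological_space set \<Rightarrow> 'a set \<Rightarrow> bool" (infix \<open>\<lhd>\<^sub>c\<close> 50) where
  "c \<lhd>\<^sub>c d \<longleftrightarrow> c \<noteq> d \<and> c \<subseteq> closure d"

definition disk_cell :: "'b::euclidean_space itself \<Rightarrow> 'a::topological_space set \<Rightarrow> bool" where
  "disk_cell _ c \<longleftrightarrow>
     (\<exists>f g. homeomorphism (cball (0::'b) 1) (closure c) f g \<and> f ` ball 0 1 = c)"

definition regular_cell_complex :: "'a::topological_space set \<Rightarrow> 'a cell_complex \<Rightarrow> bool" where
  "regular_cell_complex S K \<longleftrightarrow>
     finite (cells K) \<and> disjoint (cells K) \<and> \<Union>(cells K) = S \<and>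
     (\<forall>v\<in>verts K. \<exists>x. v = {x}) \<and>
     (\<forall>e\<in>edges K. disk_cell TYPE(real) e \<and>
        closure e - e = \<Union>{v \<in> verts K. v \<lhd>\<^sub>c e}) \<and>
     (\<forall>f\<in>faces K. disk_cell TYPE(real^2) f \<and>
        closure f - f = \<Union>{c \<in> verts K \<union> edges K. c \<lhd>\<^sub>c f})"

text \<open>
  On a regular cell complex the functions \<open>incid\<close> below are exactly those induced by local
  orientations of the cells.
\<close>

definition signed_incidence :: "'a::topological_space cell_complex \<Rightarrow> bool" where
  "signed_incidence K \<longleftrightarrow>
     (\<forall>c\<in>cells K. \<forall>d\<in>cells K. incid K c d \<in> {-1, 0, 1} \<and>
        (incid K c d \<noteq> 0 \<longleftrightarrow> c \<lhd>\<^sub>c d \<and> cell_dim K d = cell_dim K c + 1)) \<and>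
     (\<forall>e\<in>edges K. \<forall>u\<in>verts K. \<forall>v\<in>verts K. u \<lhd>\<^sub>c e \<longrightarrow> v \<lhd>\<^sub>c e \<longrightarrow> u \<noteq> v \<longrightarrow>
        incid K u e * incid K v e = -1) \<and>
     (\<forall>b\<in>cells K. \<forall>d\<in>cells K. b \<lhd>\<^sub>c d \<longrightarrow> (\<Sum>c\<in>cells K. incid K b c * incid K c d) = 0)"

text \<open>
  The faces are oriented consistently with an orientation of the surface iff each edge inherits
  opposite orientations from the two faces it separates.
\<close>

definition consistently_oriented :: "'a::topological_space cell_complex \<Rightarrow> bool" where
  "consistently_oriented K \<longleftrightarrow>
     (\<forall>e\<in>edges K. \<forall>f\<in>faces K. \<forall>g\<in>faces K. e \<lhd>\<^sub>c f \<longrightarrow> e \<lhd>\<^sub>c g \<longrightarrow> f \<noteq> g \<longrightarrow>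
        incid K e f * incid K e g = -1)"

definition sphere_decomposition :: "(real^3) cell_complex \<Rightarrow> bool" where
  "sphere_decomposition K \<longleftrightarrow>
     regular_cell_complex (sphere 0 1) K \<and> signed_incidence K \<and> consistently_oriented K"

definition poincare_dual ::
  "'a::topological_space cell_complex \<Rightarrow> 'b::topological_space cell_complex \<Rightarrow>
   ('a set \<Rightarrow> 'b set) \<Rightarrow> bool" where
  "poincare_dual K K' dual \<longleftrightarrow>
     bij_betw dual (faces K) (verts K') \<and>
     bij_betw dual (edges K) (edges K') \<and>
     bij_betw dual (verts K) (faces K') \<and>
     (\<forall>c\<in>cells K. \<forall>d\<in>cells K. (dual d \<lhd>\<^sub>c dual c \<longleftrightarrow> c \<lhd>\<^sub>c d) \<and>
        incid K' (dual d) (dual c) = incid K c d)"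


section \<open>Diagrams in the plane\<close>

definition diagram :: "'a cell_complex \<Rightarrow> ('a set \<Rightarrow> real^2) \<Rightarrow> bool" where
  "diagram K r \<longleftrightarrow> inj_on r (verts K)"

text \<open>The signed sum \<open>[u:e] x\<^sub>u + [v:e] x\<^sub>v\<close> over the endpoints of \<open>e\<close>.\<close>

definition edge_sum ::
  "'a::topological_space cell_complex \<Rightarrow> ('a set \<Rightarrow> real^2) \<Rightarrow> 'a set \<Rightarrow> real^2" where
  "edge_sum K x e = (\<Sum>v\<in>{v \<in> verts K. v \<lhd>\<^sub>c e}. real_of_int (incid K v e) *\<^sub>R x v)"

definition edge_dir ::
  "'a::topological_space cell_complex \<Rightarrow> ('a set \<Rightarrow> real^2) \<Rightarrow> 'a set \<Rightarrow> real^2" where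
  "edge_dir K r e = sgn (edge_sum K r e)"

definition edge_line ::
  "'a::topological_space cell_complex \<Rightarrow> ('a set \<Rightarrow> real^2) \<Rightarrow> 'a set \<Rightarrow> (real^2) set" where
  "edge_line K r e = span {edge_dir K r e}"

definition reciprocal_diagrams ::
  "'a::topological_space cell_complex \<Rightarrow> ('a set \<Rightarrow> real^2) \<Rightarrow>
   'b::topological_space cell_complex \<Rightarrow> ('b set \<Rightarrow> real^2) \<Rightarrow> ('a set \<Rightarrow> 'b set) \<Rightarrow> bool" where
  "reciprocal_diagrams K p K' q dual \<longleftrightarrow>
     diagram K p \<and> diagram K' q \<and>
     (\<forall>e\<in>edges K. \<forall>f\<in>faces K. \<forall>g\<in>faces K. e \<lhd>\<^sub>c f \<longrightarrow> e \<lhd>\<^sub>c g \<longrightarrow>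
        q (dual f) - q (dual g) \<in> edge_line K p e)"


section \<open>The spaces attached to a diagram\<close>

abbreviation plane :: "(real^2) real_space" where
  "plane \<equiv> vec_space UNIV"

definition vertex_vectors :: "'a cell_complex \<Rightarrow> ('a set \<Rightarrow> real^2) real_space" where
  "vertex_vectors K = prod_space (verts K) (\<lambda>_. plane)"

definition edge_scalars :: "'a cell_complex \<Rightarrow> ('a set \<Rightarrow> real) real_space" where
  "edge_scalars K = prod_space (edges K) (\<lambda>_. vec_space UNIV)"

definition force_boundary ::
  "'a::topological_space cell_complex \<Rightarrow> ('a set \<Rightarrow> real^2) \<Rightarrow>
   ('a set \<Rightarrow> real) \<Rightarrow> 'a set \<Rightarrow> real^2" where
  "force_boundary K r w =
     (\<lambda>v\<in>verts K. \<Sum>e\<in>{e \<in> edges K. v \<lhd>\<^sub>c e}. (real_of_int (incid K v e) * w e) *\<^sub>R edge_dir K r e)"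

definition axial_self_stresses ::
  "'a::topological_space cell_complex \<Rightarrow> ('a set \<Rightarrow> real^2) \<Rightarrow> ('a set \<Rightarrow> real) real_space" where
  "axial_self_stresses K r = ker_space (edge_scalars K) (vertex_vectors K) (force_boundary K r)"

definition force_H0 ::
  "'a::topological_space cell_complex \<Rightarrow> ('a set \<Rightarrow> real^2) \<Rightarrow> ('a set \<Rightarrow> real^2) set real_space"
  where
  "force_H0 K r = coker_space (edge_scalars K) (vertex_vectors K) (force_boundary K r)"

definition mechanisms_and_rotations ::
  "'a::topological_space cell_complex \<Rightarrow> ('a set \<Rightarrow> real^2) \<Rightarrow> ('a set \<Rightarrow> real^2) set real_space"
  where
  "mechanisms_and_rotations K r =
     ker_space (force_H0 K r) plane (induced_map (\<lambda>b. \<Sum>v\<in>verts K. b v))"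

definition edge_quotients ::
  "'a::topological_space cell_complex \<Rightarrow> ('a set \<Rightarrow> real^2) \<Rightarrow> ('a set \<Rightarrow> (real^2) set) real_space"
  where
  "edge_quotients K r = prod_space (edges K) (\<lambda>e. quot_space plane (edge_line K r e))"

definition position_coboundary ::
  "'a::topological_space cell_complex \<Rightarrow> ('a set \<Rightarrow> real^2) \<Rightarrow>
   ('a set \<Rightarrow> real^2) \<Rightarrow> 'a set \<Rightarrow> (real^2) set" where
  "position_coboundary K r \<xi> = (\<lambda>e\<in>edges K. edge_line K r e +>\<^bsub>plane\<^esub> edge_sum K \<xi> e)"

definition parallel_deformations ::
  "'a::topological_space cell_complex \<Rightarrow> ('a set \<Rightarrow> real^2) \<Rightarrow> ('a set \<Rightarrow> real^2) real_space" where
  "parallel_deformations K r =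
     ker_space (vertex_vectors K) (edge_quotients K r) (position_coboundary K r)"

definition parallel_deformations_mod_translation ::
  "'a::topological_space cell_complex \<Rightarrow> ('a set \<Rightarrow> real^2) \<Rightarrow> ('a set \<Rightarrow> real^2) set real_space"
  where
  "parallel_deformations_mod_translation K r =
     quot_space (parallel_deformations K r) (range (\<lambda>c. \<lambda>v\<in>verts K. c))"

definition impossible_edge_rotations ::
  "'a::topological_space cell_complex \<Rightarrow> ('a set \<Rightarrow> real^2) \<Rightarrow>
   ('a set \<Rightarrow> (real^2) set) set real_space" where
  "impossible_edge_rotations K r =
     coker_space (vertex_vectors K) (edge_quotients K r) (position_coboundary K r)"

definition edge_normals ::
  "'a::topological_space cell_complex \<Rightarrow> ('a set \<Rightarrow> real^2) \<Rightarrow> ('a set \<Rightarrow> real^2) real_space" where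
  "edge_normals K r = prod_space (edges K) (\<lambda>e. vec_space (orthogonal_comp (edge_line K r e)))"

definition shear_boundary ::
  "'a::topological_space cell_complex \<Rightarrow> ('a set \<Rightarrow> real^2) \<Rightarrow> 'a set \<Rightarrow> real^2" where
  "shear_boundary K s =
     (\<lambda>v\<in>verts K. \<Sum>e\<in>{e \<in> edges K. v \<lhd>\<^sub>c e}. real_of_int (incid K v e) *\<^sub>R s e)"

definition pure_self_shear_stresses ::
  "'a::topological_space cell_complex \<Rightarrow> ('a set \<Rightarrow> real^2) \<Rightarrow> ('a set \<Rightarrow> real^2) real_space" where
  "pure_self_shear_stresses K r =
     ker_space (edge_normals K r) (vertex_vectors K) (shear_boundary K)"

definition affine_functions :: "(real^2 \<Rightarrow> real) real_space" where
  "affine_functions = \<lparr>carrier = {h. \<exists>l c. linear l \<and> h = (\<lambda>x. l x + c)},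
                       mult = undefined, one = undefined,
                       zero = (\<lambda>x. 0), add = (\<lambda>h k x. h x + k x), smult = (\<lambda>a h x. a * h x)\<rparr>"

definition polyhedral_lifts ::
  "'a::topological_space cell_complex \<Rightarrow> ('a set \<Rightarrow> real^2) \<Rightarrow>
   ('a set \<Rightarrow> real^2 \<Rightarrow> real) real_space" where
  "polyhedral_lifts K r =
     (let M = prod_space (faces K) (\<lambda>_. affine_functions)
      in M\<lparr>carrier := {h \<in> carrier M.
             \<forall>e\<in>edges K. \<forall>f\<in>faces K. \<forall>g\<in>faces K. \<forall>v\<in>verts K.
               e \<lhd>\<^sub>c f \<longrightarrow> e \<lhd>\<^sub>c g \<longrightarrow> v \<lhd>\<^sub>c e \<longrightarrow> h f (r v) = h g (r v)}\<rparr>)"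

definition polyhedral_lifts_mod_affine ::
  "'a::topological_space cell_complex \<Rightarrow> ('a set \<Rightarrow> real^2) \<Rightarrow>
   ('a set \<Rightarrow> real^2 \<Rightarrow> real) set real_space" where
  "polyhedral_lifts_mod_affine K r =
     quot_space (polyhedral_lifts K r) ((\<lambda>h. \<lambda>f\<in>faces K. h) ` carrier affine_functions)"

end

theory Submission
  imports Defs "HOL-Analysis.Kronecker_Approximation_Theorem"
begin

text \<open>
  The spaces are compared, directly or through the parallel deformations, with the axial self
  stresses of the dual diagram.

  Three of the identifications are linear algebra in one diagram.  Rotation by a right angle
  exchanges axial and shear stresses (\<open>axial_iso_shear\<close>).  The boundary map on stresses and the
  difference map on vertex vectors are adjoint (\<open>inner_boundary\<close>), so that the cokernel of the one is,
  up to a rotation, the kernel of the other; since the spaces are finite dimensional, a cokernel is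
  represented by an orthogonal complement (\<open>normal_equations\<close>).  This relates impossible edge
  rotations to stresses (\<open>axial_iso_edge_rotations\<close>) and mechanisms to parallel deformations
  modulo translations (\<open>mechanisms_iso_parallel\<close>).

  The other two pass between the primal and the dual diagram.  In a parallel deformation the
  difference over an edge is a multiple of the edge direction, hence of the direction of the dual
  edge, and these multiples form a self stress of the dual diagram because differences sum to 0
  around a face.  A self stress arises in this way because the first cohomology of the sphere
  vanishes, and it determines the deformation up to translation because the 1-skeleton is
  connected (\<open>parallel_iso_axial\<close>).  The gradients of a polyhedral lift of the dual diagram, turned by
  a right angle, are a parallel deformation of the primal one; the constant terms are recovered by
  a second use of the cohomology (\<open>lifts_iso_axial\<close>).

  Vanishing of the first cohomology is obtained from the fact that maps from the 2-sphere to the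
  circle have continuous logarithms: an integral cocycle is realised by such a map
  (\<open>integer_cocycle_is_coboundary\<close>), and simultaneous Diophantine approximation passes from integral
  to real cocycles (\<open>real_cocycle_is_coboundary\<close>).
\<close>

section \<open>Real vector spaces with explicit carriers\<close>

abbreviation real_ring :: "real ring" where
  "real_ring \<equiv> ring_of_type_algebra"

abbreviation real_module :: "'v real_space \<Rightarrow> bool" where
  "real_module M \<equiv> Module.module real_ring M"

lemma real_ring_simps [simp]:
  "carrier real_ring = UNIV" "add real_ring = plus" "mult real_ring = times" "one real_ring = 1"
  by (simp_all add: ring_of_type_algebra_def)

lemma real_moduleI:
  fixes M :: "'v real_space" (structure)
  assumes "\<zero> \<in> carrier M"
    and "\<And>x y. x \<in> carrier M \<Longrightarrow> y \<in> carrier M \<Longrightarrow> x \<oplus> y \<in> carrier M"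
    and "\<And>a x. x \<in> carrier M \<Longrightarrow> a \<odot> x \<in> carrier M"
    and "\<And>x y z. x \<in> carrier M \<Longrightarrow> y \<in> carrier M \<Longrightarrow> z \<in> carrier M \<Longrightarrow> (x \<oplus> y) \<oplus> z = x \<oplus> (y \<oplus> z)"
    and "\<And>x y. x \<in> carrier M \<Longrightarrow> y \<in> carrier M \<Longrightarrow> x \<oplus> y = y \<oplus> x"
    and "\<And>x. x \<in> carrier M \<Longrightarrow> \<zero> \<oplus> x = x"
    and "\<And>x. x \<in> carrier M \<Longrightarrow> ((-1) \<odot> x) \<oplus> x = \<zero>"
    and "\<And>a b x. x \<in> carrier M \<Longrightarrow> (a + b) \<odot> x = (a \<odot> x) \<oplus> (b \<odot> x)"
    and "\<And>a x y. x \<in> carrier M \<Longrightarrow> y \<in> carrier M \<Longrightarrow> a \<odot> (x \<oplus> y) = (a \<odot> x) \<oplus> (a \<odot> y)"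
    and "\<And>a b x. x \<in> carrier M \<Longrightarrow> (a * b) \<odot> x = a \<odot> (b \<odot> x)"
    and "\<And>x. x \<in> carrier M \<Longrightarrow> 1 \<odot> x = x"
  shows "real_module M"
proof (rule moduleI)
  show "cring real_ring" by (rule cring_from_type_algebra)
  have inv: "\<exists>y\<in>carrier M. y \<oplus> x = \<zero>" if "x \<in> carrier M" for x
    using assms(3,7) that by blast
  show "abelian_group M"
    by (rule abelian_groupI) (use assms(1,2,4-6) inv in blast)+
qed (use assms in simp_all)

lemma real_moduleD:
  fixes M :: "'v real_space" (structure)
  assumes "real_module M"
  shows "\<zero> \<in> carrier M"
    and "\<And>x y. x \<in> carrier M \<Longrightarrow> y \<in> carrier M \<Longrightarrow> x \<oplus> y \<in> carrier M"
    and "\<And>a x. x \<in> carrier M \<Longrightarrow> a \<odot> x \<in> carrier M"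
    and "\<And>x y z. x \<in> carrier M \<Longrightarrow> y \<in> carrier M \<Longrightarrow> z \<in> carrier M \<Longrightarrow> (x \<oplus> y) \<oplus> z = x \<oplus> (y \<oplus> z)"
    and "\<And>x y. x \<in> carrier M \<Longrightarrow> y \<in> carrier M \<Longrightarrow> x \<oplus> y = y \<oplus> x"
    and "\<And>x. x \<in> carrier M \<Longrightarrow> \<zero> \<oplus> x = x"
    and "\<And>x. x \<in> carrier M \<Longrightarrow> ((-1) \<odot> x) \<oplus> x = \<zero>"
    and "\<And>a b x. x \<in> carrier M \<Longrightarrow> (a + b) \<odot> x = (a \<odot> x) \<oplus> (b \<odot> x)"
    and "\<And>a x y. x \<in> carrier M \<Longrightarrow> y \<in> carrier M \<Longrightarrow> a \<odot> (x \<oplus> y) = (a \<odot> x) \<oplus> (a \<odot> y)"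
    and "\<And>a b x. x \<in> carrier M \<Longrightarrow> (a * b) \<odot> x = a \<odot> (b \<odot> x)"
    and "\<And>x. x \<in> carrier M \<Longrightarrow> 1 \<odot> x = x"
proof -
  interpret M: Module.module real_ring M by (rule assms)
  show "\<zero> \<in> carrier M" by (rule M.zero_closed)
  show "x \<in> carrier M \<Longrightarrow> y \<in> carrier M \<Longrightarrow> x \<oplus> y \<in> carrier M" for x y by (rule M.add.m_closed)
  show "x \<in> carrier M \<Longrightarrow> a \<odot> x \<in> carrier M" for a x by simp
  show "x \<in> carrier M \<Longrightarrow> y \<in> carrier M \<Longrightarrow> z \<in> carrier M \<Longrightarrow> (x \<oplus> y) \<oplus> z = x \<oplus> (y \<oplus> z)" for x y z
    by (rule M.add.m_assoc)
  show "x \<in> carrier M \<Longrightarrow> y \<in> carrier M \<Longrightarrow> x \<oplus> y = y \<oplus> x" for x y by (rule M.add.m_comm)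
  show "x \<in> carrier M \<Longrightarrow> \<zero> \<oplus> x = x" for x by simp
  show dist: "x \<in> carrier M \<Longrightarrow> (a + b) \<odot> x = (a \<odot> x) \<oplus> (b \<odot> x)" for a b x
    using M.smult_l_distr[of a b x] by simp
  show "x \<in> carrier M \<Longrightarrow> y \<in> carrier M \<Longrightarrow> a \<odot> (x \<oplus> y) = (a \<odot> x) \<oplus> (a \<odot> y)" for a x y
    using M.smult_r_distr[of a x y] by simp
  show "x \<in> carrier M \<Longrightarrow> (a * b) \<odot> x = a \<odot> (b \<odot> x)" for a b x
    using M.smult_assoc1[of a b x] by simp
  show one: "x \<in> carrier M \<Longrightarrow> 1 \<odot> x = x" for x
    using M.smult_one[of x] by simp
  show "x \<in> carrier M \<Longrightarrow> ((-1) \<odot> x) \<oplus> x = \<zero>" for x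
    using dist[of x "-1" 1] one[of x] M.smult_l_null[of x] by (simp add: ring_of_type_algebra_def)
qed

lemma real_module_vec_space:
  fixes S :: "'v::real_vector set"
  assumes "subspace S"
  shows "real_module (vec_space S)"
  by (rule real_moduleI)
    (use assms in \<open>auto simp: vec_space_def subspace_def algebra_simps\<close>)

lemma real_module_prod_space:
  assumes "\<And>i. i \<in> I \<Longrightarrow> real_module (M i)"
  shows "real_module (prod_space I M)"
proof (rule real_moduleI)
  note D = real_moduleD[OF assms]
  show "\<zero>\<^bsub>prod_space I M\<^esub> \<in> carrier (prod_space I M)"
    using D(1) by (auto simp: prod_space_def)
qed (auto simp: prod_space_def PiE_iff fun_eq_iff extensional_def real_moduleD(1-4,6-)[OF assms]
      intro: real_moduleD(5)[OF assms])

lemma real_module_affine_functions: "real_module affine_functions"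
proof (rule real_moduleI)
  show "\<zero>\<^bsub>affine_functions\<^esub> \<in> carrier affine_functions"
    by (auto simp: affine_functions_def intro!: exI[of _ "\<lambda>_. 0"] exI[of _ 0] linear_zero)
next
  fix h k assume "h \<in> carrier affine_functions" "k \<in> carrier affine_functions"
  then obtain l c l' c' where *: "linear l" "h = (\<lambda>x. l x + c)" "linear l'" "k = (\<lambda>x. l' x + c')"
    by (auto simp: affine_functions_def)
  show "h \<oplus>\<^bsub>affine_functions\<^esub> k \<in> carrier affine_functions"
    using linear_compose_add[OF *(1,3)]
    by (auto simp: affine_functions_def * intro!: exI[of _ "\<lambda>x. l x + l' x"] exI[of _ "c + c'"])
next
  fix a h assume "h \<in> carrier affine_functions"
  then obtain l c where *: "linear l" "h = (\<lambda>x. l x + c)"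
    by (auto simp: affine_functions_def)
  show "a \<odot>\<^bsub>affine_functions\<^esub> h \<in> carrier affine_functions"
    using linear_compose_scale_right[OF *(1), of a]
    by (auto simp: affine_functions_def * algebra_simps intro!: exI[of _ "\<lambda>x. a * l x"] exI[of _ "a * c"])
qed (auto simp: affine_functions_def algebra_simps)

lemma real_module_subspace:
  assumes M: "real_module M"
    and S: "S \<subseteq> carrier M" "\<zero>\<^bsub>M\<^esub> \<in> S"
      "\<And>x y. x \<in> S \<Longrightarrow> y \<in> S \<Longrightarrow> x \<oplus>\<^bsub>M\<^esub> y \<in> S" "\<And>a x. x \<in> S \<Longrightarrow> a \<odot>\<^bsub>M\<^esub> x \<in> S"
  shows "real_module (M\<lparr>carrier := S\<rparr>)"
  by (rule real_moduleI)
    (use S in \<open>auto simp: real_moduleD(1-4,6-)[OF M] subset_iff intro: real_moduleD(5)[OF M]\<close>)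

definition linear_epi :: "'v real_space \<Rightarrow> 'w real_space \<Rightarrow> ('v \<Rightarrow> 'w) \<Rightarrow> bool" where
  "linear_epi M N \<phi> \<longleftrightarrow> \<phi> ` carrier M = carrier N \<and>
     (\<forall>x\<in>carrier M. \<forall>y\<in>carrier M. \<phi> (x \<oplus>\<^bsub>M\<^esub> y) = \<phi> x \<oplus>\<^bsub>N\<^esub> \<phi> y) \<and>
     (\<forall>a. \<forall>x\<in>carrier M. \<phi> (a \<odot>\<^bsub>M\<^esub> x) = a \<odot>\<^bsub>N\<^esub> \<phi> x)"

lemma linear_epiI:
  assumes "\<And>x. x \<in> carrier M \<Longrightarrow> \<phi> x \<in> carrier N"
    and "\<And>y. y \<in> carrier N \<Longrightarrow> \<exists>x\<in>carrier M. \<phi> x = y"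
    and "\<And>x y. x \<in> carrier M \<Longrightarrow> y \<in> carrier M \<Longrightarrow> \<phi> (x \<oplus>\<^bsub>M\<^esub> y) = \<phi> x \<oplus>\<^bsub>N\<^esub> \<phi> y"
    and "\<And>a x. x \<in> carrier M \<Longrightarrow> \<phi> (a \<odot>\<^bsub>M\<^esub> x) = a \<odot>\<^bsub>N\<^esub> \<phi> x"
  shows "linear_epi M N \<phi>"
  using assms unfolding linear_epi_def by blast

lemma linear_epiD:
  assumes "linear_epi M N \<phi>"
  shows "\<And>x. x \<in> carrier M \<Longrightarrow> \<phi> x \<in> carrier N"
    and "\<And>y. y \<in> carrier N \<Longrightarrow> \<exists>x\<in>carrier M. y = \<phi> x"
    and "\<And>x y. x \<in> carrier M \<Longrightarrow> y \<in> carrier M \<Longrightarrow> \<phi> (x \<oplus>\<^bsub>M\<^esub> y) = \<phi> x \<oplus>\<^bsub>N\<^esub> \<phi> y"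
    and "\<And>a x. x \<in> carrier M \<Longrightarrow> \<phi> (a \<odot>\<^bsub>M\<^esub> x) = a \<odot>\<^bsub>N\<^esub> \<phi> x"
  using assms unfolding linear_epi_def by blast+

lemma linear_epi_compose:
  assumes "linear_epi M N \<phi>" "linear_epi N P \<psi>"
  shows "linear_epi M P (\<psi> \<circ> \<phi>)"
proof (rule linear_epiI)
  note \<phi> = linear_epiD[OF assms(1)] and \<psi> = linear_epiD[OF assms(2)]
  show "(\<psi> \<circ> \<phi>) x \<in> carrier P" if "x \<in> carrier M" for x
    using \<phi>(1) \<psi>(1) that by simp
  show "\<exists>x\<in>carrier M. (\<psi> \<circ> \<phi>) x = z" if "z \<in> carrier P" for z
    using \<phi>(2) \<psi>(2)[OF that] by (metis comp_apply)
qed (use linear_epiD[OF assms(1)] linear_epiD[OF assms(2)] in simp_all)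

text \<open>
The module axioms are equations, so they pass to the image of a linear map; the existence of
inverses is an equation as well once the inverse of \<open>x\<close> is written as \<open>(-1) \<odot> x\<close>.  This makes
quotient spaces modules without a separate check of each axiom on cosets.
\<close>

lemma real_module_image:
  assumes M: "real_module M" and epi: "linear_epi M N \<phi>" and zero: "\<phi> \<zero>\<^bsub>M\<^esub> = \<zero>\<^bsub>N\<^esub>"
  shows "real_module N"
proof -
  note D = real_moduleD[OF M]
  note add = linear_epiD(3)[OF epi, symmetric] and scale = linear_epiD(4)[OF epi, symmetric]
    and img = linear_epiD(2)[OF epi] and cl = linear_epiD(1)[OF epi]
  show ?thesis
  proof (rule real_moduleI)
    show "\<zero>\<^bsub>N\<^esub> \<in> carrier N" using cl[OF D(1)] zero by simp
    show "x \<oplus>\<^bsub>N\<^esub> y \<in> carrier N" if "x \<in> carrier N" "y \<in> carrier N" for x y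
      using img[OF that(1)] img[OF that(2)] cl D(2) add by force
    show "a \<odot>\<^bsub>N\<^esub> x \<in> carrier N" if "x \<in> carrier N" for a x
      using img[OF that(1)] cl D(3) scale by force
    show "(x \<oplus>\<^bsub>N\<^esub> y) \<oplus>\<^bsub>N\<^esub> z = x \<oplus>\<^bsub>N\<^esub> (y \<oplus>\<^bsub>N\<^esub> z)"
      if "x \<in> carrier N" "y \<in> carrier N" "z \<in> carrier N" for x y z
      using img[OF that(1)] img[OF that(2)] img[OF that(3)] by (auto simp: add D(1-4,6-))
    show "x \<oplus>\<^bsub>N\<^esub> y = y \<oplus>\<^bsub>N\<^esub> x" if "x \<in> carrier N" "y \<in> carrier N" for x y
      using img[OF that(1)] img[OF that(2)] D(5) by (auto simp: add)
    show "\<zero>\<^bsub>N\<^esub> \<oplus>\<^bsub>N\<^esub> x = x" if "x \<in> carrier N" for x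
      using img[OF that] by (auto simp: zero[symmetric] add D(1-4,6-))
    show "((-1) \<odot>\<^bsub>N\<^esub> x) \<oplus>\<^bsub>N\<^esub> x = \<zero>\<^bsub>N\<^esub>" if "x \<in> carrier N" for x
      using img[OF that] by (auto simp: zero[symmetric] add scale D(1-4,6-))
    show "(a + b) \<odot>\<^bsub>N\<^esub> x = (a \<odot>\<^bsub>N\<^esub> x) \<oplus>\<^bsub>N\<^esub> (b \<odot>\<^bsub>N\<^esub> x)" if "x \<in> carrier N" for a b x
      using img[OF that] by (auto simp: add scale D(1-4,6-))
    show "a \<odot>\<^bsub>N\<^esub> (x \<oplus>\<^bsub>N\<^esub> y) = (a \<odot>\<^bsub>N\<^esub> x) \<oplus>\<^bsub>N\<^esub> (a \<odot>\<^bsub>N\<^esub> y)"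
      if "x \<in> carrier N" "y \<in> carrier N" for a x y
      using img[OF that(1)] img[OF that(2)] by (auto simp: add scale D)
    show "(a * b) \<odot>\<^bsub>N\<^esub> x = a \<odot>\<^bsub>N\<^esub> (b \<odot>\<^bsub>N\<^esub> x)" if "x \<in> carrier N" for a b x
      using img[OF that] by (auto simp: scale D)
    show "1 \<odot>\<^bsub>N\<^esub> x = x" if "x \<in> carrier N" for x
      using img[OF that] by (auto simp: scale D)
  qed
qed

definition linear_subspace :: "'v real_space \<Rightarrow> 'v set \<Rightarrow> bool" where
  "linear_subspace M H \<longleftrightarrow> H \<subseteq> carrier M \<and> \<zero>\<^bsub>M\<^esub> \<in> H \<and>
     (\<forall>x\<in>H. \<forall>y\<in>H. x \<oplus>\<^bsub>M\<^esub> y \<in> H) \<and> (\<forall>a. \<forall>x\<in>H. a \<odot>\<^bsub>M\<^esub> x \<in> H)"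

lemma linear_subspace_kernel:
  assumes "real_module M" "real_module N"
    and "\<And>x. x \<in> carrier M \<Longrightarrow> \<phi> x \<in> carrier N"
    and "\<And>x y. x \<in> carrier M \<Longrightarrow> y \<in> carrier M \<Longrightarrow> \<phi> (x \<oplus>\<^bsub>M\<^esub> y) = \<phi> x \<oplus>\<^bsub>N\<^esub> \<phi> y"
    and "\<And>a x. x \<in> carrier M \<Longrightarrow> \<phi> (a \<odot>\<^bsub>M\<^esub> x) = a \<odot>\<^bsub>N\<^esub> \<phi> x"
  shows "linear_subspace M {x \<in> carrier M. \<phi> x = \<zero>\<^bsub>N\<^esub>}"
proof -
  interpret N: Module.module real_ring N by (rule assms)
  note D = real_moduleD[OF assms(1)]
  have "\<phi> \<zero>\<^bsub>M\<^esub> = \<phi> (0 \<odot>\<^bsub>M\<^esub> \<zero>\<^bsub>M\<^esub>)"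
    using D(7)[OF D(1)] D(8)[OF D(1), of "-1" 1] D(11)[OF D(1)] by simp
  also have "\<dots> = 0 \<odot>\<^bsub>N\<^esub> \<phi> \<zero>\<^bsub>M\<^esub>" by (rule assms(5)[OF D(1)])
  also have "\<dots> = \<zero>\<^bsub>N\<^esub>"
    using N.smult_l_null[of "\<phi> \<zero>\<^bsub>M\<^esub>"] assms(3)[OF D(1)] by (simp add: ring_of_type_algebra_def)
  finally have "\<phi> \<zero>\<^bsub>M\<^esub> = \<zero>\<^bsub>N\<^esub>" .
  then show ?thesis
    using N.smult_r_null by (auto simp: linear_subspace_def D assms)
qed

lemma linear_subspace_image:
  assumes "real_module M" "real_module N"
    and "\<And>x. x \<in> carrier M \<Longrightarrow> \<phi> x \<in> carrier N"
    and "\<And>x y. x \<in> carrier M \<Longrightarrow> y \<in> carrier M \<Longrightarrow> \<phi> (x \<oplus>\<^bsub>M\<^esub> y) = \<phi> x \<oplus>\<^bsub>N\<^esub> \<phi> y"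
    and "\<And>a x. x \<in> carrier M \<Longrightarrow> \<phi> (a \<odot>\<^bsub>M\<^esub> x) = a \<odot>\<^bsub>N\<^esub> \<phi> x"
  shows "linear_subspace N (\<phi> ` carrier M)"
proof -
  note D = real_moduleD[OF assms(1)]
  have "\<zero>\<^bsub>M\<^esub> \<in> {x \<in> carrier M. \<phi> x = \<zero>\<^bsub>N\<^esub>}"
    using linear_subspace_kernel[OF assms] by (simp add: linear_subspace_def)
  then have "\<zero>\<^bsub>N\<^esub> \<in> \<phi> ` carrier M" by force
  then show ?thesis
    using assms(3) D(2,3) by (auto simp: linear_subspace_def assms(4,5)[symmetric])
qed

lemma coset_image: "H +>\<^bsub>M\<^esub> x = (\<lambda>h. h \<oplus>\<^bsub>M\<^esub> x) ` H"
  by (auto simp: a_r_coset_def')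

context
  fixes M :: "'v real_space" and H :: "'v set"
  assumes M: "real_module M" and H: "linear_subspace M H"
begin

interpretation M: Module.module real_ring M by (rule M)

lemma abelian_subgroup_of_linear_subspace: "abelian_subgroup H M"
proof -
  have "\<ominus>\<^bsub>M\<^esub> x \<in> H" if "x \<in> H" for x
  proof -
    have x: "x \<in> carrier M" using that H by (auto simp: linear_subspace_def)
    have "(-1) \<odot>\<^bsub>M\<^esub> x = \<ominus>\<^bsub>M\<^esub> x"
      using real_moduleD(7)[OF M x] x real_moduleD(3)[OF M x] by (metis M.minus_equality)
    moreover have "(-1) \<odot>\<^bsub>M\<^esub> x \<in> H" using H that by (auto simp: linear_subspace_def)
    ultimately show ?thesis by simp
  qed
  then have "submodule H real_ring M"
    using H by (intro M.submoduleI) (auto simp: linear_subspace_def)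
  then have "additive_subgroup H M"
    by (simp add: additive_subgroup_def submodule.axioms(1))
  then show ?thesis by (rule abelian_subgroupI3) (rule M.abelian_group_axioms)
qed

interpretation A: abelian_subgroup H M by (rule abelian_subgroup_of_linear_subspace)

lemma coset_carrier: "carrier (quot_space M H) = (\<lambda>x. H +>\<^bsub>M\<^esub> x) ` carrier M"
  by (auto simp: quot_space_def A_RCOSETS_def')

text \<open>
The scalar multiple of a coset is defined as a union over its elements; all members of the union
coincide because \<open>H\<close> is closed under scaling.
\<close>

lemma coset_smult:
  assumes "x \<in> carrier M"
  shows "(\<Union>y\<in>H +>\<^bsub>M\<^esub> x. H +>\<^bsub>M\<^esub> (a \<odot>\<^bsub>M\<^esub> y)) = H +>\<^bsub>M\<^esub> (a \<odot>\<^bsub>M\<^esub> x)"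
proof -
  have "H +>\<^bsub>M\<^esub> (a \<odot>\<^bsub>M\<^esub> y) = H +>\<^bsub>M\<^esub> (a \<odot>\<^bsub>M\<^esub> x)" if y: "y \<in> H +>\<^bsub>M\<^esub> x" for y
  proof -
    obtain h where h: "h \<in> H" "y = h \<oplus>\<^bsub>M\<^esub> x" using y by (auto simp: coset_image)
    then have "h \<in> carrier M" using H by (auto simp: linear_subspace_def)
    then have "a \<odot>\<^bsub>M\<^esub> y = (a \<odot>\<^bsub>M\<^esub> h) \<oplus>\<^bsub>M\<^esub> (a \<odot>\<^bsub>M\<^esub> x)"
      using h assms by (simp add: real_moduleD[OF M])
    moreover have "a \<odot>\<^bsub>M\<^esub> h \<in> H" using H h by (auto simp: linear_subspace_def)
    ultimately have "a \<odot>\<^bsub>M\<^esub> y \<in> H +>\<^bsub>M\<^esub> (a \<odot>\<^bsub>M\<^esub> x)" by (auto simp: coset_image)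
    then show ?thesis
      using A.a_repr_independence' assms by simp
  qed
  moreover have "x \<in> H +>\<^bsub>M\<^esub> x" using assms by (rule A.a_rcos_self)
  ultimately show ?thesis by blast
qed

lemma linear_epi_coset: "linear_epi M (quot_space M H) (\<lambda>x. H +>\<^bsub>M\<^esub> x)"
  unfolding linear_epi_def coset_carrier
  using A.a_rcos_sum coset_smult by (simp add: quot_space_def)

lemma coset_zero: "H +>\<^bsub>M\<^esub> \<zero>\<^bsub>M\<^esub> = \<zero>\<^bsub>quot_space M H\<^esub>"
  using A.a_subset by (simp add: quot_space_def M.a_coset_add_zero)

lemma real_module_quot_space: "real_module (quot_space M H)"
  using real_module_image[OF M linear_epi_coset coset_zero] .

lemma coset_eq_iff:
  assumes "x \<in> carrier M" "y \<in> carrier M"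
  shows "H +>\<^bsub>M\<^esub> x = H +>\<^bsub>M\<^esub> y \<longleftrightarrow> (\<exists>h\<in>H. x = h \<oplus>\<^bsub>M\<^esub> y)"
proof
  assume "H +>\<^bsub>M\<^esub> x = H +>\<^bsub>M\<^esub> y"
  then have "x \<in> H +>\<^bsub>M\<^esub> y" using A.a_rcos_self[OF assms(1)] by simp
  then show "\<exists>h\<in>H. x = h \<oplus>\<^bsub>M\<^esub> y" by (auto simp: coset_image)
next
  assume "\<exists>h\<in>H. x = h \<oplus>\<^bsub>M\<^esub> y"
  then have "x \<in> H +>\<^bsub>M\<^esub> y" by (auto simp: coset_image)
  then show "H +>\<^bsub>M\<^esub> x = H +>\<^bsub>M\<^esub> y" using A.a_repr_independence'[of x y] assms by simp
qed

lemma coset_eq_zero_iff: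
  assumes "x \<in> carrier M"
  shows "H +>\<^bsub>M\<^esub> x = \<zero>\<^bsub>quot_space M H\<^esub> \<longleftrightarrow> x \<in> H"
  unfolding coset_zero[symmetric] coset_eq_iff[OF assms M.zero_closed]
  using H by (auto simp: linear_subspace_def subset_iff)

end

lemma induced_map_coset:
  assumes "linear_subspace M H" "\<And>h. h \<in> H \<Longrightarrow> f (h \<oplus>\<^bsub>M\<^esub> x) = y"
  shows "induced_map f (H +>\<^bsub>M\<^esub> x) = y"
proof -
  have "f ` (H +>\<^bsub>M\<^esub> x) = (\<lambda>_. y) ` H"
    unfolding coset_image image_image by (rule image_cong) (simp_all add: assms(2))
  also have "\<dots> = {y}" using assms(1) by (auto simp: linear_subspace_def)
  finally show ?thesis by (simp add: induced_map_def)
qed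

lemma isomorphic_spaces_sym:
  assumes "M \<cong>\<^sub>V N"
  shows "N \<cong>\<^sub>V M"
proof -
  obtain \<phi> where b: "bij_betw \<phi> (carrier M) (carrier N)"
    and add: "\<And>x y. x \<in> carrier M \<Longrightarrow> y \<in> carrier M \<Longrightarrow> \<phi> (x \<oplus>\<^bsub>M\<^esub> y) = \<phi> x \<oplus>\<^bsub>N\<^esub> \<phi> y"
    and scale: "\<And>a x. x \<in> carrier M \<Longrightarrow> \<phi> (a \<odot>\<^bsub>M\<^esub> x) = a \<odot>\<^bsub>N\<^esub> \<phi> x"
    and M: "real_module M" and N: "real_module N"
    using assms by (auto simp: isomorphic_spaces_def linear_isos_def)
  let ?\<psi> = "inv_into (carrier M) \<phi>"
  have inv: "?\<psi> y \<in> carrier M" "\<phi> (?\<psi> y) = y" if "y \<in> carrier N" for y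
    using b that by (auto simp: bij_betw_def inv_into_into f_inv_into_f)
  have inj: "?\<psi> (\<phi> x) = x" if "x \<in> carrier M" for x
    using b that by (simp add: bij_betw_def)
  have "?\<psi> \<in> linear_isos N M"
    unfolding linear_isos_def mem_Collect_eq
  proof (intro conjI ballI allI)
    show "bij_betw ?\<psi> (carrier N) (carrier M)" using b by (rule bij_betw_inv_into)
    fix x y assume "x \<in> carrier N" "y \<in> carrier N"
    then show "?\<psi> (x \<oplus>\<^bsub>N\<^esub> y) = ?\<psi> x \<oplus>\<^bsub>M\<^esub> ?\<psi> y"
      using inj[of "?\<psi> x \<oplus>\<^bsub>M\<^esub> ?\<psi> y"] by (simp add: add inv real_moduleD(2)[OF M])
  next
    fix a x assume "x \<in> carrier N"
    then show "?\<psi> (a \<odot>\<^bsub>N\<^esub> x) = a \<odot>\<^bsub>M\<^esub> ?\<psi> x"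
      using inj[of "a \<odot>\<^bsub>M\<^esub> ?\<psi> x"] by (simp add: scale inv real_moduleD(3)[OF M])
  qed
  then show ?thesis using M N by (auto simp: isomorphic_spaces_def)
qed

lemma isomorphic_spaces_trans:
  assumes "M \<cong>\<^sub>V N" "N \<cong>\<^sub>V P"
  shows "M \<cong>\<^sub>V P"
proof -
  obtain \<phi> \<psi> where \<phi>: "\<phi> \<in> linear_isos M N" and \<psi>: "\<psi> \<in> linear_isos N P"
    using assms by (auto simp: isomorphic_spaces_def)
  have "\<phi> x \<in> carrier N" if "x \<in> carrier M" for x
    using \<phi> that by (auto simp: linear_isos_def bij_betw_def)
  then have "\<psi> \<circ> \<phi> \<in> linear_isos M P"
    using \<phi> \<psi> by (auto simp: linear_isos_def intro: bij_betw_trans)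
  then show ?thesis using assms by (auto simp: isomorphic_spaces_def)
qed

lemma isomorphic_spacesI:
  assumes M: "real_module M" and N: "real_module N" and epi: "linear_epi M N \<phi>"
    and ker: "\<And>x. x \<in> carrier M \<Longrightarrow> \<phi> x = \<zero>\<^bsub>N\<^esub> \<Longrightarrow> x = \<zero>\<^bsub>M\<^esub>"
  shows "M \<cong>\<^sub>V N"
proof -
  interpret M: Module.module real_ring M by (rule M)
  interpret N: Module.module real_ring N by (rule N)
  note D = real_moduleD[OF M] and DN = real_moduleD[OF N]
  have "x = y" if xy: "x \<in> carrier M" "y \<in> carrier M" "\<phi> x = \<phi> y" for x y
  proof -
    have m: "(-1) \<odot>\<^bsub>M\<^esub> y \<in> carrier M" using D(3) xy by blast
    have "\<phi> (((-1) \<odot>\<^bsub>M\<^esub> y) \<oplus>\<^bsub>M\<^esub> x) = ((-1) \<odot>\<^bsub>N\<^esub> \<phi> y) \<oplus>\<^bsub>N\<^esub> \<phi> x"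
      using linear_epiD(3)[OF epi m xy(1)] linear_epiD(4)[OF epi xy(2), of "-1"] by simp
    also have "\<dots> = \<zero>\<^bsub>N\<^esub>" using xy(3) DN(7) linear_epiD(1)[OF epi xy(2)] by simp
    finally have "((-1) \<odot>\<^bsub>M\<^esub> y) \<oplus>\<^bsub>M\<^esub> x = \<zero>\<^bsub>M\<^esub>"
      by (rule ker[rotated]) (use m xy in simp)
    moreover have "((-1) \<odot>\<^bsub>M\<^esub> y) \<oplus>\<^bsub>M\<^esub> y = \<zero>\<^bsub>M\<^esub>" using D(7) xy by simp
    ultimately show ?thesis using m xy M.add.l_cancel by metis
  qed
  then have "\<phi> \<in> linear_isos M N"
    using epi by (auto simp: linear_isos_def linear_epi_def bij_betw_def inj_on_def)
  then show ?thesis using M N by (auto simp: isomorphic_spaces_def)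
qed

text \<open>
The two quotients in the theorem, by translations and by global affine functions, are both
recognised through this lemma: it suffices to find a surjection with the right kernel.
\<close>

lemma first_isomorphism:
  assumes M: "real_module M" and N: "real_module N" and epi: "linear_epi M N \<phi>"
    and H: "H = {x \<in> carrier M. \<phi> x = \<zero>\<^bsub>N\<^esub>}"
  shows "quot_space M H \<cong>\<^sub>V N"
proof -
  have sub: "linear_subspace M H"
    unfolding H using linear_epiD[OF epi] by (intro linear_subspace_kernel M N)
  note D = real_moduleD[OF M] and DN = real_moduleD[OF N]
  have ind: "induced_map \<phi> (H +>\<^bsub>M\<^esub> x) = \<phi> x" if x: "x \<in> carrier M" for x
  proof -
    have "\<phi> (h \<oplus>\<^bsub>M\<^esub> x) = \<phi> x" if "h \<in> H" for h
      using that x linear_epiD(1,3)[OF epi] DN(6) by (auto simp: H)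
    then show ?thesis using sub by (intro induced_map_coset) auto
  qed
  note Q = linear_epi_coset[OF M sub]
  note car = coset_carrier[OF M sub]
  have "linear_epi (quot_space M H) N (induced_map \<phi>)"
  proof (rule linear_epiI)
    fix A B assume A: "A \<in> carrier (quot_space M H)" and B: "B \<in> carrier (quot_space M H)"
    then obtain x y where x: "x \<in> carrier M" "A = H +>\<^bsub>M\<^esub> x" and y: "y \<in> carrier M" "B = H +>\<^bsub>M\<^esub> y"
      by (auto simp: car)
    show "induced_map \<phi> (A \<oplus>\<^bsub>quot_space M H\<^esub> B) = induced_map \<phi> A \<oplus>\<^bsub>N\<^esub> induced_map \<phi> B"
      using linear_epiD(3)[OF Q x(1) y(1)] linear_epiD(3)[OF epi x(1) y(1)] ind D(2) x y by metis
  next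
    fix a A assume "A \<in> carrier (quot_space M H)"
    then obtain x where x: "x \<in> carrier M" "A = H +>\<^bsub>M\<^esub> x" by (auto simp: car)
    show "induced_map \<phi> (a \<odot>\<^bsub>quot_space M H\<^esub> A) = a \<odot>\<^bsub>N\<^esub> induced_map \<phi> A"
      using linear_epiD(4)[OF Q x(1)] linear_epiD(4)[OF epi x(1)] ind D(3) x by metis
  next
    fix A assume "A \<in> carrier (quot_space M H)"
    then show "induced_map \<phi> A \<in> carrier N" using ind linear_epiD(1)[OF epi] by (auto simp: car)
  next
    fix y assume "y \<in> carrier N"
    then obtain x where "x \<in> carrier M" "y = \<phi> x" using linear_epiD(2)[OF epi] by blast
    then show "\<exists>A\<in>carrier (quot_space M H). induced_map \<phi> A = y" using ind by (auto simp: car)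
  qed
  then show ?thesis
  proof (rule isomorphic_spacesI[OF real_module_quot_space[OF M sub] N])
    fix A assume "A \<in> carrier (quot_space M H)" "induced_map \<phi> A = \<zero>\<^bsub>N\<^esub>"
    then obtain x where x: "x \<in> carrier M" "A = H +>\<^bsub>M\<^esub> x" "\<phi> x = \<zero>\<^bsub>N\<^esub>" using ind by (auto simp: car)
    then have "x \<in> H" by (simp add: H)
    then show "A = \<zero>\<^bsub>quot_space M H\<^esub>" using coset_eq_zero_iff[OF M sub x(1)] x(2) by simp
  qed
qed

lemma a_kernel_eq: "a_kernel M N f = {x \<in> carrier M. f x = \<zero>\<^bsub>N\<^esub>}"
  by (auto simp: a_kernel_def')

lemma real_module_ker_space:
  assumes "real_module M" "linear_subspace M {x \<in> carrier M. f x = \<zero>\<^bsub>N\<^esub>}"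
  shows "real_module (ker_space M N f)"
  unfolding ker_space_def a_kernel_eq
  by (rule real_module_subspace[OF assms(1)]) (use assms(2) in \<open>auto simp: linear_subspace_def\<close>)

section \<open>Orthogonal projection and simultaneous approximation\<close>

text \<open>
Orthogonal projection of \<open>x\<close> onto the span of finitely many functions \<open>g j\<close>, with respect to the
inner product summed over \<open>I\<close>.  Functions on a finite index set inside an infinite type do not form
a Euclidean space, so the projection is built by one Gram-Schmidt step per generator.
\<close>

lemma normal_equations:
  fixes g :: "'j \<Rightarrow> 'i \<Rightarrow> 'v::real_inner"
  assumes "finite J" "finite I"
  shows "\<exists>a. \<forall>j\<in>J. (\<Sum>i\<in>I. (x i - (\<Sum>k\<in>J. a k *\<^sub>R g k i)) \<bullet> g j i) = 0"
  using \<open>finite J\<close>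
proof (induction J arbitrary: x)
  case empty
  then show ?case by simp
next
  case (insert j J)
  obtain a where a: "\<forall>k\<in>J. (\<Sum>i\<in>I. (x i - (\<Sum>k\<in>J. a k *\<^sub>R g k i)) \<bullet> g k i) = 0"
    using insert.IH[of x] by blast
  obtain b where b: "\<forall>k\<in>J. (\<Sum>i\<in>I. (g j i - (\<Sum>k\<in>J. b k *\<^sub>R g k i)) \<bullet> g k i) = 0"
    using insert.IH[of "g j"] by blast
  define r where "r i = x i - (\<Sum>k\<in>J. a k *\<^sub>R g k i)" for i
  define u where "u i = g j i - (\<Sum>k\<in>J. b k *\<^sub>R g k i)" for i
  \<comment> \<open>If u vanishes on I then t = 0 by the convention for division by zero, which is the right value.\<close>
  define t where "t = (\<Sum>i\<in>I. r i \<bullet> u i) / (\<Sum>i\<in>I. u i \<bullet> u i)"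
  define a' where "a' k = (if k = j then t else a k - t * b k)" for k
  have res: "x i - (\<Sum>k\<in>insert j J. a' k *\<^sub>R g k i) = r i - t *\<^sub>R u i" for i
  proof -
    have "(\<Sum>k\<in>J. a' k *\<^sub>R g k i) = (\<Sum>k\<in>J. a k *\<^sub>R g k i) - t *\<^sub>R (\<Sum>k\<in>J. b k *\<^sub>R g k i)"
      unfolding scaleR_sum_right sum_subtractf[symmetric] using insert.hyps(2)
      by (intro sum.cong) (auto simp: a'_def scaleR_diff_left)
    then show ?thesis
      using insert.hyps by (simp add: a'_def r_def u_def algebra_simps)
  qed
  have old: "(\<Sum>i\<in>I. (r i - t *\<^sub>R u i) \<bullet> g k i) = 0" if "k \<in> J" for k
    using a b that by (simp add: inner_diff_left sum_subtractf flip: r_def u_def sum_distrib_left)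
  have "(\<Sum>i\<in>I. (r i - t *\<^sub>R u i) \<bullet> u i) = 0"
  proof (cases "(\<Sum>i\<in>I. u i \<bullet> u i) = 0")
    case True
    then have "u i = 0" if "i \<in> I" for i
      using that \<open>finite I\<close> by (simp add: sum_nonneg_eq_0_iff)
    then show ?thesis by simp
  next
    case False
    have "(\<Sum>i\<in>I. (r i - t *\<^sub>R u i) \<bullet> u i) = (\<Sum>i\<in>I. r i \<bullet> u i) - t * (\<Sum>i\<in>I. u i \<bullet> u i)"
      by (simp add: inner_diff_left sum_subtractf sum_distrib_left)
    with False show ?thesis by (simp add: t_def)
  qed
  moreover have "(\<Sum>i\<in>I. (r i - t *\<^sub>R u i) \<bullet> (\<Sum>k\<in>J. b k *\<^sub>R g k i)) = 0"
  proof -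
    have "(\<Sum>i\<in>I. (r i - t *\<^sub>R u i) \<bullet> (\<Sum>k\<in>J. b k *\<^sub>R g k i))
        = (\<Sum>k\<in>J. b k * (\<Sum>i\<in>I. (r i - t *\<^sub>R u i) \<bullet> g k i))"
      by (simp add: inner_sum_right sum_distrib_left) (rule sum.swap)
    then show ?thesis using old by simp
  qed
  ultimately have "(\<Sum>i\<in>I. (r i - t *\<^sub>R u i) \<bullet> (u i + (\<Sum>k\<in>J. b k *\<^sub>R g k i))) = 0"
    by (simp add: inner_add_right sum.distrib)
  moreover have "u i + (\<Sum>k\<in>J. b k *\<^sub>R g k i) = g j i" for i by (simp add: u_def)
  ultimately have "(\<Sum>i\<in>I. (r i - t *\<^sub>R u i) \<bullet> g j i) = 0" by simp
  with old have "\<forall>k\<in>insert j J. (\<Sum>i\<in>I. (x i - (\<Sum>k\<in>insert j J. a' k *\<^sub>R g k i)) \<bullet> g k i) = 0"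
    unfolding res by blast
  then show ?case by blast
qed

lemma simultaneous_approximation:
  fixes z :: "'i \<Rightarrow> real"
  assumes "finite I" "N > 0"
  obtains q :: int and p :: "'i \<Rightarrow> int" where "q > 0"
    "\<And>i. i \<in> I \<Longrightarrow> \<bar>of_int q * z i - of_int (p i)\<bar> < 1 / real N"
proof -
  obtain h where h: "bij_betw h I {0..<card I}" using ex_bij_betw_finite_nat[OF assms(1)] by blast
  obtain q p where qp: "0 < q" "q \<le> int (N ^ card I)"
    "\<And>n. n < card I \<Longrightarrow> \<bar>of_int q * z (inv_into I h n) - of_int (p n)\<bar> < 1 / real N"
    by (rule Dirichlet_approx_simult[OF assms(2), of "card I" "\<lambda>n. z (inv_into I h n)"]) blast
  have "\<bar>of_int q * z i - of_int (p (h i))\<bar> < 1 / real N" if "i \<in> I" for i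
    using qp(3)[of "h i"] bij_betwE[OF h] bij_betw_inv_into_left[OF h that] that by auto
  then show thesis by (rule that[OF qp(1)])
qed

section \<open>Lifts of circle-valued maps\<close>

lemma cis_2pi_eq_iff: "cis (2 * pi * a) = cis (2 * pi * b) \<longleftrightarrow> a - b \<in> \<int>"
proof -
  have "cis (2 * pi * a) = cis (2 * pi * b) \<longleftrightarrow> cis (2 * pi * (a - b)) = 1"
    by (simp add: right_diff_distrib flip: cis_divide)
  also have "\<dots> \<longleftrightarrow> cos (2 * pi * (a - b)) = 1"
    using cos_one_sin_zero[of "2 * pi * (a - b)"] by (simp add: complex_eq_iff) blast
  also have "\<dots> \<longleftrightarrow> (\<exists>n::int. a - b = of_int n)"
    by (simp add: cos_one_2pi_int)
  finally show ?thesis by (simp add: Ints_def image_iff)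
qed

text \<open>
The difference of two lifts is continuous and integer valued, hence constant on a connected set.
\<close>

lemma circle_lifts_differ_by_constant:
  fixes \<alpha> \<beta> :: "'a::topological_space \<Rightarrow> real"
  assumes T: "connected T" and cont: "continuous_on T \<alpha>" "continuous_on T \<beta>"
    and eq: "\<And>x. x \<in> T \<Longrightarrow> cis (2 * pi * \<alpha> x) = cis (2 * pi * \<beta> x)"
    and xy: "x \<in> T" "y \<in> T"
  shows "\<alpha> x - \<beta> x = \<alpha> y - \<beta> y"
proof -
  have int: "\<alpha> x - \<beta> x \<in> \<int>" if "x \<in> T" for x
    using eq[OF that] by (simp add: cis_2pi_eq_iff)
  have "(\<lambda>x. \<alpha> x - \<beta> x) constant_on T"
  proof (rule continuous_discrete_range_constant[OF T])
    show "continuous_on T (\<lambda>x. \<alpha> x - \<beta> x)" using cont by (intro continuous_intros)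
    fix x assume x: "x \<in> T"
    have "1 \<le> norm (\<alpha> y - \<beta> y - (\<alpha> x - \<beta> x))"
      if "y \<in> T" "\<alpha> y - \<beta> y \<noteq> \<alpha> x - \<beta> x" for y
      using Ints_nonzero_abs_ge1[OF Ints_diff[OF int[OF that(1)] int[OF x]]] that(2) by simp
    then show "\<exists>e>0. \<forall>y. y \<in> T \<and> \<alpha> y - \<beta> y \<noteq> \<alpha> x - \<beta> x \<longrightarrow>
        e \<le> norm (\<alpha> y - \<beta> y - (\<alpha> x - \<beta> x))"
      by (intro exI[of _ 1]) auto
  qed
  with xy show ?thesis by (auto simp: constant_on_def)
qed

lemma Borsukian_circle_lift:
  fixes \<psi> :: "'a::real_normed_vector \<Rightarrow> complex"
  assumes "Borsukian T" "continuous_on T \<psi>" "\<And>x. x \<in> T \<Longrightarrow> norm (\<psi> x) = 1"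
  obtains \<theta> :: "'a \<Rightarrow> real" where "continuous_on T \<theta>" "\<And>x. x \<in> T \<Longrightarrow> \<psi> x = cis (2 * pi * \<theta> x)"
proof -
  obtain g where g: "continuous_on T (complex_of_real \<circ> g)" "\<forall>x\<in>T. \<psi> x = exp (\<i> * of_real (g x))"
    using assms unfolding Borsukian_continuous_logarithm_circle_real by (force simp: Pi_iff)
  have "continuous_on T (\<lambda>x. Re ((complex_of_real \<circ> g) x))"
    using g(1) by (rule continuous_on_Re)
  then have "continuous_on T (\<lambda>x. g x / (2 * pi))"
    by (intro continuous_intros) auto
  moreover have "\<psi> x = cis (2 * pi * (g x / (2 * pi)))" if "x \<in> T" for x
    using g(2) that by (simp add: cis_conv_exp)
  ultimately show thesis using that by blast
qed

section \<open>Cell decompositions of the sphere\<close>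

locale sphere_complex =
  fixes K :: "(real^3) cell_complex"
  assumes decomposition: "sphere_decomposition K"
begin

abbreviation "V \<equiv> verts K"
abbreviation "E \<equiv> edges K"
abbreviation "F \<equiv> faces K"

lemma regular: "regular_cell_complex (sphere 0 1) K"
  and signed: "signed_incidence K"
  using decomposition by (auto simp: sphere_decomposition_def)

lemma finite_cells [simp]: "finite (cells K)"
  using regular by (simp add: regular_cell_complex_def)

lemma finite_verts [simp]: "finite V" and finite_edges [simp]: "finite E" and finite_faces [simp]: "finite F"
  using finite_cells by (auto simp: cells_def)

lemma cellI: "v \<in> V \<Longrightarrow> v \<in> cells K" "e \<in> E \<Longrightarrow> e \<in> cells K" "f \<in> F \<Longrightarrow> f \<in> cells K"
  by (auto simp: cells_def)

lemma cells_disjoint: "c \<in> cells K \<Longrightarrow> d \<in> cells K \<Longrightarrow> x \<in> c \<Longrightarrow> x \<in> d \<Longrightarrow> c = d"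
  using regular unfolding regular_cell_complex_def by (metis disjnt_iff pairwiseD)

lemma cells_cover: "\<Union>(cells K) = sphere 0 1"
  using regular by (simp add: regular_cell_complex_def)

lemma vert_singleton: "v \<in> V \<Longrightarrow> \<exists>x. v = {x}"
  using regular by (simp add: regular_cell_complex_def)

lemma edge_arc:
  assumes "e \<in> E"
  obtains f g where "homeomorphism (cball (0::real) 1) (closure e) f g" "f ` ball 0 1 = e"
    "closure e - e = \<Union>{v \<in> V. v \<lhd>\<^sub>c e}"
  using regular assms by (auto simp: regular_cell_complex_def disk_cell_def)

lemma face_disk:
  assumes "c \<in> F"
  obtains f g where "homeomorphism (cball (0::real^2) 1) (closure c) f g" "f ` ball 0 1 = c"
    "closure c - c = \<Union>{d \<in> V \<union> E. d \<lhd>\<^sub>c c}"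
  using regular assms by (auto simp: regular_cell_complex_def disk_cell_def)

definition face_boundary :: "(real^3) set \<Rightarrow> (real^3) set" where
  "face_boundary f = closure f - f"

lemma face_boundary_homeomorphism:
  assumes "f \<in> F"
  obtains h k where "homeomorphism (sphere (0::real^2) 1) (face_boundary f) h k"
proof -
  obtain h k where hk: "homeomorphism (cball (0::real^2) 1) (closure f) h k" "h ` ball 0 1 = f"
    using face_disk[OF assms] by metis
  have inj: "inj_on h (cball 0 1)"
    using homeomorphism_apply1[OF hk(1)] by (intro inj_on_inverseI[of _ k]) auto
  have "h ` (cball 0 1 - ball 0 1) = h ` cball 0 1 - h ` ball 0 1"
    by (rule inj_on_image_set_diff[OF inj]) auto
  then have "h ` sphere 0 1 = face_boundary f"
    using hk by (simp add: homeomorphism_image1 cball_diff_eq_sphere face_boundary_def)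
  then have "homeomorphism (sphere 0 1) (face_boundary f) h k"
    using hk(1) by (intro homeomorphism_of_subsets[OF hk(1)]) auto
  then show thesis by (rule that)
qed

lemma incid_range: "c \<in> cells K \<Longrightarrow> d \<in> cells K \<Longrightarrow> incid K c d \<in> {-1, 0, 1}"
  using signed by (simp add: signed_incidence_def)

text \<open>
A closed edge is a homeomorphic image of \<open>[-1, 1]\<close>, so it has exactly two endpoints; the sign rule
for their incidences orients it, and the homeomorphism, reversed if necessary, becomes a
parameter running from 0 at the negative to 1 at the positive endpoint.
\<close>

lemma edge_endpoints:
  assumes "e \<in> E"
  obtains u v t where "u \<in> V" "v \<in> V" "u \<noteq> v" "closure e - e = u \<union> v"
    "{w \<in> V. w \<lhd>\<^sub>c e} = {u, v}" "continuous_on (closure e) (t :: real^3 \<Rightarrow> real)"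
    "\<And>x. x \<in> u \<Longrightarrow> t x = 0" "\<And>x. x \<in> v \<Longrightarrow> t x = 1" "incid K u e = -1" "incid K v e = 1"
proof -
  obtain f g where fg: "homeomorphism (cball (0::real) 1) (closure e) f g" "f ` ball 0 1 = e"
    and bd: "closure e - e = \<Union>{v \<in> V. v \<lhd>\<^sub>c e}"
    by (rule edge_arc[OF assms])
  have inj: "inj_on f (cball 0 1)"
    using homeomorphism_apply1[OF fg(1)] by (intro inj_on_inverseI[of _ g]) auto
  have "f ` (cball 0 1 - ball 0 1) = f ` cball 0 1 - f ` ball 0 1"
    by (rule inj_on_image_set_diff[OF inj]) auto
  then have "closure e - e = f ` (cball 0 1 - ball 0 1)"
    using fg by (simp add: homeomorphism_image1)
  also have "cball 0 1 - ball 0 1 = {-1, 1::real}"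
    by (auto simp: dist_real_def)
  finally have two: "closure e - e = {f (-1), f 1}" by simp
  have ne: "f (-1) \<noteq> f 1" using inj_onD[OF inj, of "-1" 1] by (auto simp: dist_real_def)
  have vert: "\<exists>u\<in>V. u \<lhd>\<^sub>c e \<and> u = {x}" if "x \<in> closure e - e" for x
    using that unfolding bd using vert_singleton by fastforce
  have sub: "w \<in> {{f (-1)}, {f 1}}" if "w \<in> V" "w \<lhd>\<^sub>c e" for w
  proof -
    obtain x where "w = {x}" using vert_singleton \<open>w \<in> V\<close> by blast
    moreover have "w \<subseteq> closure e - e" using that bd by blast
    ultimately show ?thesis using two by auto
  qed
  have set: "{w \<in> V. w \<lhd>\<^sub>c e} = {{f (-1)}, {f 1}}"
  proof -
    have "{f (-1)} \<in> {w \<in> V. w \<lhd>\<^sub>c e}" "{f 1} \<in> {w \<in> V. w \<lhd>\<^sub>c e}"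
      using vert[of "f (-1)"] vert[of "f 1"] two by simp_all
    then show ?thesis using sub by blast
  qed
  have V: "{f (-1)} \<in> V" "{f 1} \<in> V" and lt: "{f (-1)} \<lhd>\<^sub>c e" "{f 1} \<lhd>\<^sub>c e" using set by auto
  have sgn: "incid K {f (-1)} e * incid K {f 1} e = -1"
    using signed assms V lt ne by (auto simp: signed_incidence_def)
  have vals: "incid K {f (-1)} e \<in> {-1,0,1}" "incid K {f 1} e \<in> {-1,0,1}"
    using incid_range V assms cellI by blast+
  have g: "continuous_on (closure e) g" "g (f (-1)) = -1" "g (f 1) = 1"
    using homeomorphism_cont2[OF fg(1)] homeomorphism_apply1[OF fg(1), of "-1"]
      homeomorphism_apply1[OF fg(1), of 1] by (simp_all add: dist_real_def)
  consider "incid K {f (-1)} e = -1" "incid K {f 1} e = 1" | "incid K {f (-1)} e = 1" "incid K {f 1} e = -1"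
    using sgn vals by auto
  then show thesis
  proof cases
    case 1
    show thesis
    proof (rule that[OF V _ _ set])
      show "continuous_on (closure e) (\<lambda>x. (g x + 1) / 2)" using g(1) by (intro continuous_intros) auto
    qed (use 1 ne two g in \<open>simp_all add: insert_commute\<close>)
  next
    case 2
    show thesis
    proof (rule that[OF V(2,1)])
      show "continuous_on (closure e) (\<lambda>x. (1 - g x) / 2)" using g(1) by (intro continuous_intros) auto
      show "{w \<in> V. w \<lhd>\<^sub>c e} = {{f 1}, {f (- 1)}}" using set by (simp add: insert_commute)
      show "closure e - e = {f 1} \<union> {f (- 1)}" using two by (simp add: insert_commute)
    qed (use 2 ne g in simp_all)
  qed
qed


lemma vert_closed: "v \<in> V \<Longrightarrow> closure v = v"
  using vert_singleton by fastforce

lemma verts_edges_disjoint: "c \<in> V \<Longrightarrow> c \<in> E \<Longrightarrow> False"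
proof -
  assume "c \<in> V" "c \<in> E"
  from \<open>c \<in> E\<close> obtain u v where "u \<in> V" "closure c - c = u \<union> v" by (rule edge_endpoints)
  then show False using vert_closed[OF \<open>c \<in> V\<close>] vert_singleton[OF \<open>u \<in> V\<close>] by auto
qed

lemma compact_face_boundary:
  assumes "f \<in> F"
  shows "compact (face_boundary f)"
proof -
  obtain h k where hk: "homeomorphism (sphere (0::real^2) 1) (face_boundary f) h k"
    using assms by (rule face_boundary_homeomorphism)
  then show ?thesis
    using compact_continuous_image[OF homeomorphism_cont1[OF hk]] homeomorphism_image1[OF hk] by simp
qed

lemma connected_face_boundary:
  assumes "f \<in> F"
  shows "connected (face_boundary f)"
proof -
  obtain h k where hk: "homeomorphism (sphere (0::real^2) 1) (face_boundary f) h k"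
    using assms by (rule face_boundary_homeomorphism)
  have "connected (sphere (0::real^2) 1)"
    by (rule connected_sphere) simp
  then show ?thesis
    using connected_continuous_image[OF homeomorphism_cont1[OF hk]] homeomorphism_image1[OF hk] by simp
qed

lemma infinite_face_boundary:
  assumes "f \<in> F"
  shows "infinite (face_boundary f)"
proof
  assume fin: "finite (face_boundary f)"
  obtain h k where hk: "homeomorphism (sphere (0::real^2) 1) (face_boundary f) h k"
    using assms by (rule face_boundary_homeomorphism)
  have pts: "axis 1 1 \<in> sphere (0::real^2) 1" "- axis 1 1 \<in> sphere (0::real^2) 1"
    by (simp_all add: norm_axis_1)
  have "h (axis 1 1) = h (- axis 1 1)"
  proof -
    have "face_boundary f = {} \<or> (\<exists>x. face_boundary f = {x})"
      using connected_finite_iff_sing[OF connected_face_boundary[OF assms]] fin by blast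
    moreover have "h (axis 1 1) \<in> face_boundary f" "h (- axis 1 1) \<in> face_boundary f"
      using homeomorphism_image1[OF hk] pts by blast+
    ultimately show ?thesis by auto
  qed
  then have "axis 1 1 = (- axis 1 1 :: real^2)"
    using homeomorphism_apply1[OF hk] pts by metis
  then have "(axis 1 1 :: real^2) $ 1 = (- axis 1 1 :: real^2) $ 1" by (rule arg_cong)
  then show False by (simp add: axis_def)
qed

text \<open>
A circle without one point is a line, so every circle-valued map on it has a continuous logarithm.
\<close>

lemma Borsukian_punctured_face_boundary:
  assumes "f \<in> F" "x \<in> face_boundary f"
  shows "Borsukian (face_boundary f - {x})"
proof -
  obtain h k where hk: "homeomorphism (sphere (0::real^2) 1) (face_boundary f) h k"
    using assms(1) by (rule face_boundary_homeomorphism)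
  have kx: "k x \<in> sphere 0 1" "h (k x) = x"
    using homeomorphism_image2[OF hk] homeomorphism_apply2[OF hk] assms(2) by auto
  have "inj_on h (sphere 0 1)"
    using homeomorphism_apply1[OF hk] by (intro inj_on_inverseI[of _ k]) auto
  then have "h ` (sphere 0 1 - {k x}) = h ` sphere 0 1 - h ` {k x}"
    by (rule inj_on_image_set_diff) (use kx in auto)
  then have "h ` (sphere 0 1 - {k x}) = face_boundary f - {x}"
    using homeomorphism_image1[OF hk] kx by simp
  then have "homeomorphism (sphere 0 1 - {k x}) (face_boundary f - {x}) h k"
    by (intro homeomorphism_of_subsets[OF hk]) auto
  then have "face_boundary f - {x} homeomorphic sphere 0 1 - {k x}"
    using homeomorphic_def homeomorphic_sym by blast
  also have "\<dots> homeomorphic {y::real^2. axis 1 1 \<bullet> y = 0}"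
    by (rule homeomorphic_punctured_sphere_hyperplane[OF zero_less_one kx(1)]) (simp add: axis_eq_0_iff)
  finally show ?thesis
    using homeomorphic_Borsukian_eq convex_imp_Borsukian[OF convex_hyperplane] by blast
qed

text \<open>
The boundary of a cell tells its dimension: it is empty, has two points, or is infinite.  This is
what makes \<^const>\<open>cell_dim\<close> meaningful, since the three families of cells are merely given as sets.
\<close>

lemma faces_disjoint: "c \<in> F \<Longrightarrow> c \<in> V \<or> c \<in> E \<Longrightarrow> False"
proof -
  assume "c \<in> F" and "c \<in> V \<or> c \<in> E"
  from \<open>c \<in> V \<or> c \<in> E\<close> have "finite (face_boundary c)"
  proof
    assume "c \<in> V"
    then show ?thesis by (simp add: face_boundary_def vert_closed)
  next
    assume "c \<in> E"
    then obtain u v where "u \<in> V" "v \<in> V" "closure c - c = u \<union> v" by (rule edge_endpoints)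
    then show ?thesis using vert_singleton[of u] vert_singleton[of v] by (auto simp: face_boundary_def)
  qed
  then show False using infinite_face_boundary[OF \<open>c \<in> F\<close>] by simp
qed

lemma cell_types_disjoint:
  "c \<in> V \<Longrightarrow> c \<notin> E" "c \<in> V \<Longrightarrow> c \<notin> F" "c \<in> E \<Longrightarrow> c \<notin> V" "c \<in> E \<Longrightarrow> c \<notin> F"
  "c \<in> F \<Longrightarrow> c \<notin> V" "c \<in> F \<Longrightarrow> c \<notin> E"
  using verts_edges_disjoint faces_disjoint by blast+

lemma cell_dim_simps:
  "c \<in> V \<Longrightarrow> cell_dim K c = 0" "c \<in> E \<Longrightarrow> cell_dim K c = 1" "c \<in> F \<Longrightarrow> cell_dim K c = 2"
  using cell_types_disjoint(3)[of c] cell_types_disjoint(5,6)[of c] by (simp_all add: cell_dim_def)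

lemma incid_nonzero_iff:
  assumes "c \<in> cells K" "d \<in> cells K"
  shows "incid K c d \<noteq> 0 \<longleftrightarrow> c \<lhd>\<^sub>c d \<and> cell_dim K d = cell_dim K c + 1"
  using signed assms by (simp add: signed_incidence_def)

lemma incid_vert_edge: "v \<in> V \<Longrightarrow> e \<in> E \<Longrightarrow> incid K v e \<noteq> 0 \<longleftrightarrow> v \<lhd>\<^sub>c e"
  using incid_nonzero_iff[of v e] by (simp add: cellI cell_dim_simps)

lemma incid_edge_face: "e \<in> E \<Longrightarrow> f \<in> F \<Longrightarrow> incid K e f \<noteq> 0 \<longleftrightarrow> e \<lhd>\<^sub>c f"
  using incid_nonzero_iff[of e f] by (simp add: cellI cell_dim_simps)

definition tail :: "(real^3) set \<Rightarrow> (real^3) set" where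
  "tail e = (THE u. u \<in> V \<and> incid K u e = -1)"

definition head :: "(real^3) set \<Rightarrow> (real^3) set" where
  "head e = (THE u. u \<in> V \<and> incid K u e = 1)"

definition param :: "(real^3) set \<Rightarrow> real^3 \<Rightarrow> real" where
  "param e = (SOME t. continuous_on (closure e) t \<and> (\<forall>x\<in>tail e. t x = 0) \<and> (\<forall>x\<in>head e. t x = 1))"

lemma edge_ends:
  assumes "e \<in> E"
  shows tail_vert: "tail e \<in> V" and head_vert: "head e \<in> V" and tail_neq_head: "tail e \<noteq> head e"
    and edge_closure: "closure e = e \<union> tail e \<union> head e"
    and edge_verts: "{w \<in> V. w \<lhd>\<^sub>c e} = {tail e, head e}"
    and incid_tail: "incid K (tail e) e = -1" and incid_head: "incid K (head e) e = 1"
    and continuous_param: "continuous_on (closure e) (param e)"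
    and param_tail: "x \<in> tail e \<Longrightarrow> param e x = 0"
    and param_head: "x \<in> head e \<Longrightarrow> param e x = 1"
proof -
  obtain u v t where uv: "u \<in> V" "v \<in> V" "u \<noteq> v" "closure e - e = u \<union> v"
    "{w \<in> V. w \<lhd>\<^sub>c e} = {u, v}" "continuous_on (closure e) (t :: real^3 \<Rightarrow> real)"
    "\<And>x. x \<in> u \<Longrightarrow> t x = 0" "\<And>x. x \<in> v \<Longrightarrow> t x = 1" "incid K u e = -1" "incid K v e = 1"
    using edge_endpoints[OF assms] by blast
  have end_cases: "w = u \<or> w = v" if "w \<in> V" "incid K w e \<noteq> 0" for w
    using that incid_vert_edge[OF that(1) assms] uv(5) by blast
  have t: "tail e = u"
    unfolding tail_def
  proof (rule the_equality)
    fix w assume "w \<in> V \<and> incid K w e = - 1"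
    then show "w = u" using end_cases[of w] uv(10) by auto
  qed (use uv in simp)
  have h: "head e = v"
    unfolding head_def
  proof (rule the_equality)
    fix w assume "w \<in> V \<and> incid K w e = 1"
    then show "w = v" using end_cases[of w] uv(9) by auto
  qed (use uv in simp)
  have ex: "\<exists>t. continuous_on (closure e) t \<and> (\<forall>x\<in>tail e. t x = (0::real)) \<and> (\<forall>x\<in>head e. t x = 1)"
    unfolding t h using uv(6-8) by blast
  note p = someI_ex[OF ex, folded param_def]
  show "tail e \<in> V" "head e \<in> V" "tail e \<noteq> head e" "{w \<in> V. w \<lhd>\<^sub>c e} = {tail e, head e}"
    "incid K (tail e) e = -1" "incid K (head e) e = 1" unfolding t h by (fact uv)+
  show "closure e = e \<union> tail e \<union> head e"
    unfolding t h using uv(4) closure_subset[of e] by blast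
  show "continuous_on (closure e) (param e)" "x \<in> tail e \<Longrightarrow> param e x = 0"
    "x \<in> head e \<Longrightarrow> param e x = 1" using p by blast+
qed

lemma sum_incid_verts:
  fixes x :: "(real^3) set \<Rightarrow> 'b::real_vector"
  assumes "e \<in> E"
  shows "(\<Sum>v\<in>V. of_int (incid K v e) *\<^sub>R x v) = x (head e) - x (tail e)"
proof -
  have "(\<Sum>v\<in>V. of_int (incid K v e) *\<^sub>R x v) = (\<Sum>v\<in>{tail e, head e}. of_int (incid K v e) *\<^sub>R x v)"
  proof (rule sum.mono_neutral_right)
    show "\<forall>v\<in>V - {tail e, head e}. of_int (incid K v e) *\<^sub>R x v = 0"
      using edge_verts[OF assms] incid_vert_edge[OF _ assms] by (metis (lifting) DiffE mem_Collect_eq of_int_0 scaleR_zero_left)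
  qed (use edge_ends(1,2)[OF assms] in auto)
  also have "\<dots> = x (head e) - x (tail e)"
    using edge_ends(3,6,7)[OF assms] by simp
  finally show ?thesis .
qed

text \<open>
The hypothesis on signed incidences sums over cells of every dimension and speaks only of
incident pairs.  For dimension reasons only edges contribute, and for pairs that are not incident
every product vanishes.
\<close>

lemma boundary_of_boundary:
  assumes "v \<in> V" "f \<in> F"
  shows "(\<Sum>e\<in>E. incid K v e * incid K e f) = 0"
proof (cases "v \<lhd>\<^sub>c f")
  case True
  then have "(\<Sum>c\<in>cells K. incid K v c * incid K c f) = 0"
    using signed assms by (simp add: signed_incidence_def cellI)
  moreover have "incid K v c * incid K c f = 0" if "c \<in> cells K - E" for c
  proof -
    have "cell_dim K c \<noteq> 1"
      using that by (auto simp: cells_def cell_dim_simps)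
    then show ?thesis
      using that incid_nonzero_iff[of v c] assms by (auto simp: cellI cell_dim_simps)
  qed
  then have "(\<Sum>c\<in>E. incid K v c * incid K c f) = (\<Sum>c\<in>cells K. incid K v c * incid K c f)"
    by (intro sum.mono_neutral_left) (auto simp: cells_def)
  ultimately show ?thesis by simp
next
  case False
  have "incid K v e * incid K e f = 0" if "e \<in> E" for e
  proof (rule ccontr)
    assume "incid K v e * incid K e f \<noteq> 0"
    then have *: "v \<lhd>\<^sub>c e" "e \<lhd>\<^sub>c f"
      using that assms incid_vert_edge incid_edge_face by auto
    then have "v \<subseteq> closure f"
      using closure_minimal[OF _ closed_closure, of e f] unfolding in_boundary_def by blast
    then show False using False assms cell_types_disjoint(2)[OF assms(1)] by (auto simp: in_boundary_def)
  qed
  then show ?thesis by (intro sum.neutral) blast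
qed

lemma sum_boundary_of_coboundary:
  fixes x :: "(real^3) set \<Rightarrow> 'b::real_vector"
  assumes "f \<in> F"
  shows "(\<Sum>e\<in>E. of_int (incid K e f) *\<^sub>R (x (head e) - x (tail e))) = 0"
proof -
  have "(\<Sum>e\<in>E. of_int (incid K e f) *\<^sub>R (x (head e) - x (tail e)))
      = (\<Sum>e\<in>E. \<Sum>v\<in>V. of_int (incid K v e * incid K e f) *\<^sub>R x v)"
    by (intro sum.cong refl, subst sum_incid_verts[symmetric])
      (auto simp: scaleR_sum_right mult.commute)
  also have "\<dots> = (\<Sum>v\<in>V. of_int (\<Sum>e\<in>E. incid K v e * incid K e f) *\<^sub>R x v)"
    by (subst sum.swap) (simp add: scaleR_sum_left)
  also have "\<dots> = 0"
    using boundary_of_boundary[OF _ assms] by simp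
  finally show ?thesis .
qed

definition boundary :: "((real^3) set \<Rightarrow> 'b::real_vector) \<Rightarrow> (real^3) set \<Rightarrow> 'b" where
  "boundary y v = (\<Sum>e\<in>E. of_int (incid K v e) *\<^sub>R y e)"

lemma boundary_add: "boundary (\<lambda>e. y e + z e) v = boundary y v + boundary z v"
  by (simp add: boundary_def scaleR_add_right sum.distrib)

lemma boundary_scale: "boundary (\<lambda>e. a *\<^sub>R y e) v = a *\<^sub>R boundary y v"
  by (simp add: boundary_def scaleR_sum_right mult.commute)

lemma boundary_cong: "(\<And>e. e \<in> E \<Longrightarrow> y e = z e) \<Longrightarrow> boundary y v = boundary z v"
  by (simp add: boundary_def)

text \<open>
The boundary map is adjoint to the difference map; most orthogonality arguments below rest on this.
\<close>

lemma inner_boundary: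
  fixes y x :: "(real^3) set \<Rightarrow> 'b::real_inner"
  shows "(\<Sum>e\<in>E. y e \<bullet> (x (head e) - x (tail e))) = (\<Sum>v\<in>V. boundary y v \<bullet> x v)"
proof -
  have "(\<Sum>e\<in>E. y e \<bullet> (x (head e) - x (tail e)))
      = (\<Sum>e\<in>E. \<Sum>v\<in>V. (of_int (incid K v e) *\<^sub>R y e) \<bullet> x v)"
    by (intro sum.cong refl, subst sum_incid_verts[symmetric]) (auto simp: inner_sum_right)
  also have "\<dots> = (\<Sum>v\<in>V. boundary y v \<bullet> x v)"
    by (subst sum.swap) (simp add: boundary_def inner_sum_left)
  finally show ?thesis .
qed

lemma sum_boundary: "(\<Sum>v\<in>V. boundary y v) = (0 :: 'b::real_vector)"
proof -
  have "(\<Sum>v\<in>V. boundary y v) = (\<Sum>e\<in>E. (\<Sum>v\<in>V. of_int (incid K v e)) *\<^sub>R y e)"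
    unfolding boundary_def by (subst sum.swap) (simp add: scaleR_sum_left)
  also have "\<dots> = 0"
    using sum_incid_verts[of _ "\<lambda>_. 1::real"] by (intro sum.neutral) simp
  finally show ?thesis .
qed

lemma sum_star:
  assumes "v \<in> V"
  shows "(\<Sum>e\<in>{e \<in> E. v \<lhd>\<^sub>c e}. of_int (incid K v e) *\<^sub>R y e) = boundary y v"
  unfolding boundary_def
proof (rule sum.mono_neutral_left)
  show "\<forall>e\<in>E - {e \<in> E. v \<lhd>\<^sub>c e}. of_int (incid K v e) *\<^sub>R y e = 0"
    using incid_vert_edge[OF assms] by auto
qed auto

section \<open>Connectedness and vanishing of the first cohomology\<close>

lemma connected_edge_closure:
  assumes "e \<in> E"
  shows "connected (closure e)"
proof -
  obtain f g where fg: "homeomorphism (cball (0::real) 1) (closure e) f g"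
    using assms by (rule edge_arc)
  have "connected (cball (0::real) 1)" by simp
  then show ?thesis
    using connected_continuous_image[OF homeomorphism_cont1[OF fg]] homeomorphism_image1[OF fg] by simp
qed

lemma edge_nonempty:
  assumes "e \<in> E"
  shows "e \<noteq> {}"
proof -
  obtain f g where "f ` ball (0::real) 1 = e"
    using assms by (rule edge_arc)
  then show ?thesis by auto
qed

definition cell_of :: "real^3 \<Rightarrow> (real^3) set" where
  "cell_of x = (THE c. c \<in> cells K \<and> x \<in> c)"

lemma cell_of_eq: "c \<in> cells K \<Longrightarrow> x \<in> c \<Longrightarrow> cell_of x = c"
  unfolding cell_of_def using cells_disjoint by (intro the_equality) blast+

lemma edge_in_face_boundary:
  assumes "e \<in> E" "f \<in> F" "e \<lhd>\<^sub>c f"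
  shows "closure e \<subseteq> face_boundary f"
proof -
  have "e \<inter> f = {}"
    using assms cells_disjoint[of e f] cell_types_disjoint(4)[of e] by (auto simp: cellI)
  then have "e \<subseteq> face_boundary f"
    using assms(3) by (auto simp: in_boundary_def face_boundary_def)
  then show ?thesis
    using compact_imp_closed[OF compact_face_boundary[OF assms(2)]] by (rule closure_minimal)
qed

lemma face_boundary_cover:
  assumes "f \<in> F"
  shows "face_boundary f = (\<Union>e\<in>{e\<in>E. e \<lhd>\<^sub>c f}. closure e) \<union> (\<Union>v\<in>{v\<in>V. v \<lhd>\<^sub>c f}. v)"
proof -
  obtain g h where "homeomorphism (cball (0::real^2) 1) (closure f) g h"
    and bd: "closure f - f = \<Union>{d \<in> V \<union> E. d \<lhd>\<^sub>c f}"
    using assms by (rule face_disk)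
  have "\<Union>{d \<in> V \<union> E. d \<lhd>\<^sub>c f} \<subseteq> (\<Union>e\<in>{e\<in>E. e \<lhd>\<^sub>c f}. closure e) \<union> (\<Union>v\<in>{v\<in>V. v \<lhd>\<^sub>c f}. v)"
    using closure_subset by fast
  moreover have "(\<Union>v\<in>{v\<in>V. v \<lhd>\<^sub>c f}. v) \<subseteq> \<Union>{d \<in> V \<union> E. d \<lhd>\<^sub>c f}" by blast
  moreover have "(\<Union>e\<in>{e\<in>E. e \<lhd>\<^sub>c f}. closure e) \<subseteq> face_boundary f"
    using edge_in_face_boundary[OF _ assms] by blast
  ultimately show ?thesis unfolding bd face_boundary_def by blast
qed

lemma continuous_on_vert: "v \<in> V \<Longrightarrow> continuous_on v (g :: real^3 \<Rightarrow> 'b::topological_space)"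
  using vert_singleton by fastforce

lemma closed_edges_verts:
  assumes "A \<subseteq> E" "B \<subseteq> V"
  shows "closed ((\<Union>e\<in>A. closure e) \<union> (\<Union>v\<in>B. v))"
proof -
  have "closed v" if "v \<in> B" for v
  proof -
    have "closure v = v" using that assms(2) by (intro vert_closed) blast
    then show ?thesis using closed_closure[of v] by simp
  qed
  moreover have "finite A" "finite B"
    using finite_subset[OF assms(1) finite_edges] finite_subset[OF assms(2) finite_verts] by blast+
  ultimately show ?thesis by (intro closed_Un closed_UN) auto
qed

lemma continuous_on_edges_verts:
  fixes g :: "real^3 \<Rightarrow> 'b::topological_space"
  assumes "A \<subseteq> E" "B \<subseteq> V" "\<And>e. e \<in> A \<Longrightarrow> continuous_on (closure e) g"
  shows "continuous_on ((\<Union>e\<in>A. closure e) \<union> (\<Union>v\<in>B. v)) g"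
proof (intro continuous_on_closed_Un continuous_on_closed_Union)
  show "finite A" "finite B"
    using finite_subset[OF assms(1) finite_edges] finite_subset[OF assms(2) finite_verts] by blast+
  show "closed (\<Union>e\<in>A. closure e)" "closed (\<Union>v\<in>B. v)"
    using closed_edges_verts[OF assms(1), of "{}"] closed_edges_verts[of "{}", OF _ assms(2)] by simp_all
  show "closed v" if "v \<in> B" for v
    using closed_edges_verts[of "{}" "{v}"] that assms(2) by auto
  show "continuous_on v g" if "v \<in> B" for v
    using that assms(2) by (intro continuous_on_vert) blast
qed (use assms(3) in auto)

lemma continuous_on_sphere:
  fixes g :: "real^3 \<Rightarrow> 'b::topological_space"
  assumes "\<And>e. e \<in> E \<Longrightarrow> continuous_on (closure e) g"
    and "\<And>f. f \<in> F \<Longrightarrow> continuous_on (closure f) g"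
  shows "continuous_on (sphere 0 1) g"
proof -
  have "continuous_on (closure c) g" if "c \<in> cells K" for c
    using that assms by (auto simp: cells_def vert_closed intro: continuous_on_vert)
  then have "continuous_on (\<Union>c\<in>cells K. closure c) g"
    by (intro continuous_on_closed_Union) auto
  moreover have "sphere 0 1 \<subseteq> (\<Union>c\<in>cells K. closure c)"
    unfolding cells_cover[symmetric] by (auto intro: subsetD[OF closure_subset])
  ultimately show ?thesis by (rule continuous_on_subset)
qed

text \<open>
Connectedness of the 1-skeleton, deduced from connectedness of the sphere.  Spread the values over
the edges; the resulting function is continuous with finite range on each face boundary, which is
a connected circle, so it is constant there and extends over the face.  The extended function is
continuous with finite range on the sphere.
\<close>

lemma locally_constant_imp_constant_real:
  fixes \<xi> :: "(real^3) set \<Rightarrow> real"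
  assumes eq: "\<And>e. e \<in> E \<Longrightarrow> \<xi> (head e) = \<xi> (tail e)" and uv: "u \<in> V" "v \<in> V"
  shows "\<xi> u = \<xi> v"
proof -
  define g where "g x = (if cell_of x \<in> V then \<xi> (cell_of x) else \<xi> (tail (cell_of x)))" for x
  have g_vert: "g x = \<xi> v" if "x \<in> v" "v \<in> V" for x v
    using that by (simp add: g_def cell_of_eq[of v] cellI)
  have g_edge: "g x = \<xi> (tail e)" if "x \<in> closure e" "e \<in> E" for x e
  proof -
    from that consider "x \<in> e" | "x \<in> tail e" | "x \<in> head e" using edge_closure by blast
    then show ?thesis
    proof cases
      case 1
      then show ?thesis using that(2) by (simp add: g_def cell_of_eq[of e] cellI cell_types_disjoint(3))
    qed (use g_vert tail_vert head_vert eq that(2) in auto)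
  qed
  have g_range: "g x \<in> \<xi> ` V" if "x \<in> face_boundary f" "f \<in> F" for f x
    using that g_vert g_edge tail_vert unfolding face_boundary_cover[OF that(2)] by blast
  have g_face: "g constant_on face_boundary f" if f: "f \<in> F" for f
  proof (rule continuous_finite_range_constant[OF connected_face_boundary[OF f]])
    have "continuous_on (closure e) g" if "e \<in> E" for e
      using g_edge[OF _ that] by (subst continuous_on_cong[OF refl, of _ _ "\<lambda>_. \<xi> (tail e)"]) auto
    then show "continuous_on (face_boundary f) g"
      unfolding face_boundary_cover[OF f] by (intro continuous_on_edges_verts) auto
    show "finite (g ` face_boundary f)"
      by (rule finite_subset[of _ "\<xi> ` V"]) (use g_range f in auto)
  qed
  define b where "b f = (SOME y. \<forall>x\<in>face_boundary f. g x = y)" for f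
  have b: "g x = b f" if "x \<in> face_boundary f" "f \<in> F" for x f
  proof -
    have "\<exists>y. \<forall>x\<in>face_boundary f. g x = y" using g_face[OF that(2)] by (simp add: constant_on_def)
    from someI_ex[OF this, folded b_def] that(1) show ?thesis by blast
  qed
  define G where "G x = (if cell_of x \<in> F then b (cell_of x) else g x)" for x
  have G_low: "G x = g x" if "x \<in> c" "c \<in> V \<union> E" for x c
    using that cell_types_disjoint(2,4) by (auto simp: G_def cell_of_eq[of c] cellI)
  have G_edge: "G x = \<xi> (tail e)" if "x \<in> closure e" "e \<in> E" for x e
    using that g_edge[OF that] edge_closure[OF that(2)] G_low[of x] tail_vert[OF that(2)] head_vert[OF that(2)]
    by auto
  have G_face: "G x = b f" if "x \<in> closure f" "f \<in> F" for x f
  proof (cases "x \<in> f")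
    case True
    then show ?thesis using that by (simp add: G_def cell_of_eq[of f] cellI)
  next
    case False
    then have x: "x \<in> face_boundary f" using that by (simp add: face_boundary_def)
    then consider e where "e \<in> E" "x \<in> closure e" | v where "v \<in> V" "x \<in> v"
      unfolding face_boundary_cover[OF \<open>f \<in> F\<close>] by blast
    then have "G x = g x"
    proof cases
      case 1 then show ?thesis using G_edge g_edge by simp
    next
      case 2 then show ?thesis using G_low by blast
    qed
    then show ?thesis using b[OF x that(2)] by simp
  qed
  have cont: "continuous_on (sphere 0 1) G"
  proof (rule continuous_on_sphere)
    show "continuous_on (closure e) G" if "e \<in> E" for e
      using G_edge[OF _ that] by (subst continuous_on_cong[OF refl, of _ _ "\<lambda>_. \<xi> (tail e)"]) auto
    show "continuous_on (closure f) G" if "f \<in> F" for f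
      using G_face[OF _ that] by (subst continuous_on_cong[OF refl, of _ _ "\<lambda>_. b f"]) auto
  qed
  have "G ` sphere 0 1 \<subseteq> \<xi> ` V \<union> b ` F"
  proof
    fix y assume "y \<in> G ` sphere 0 1"
    then obtain x c where x: "x \<in> c" "c \<in> cells K" and y: "y = G x" using cells_cover by blast
    from x(2) consider "c \<in> V" | "c \<in> E" | "c \<in> F" by (auto simp: cells_def)
    then show "y \<in> \<xi> ` V \<union> b ` F"
    proof cases
      case 1 then show ?thesis using x y G_low[of x c] g_vert by auto
    next
      case 2 then show ?thesis using x y G_edge[of x c] closure_subset tail_vert by blast
    next
      case 3 then show ?thesis using x y G_face[of x c] closure_subset by blast
    qed
  qed
  then have "finite (G ` sphere 0 1)" by (rule finite_subset) simp
  moreover have "connected (sphere (0::real^3) 1)" by (rule connected_sphere) simp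
  ultimately have "G constant_on sphere 0 1" using cont by (intro continuous_finite_range_constant)
  then obtain y where y: "G x = y" if "x \<in> sphere 0 1" for x unfolding constant_on_def by blast
  have "\<xi> w = y" if "w \<in> V" for w
  proof -
    obtain x where x: "w = {x}" using vert_singleton[OF \<open>w \<in> V\<close>] by blast
    then have "x \<in> sphere 0 1" using cells_cover that cellI(1) by blast
    then show ?thesis using y[of x] G_low[of x w] g_vert[of x w] x that by simp
  qed
  then show ?thesis using uv by simp
qed

text \<open>
The first cohomology of the sphere vanishes.  An integral cocycle \<open>c\<close> describes a map from the
1-skeleton to the circle that sends all vertices to 1 and winds \<open>c e\<close> times along \<open>e\<close>.  On the
boundary of a face the total winding number is 0, so the map lifts to the reals there and extends
over the face.  The map thus obtained on the whole sphere has a continuous logarithm because the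
sphere is simply connected, and the values of this logarithm at the vertices form the potential.
\<close>

lemma integer_cocycle_is_coboundary:
  fixes c :: "(real^3) set \<Rightarrow> real"
  assumes int: "\<And>e. e \<in> E \<Longrightarrow> c e \<in> \<int>"
    and cocycle: "\<And>f. f \<in> F \<Longrightarrow> (\<Sum>e\<in>E. of_int (incid K e f) * c e) = 0"
  shows "\<exists>\<xi>. \<forall>e\<in>E. c e = \<xi> (head e) - \<xi> (tail e)"
proof -
  \<comment> \<open>Integrality of c makes the definitions on the closed edges agree at the vertices, where L is 0.\<close>
  define L where "L x = (if cell_of x \<in> E then c (cell_of x) * param (cell_of x) x else 0)" for x
  define \<psi> where "\<psi> x = cis (2 * pi * L x)" for x
  have L_vert: "L x = 0" if "x \<in> v" "v \<in> V" for x v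
    using that by (simp add: L_def cell_of_eq[of v] cellI cell_types_disjoint(1))
  have L_edge: "\<psi> x = cis (2 * pi * (c e * param e x))" if "x \<in> closure e" "e \<in> E" for x e
  proof -
    from that consider "x \<in> e" | "x \<in> tail e" | "x \<in> head e" using edge_closure by blast
    then show ?thesis
    proof cases
      case 1
      then show ?thesis using that(2) by (simp add: \<psi>_def L_def cell_of_eq[of e] cellI)
    next
      case 2
      then show ?thesis using that(2) L_vert[OF _ tail_vert] by (simp add: \<psi>_def param_tail)
    next
      case 3
      then show ?thesis
        unfolding \<psi>_def cis_2pi_eq_iff
        using that(2) L_vert[OF _ head_vert] int[of e] by (simp add: param_head Ints_minus)
    qed
  qed
  have \<psi>_cont: "continuous_on (closure e) \<psi>" if "e \<in> E" for e
  proof -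
    have "continuous_on (closure e) (\<lambda>x. cis (2 * pi * (c e * param e x)))"
      by (intro continuous_intros continuous_on_cis continuous_param[OF that])
    then show ?thesis
      using L_edge[OF _ that] by (subst continuous_on_cong[OF refl, of _ _ "\<lambda>x. cis (2 * pi * (c e * param e x))"]) auto
  qed
  have jump: "\<theta> y - \<theta> x = c e"
    if e: "e \<in> E" and x: "x \<in> tail e" and y: "y \<in> head e" and cont: "continuous_on (closure e) \<theta>"
      and lift: "\<And>z. z \<in> closure e \<Longrightarrow> \<psi> z = cis (2 * pi * \<theta> z)" for e x y \<theta>
  proof -
    have "\<theta> x - c e * param e x = \<theta> y - c e * param e y"
    proof (rule circle_lifts_differ_by_constant[OF connected_edge_closure[OF e] cont])
      show "continuous_on (closure e) (\<lambda>x. c e * param e x)"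
        by (intro continuous_intros continuous_param[OF e])
    qed (use lift L_edge[OF _ e] edge_closure[OF e] x y in auto)
    then show ?thesis using param_tail[OF e x] param_head[OF e y] by simp
  qed
  have extend: "\<exists>\<Theta>. continuous_on (closure f) \<Theta> \<and> (\<forall>x\<in>face_boundary f. \<psi> x = cis (2 * pi * \<Theta> x))"
    if f: "f \<in> F" for f
  proof -
    have "\<exists>\<Theta>. continuous_on (face_boundary f) \<Theta> \<and> (\<forall>x\<in>face_boundary f. \<psi> x = cis (2 * pi * \<Theta> x))"
    proof (cases "\<exists>e\<in>E. e \<lhd>\<^sub>c f")
      case False
      then have "L x = 0" if "x \<in> face_boundary f" for x
        using that L_vert unfolding face_boundary_cover[OF f] by blast
      then show ?thesis by (intro exI[of _ "\<lambda>_. 0"]) (auto simp: \<psi>_def)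
    next
      case True
      then obtain e\<^sub>0 where e0: "e\<^sub>0 \<in> E" "e\<^sub>0 \<lhd>\<^sub>c f" by blast
      then obtain x\<^sub>0 where x0: "x\<^sub>0 \<in> e\<^sub>0" using edge_nonempty by blast
      have x0b: "x\<^sub>0 \<in> face_boundary f"
        using edge_in_face_boundary[OF e0(1) f e0(2)] x0 closure_subset by blast
      \<comment> \<open>Away from a point of the edge e0 a lift exists for free; its differences agree with c on every
        edge except possibly e0, and the cocycle condition settles e0.\<close>
      have bd_cont: "continuous_on (face_boundary f) \<psi>"
        unfolding face_boundary_cover[OF f] by (intro continuous_on_edges_verts \<psi>_cont) auto
      have norm: "norm (\<psi> x) = 1" for x by (simp add: \<psi>_def)
      obtain \<theta> where \<theta>: "continuous_on (face_boundary f - {x\<^sub>0}) \<theta>"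
        and lift: "\<And>x. x \<in> face_boundary f - {x\<^sub>0} \<Longrightarrow> \<psi> x = cis (2 * pi * \<theta> x)"
        using Borsukian_circle_lift[OF Borsukian_punctured_face_boundary[OF f x0b]
            continuous_on_subset[OF bd_cont Diff_subset] norm] by blast
      define P where "P v = \<theta> (the_elem v)" for v
      have P: "P v = \<theta> x" if "x \<in> v" "v \<in> V" for x v
        using vert_singleton[OF that(2)] that(1) by (auto simp: P_def)
      have missv: "v \<inter> e\<^sub>0 = {}" if "v \<in> V" for v
        using cells_disjoint[OF cellI(1)[OF that] cellI(2)[OF e0(1)]] verts_edges_disjoint[OF that] e0(1)
        by blast
      have miss: "closure e \<inter> e\<^sub>0 = {}" if "e \<in> E" "e \<noteq> e\<^sub>0" for e
      proof -
        have "e \<inter> e\<^sub>0 = {}"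
          using cells_disjoint[OF cellI(2)[OF that(1)] cellI(2)[OF e0(1)]] that(2) by blast
        then show ?thesis
          using edge_closure[OF that(1)] missv[OF tail_vert[OF that(1)]] missv[OF head_vert[OF that(1)]]
          by blast
      qed
      have sub: "closure e \<subseteq> face_boundary f - {x\<^sub>0}" if "e \<in> E" "e \<lhd>\<^sub>c f" "e \<noteq> e\<^sub>0" for e
        using edge_in_face_boundary[OF that(1) f that(2)] miss[OF that(1,3)] x0 by blast
      have dP: "P (head e) - P (tail e) = c e" if e: "e \<in> E" "e \<lhd>\<^sub>c f" "e \<noteq> e\<^sub>0" for e
      proof -
        obtain x y where "tail e = {x}" "head e = {y}"
          using vert_singleton tail_vert head_vert e(1) by meson
        then show ?thesis
          using jump[OF e(1), of x y \<theta>] continuous_on_subset[OF \<theta> sub[OF e]] lift sub[OF e]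
          by (simp add: P_def subset_iff)
      qed
      have "of_int (incid K e\<^sub>0 f) * (P (head e\<^sub>0) - P (tail e\<^sub>0) - c e\<^sub>0)
          = (\<Sum>e\<in>{e\<^sub>0}. of_int (incid K e f) * (P (head e) - P (tail e) - c e))" by simp
      also have "\<dots> = (\<Sum>e\<in>E. of_int (incid K e f) * (P (head e) - P (tail e) - c e))"
      proof (rule sum.mono_neutral_left)
        show "\<forall>e\<in>E - {e\<^sub>0}. of_int (incid K e f) * (P (head e) - P (tail e) - c e) = 0"
          using dP incid_edge_face[OF _ f] by auto
      qed (use e0 in auto)
      also have "\<dots> = (\<Sum>e\<in>E. of_int (incid K e f) * (P (head e) - P (tail e)))
          - (\<Sum>e\<in>E. of_int (incid K e f) * c e)"
        by (simp add: right_diff_distrib sum_subtractf)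
      also have "\<dots> = 0"
        using sum_boundary_of_coboundary[OF f, of P] cocycle[OF f] by simp
      finally have dP0: "P (head e\<^sub>0) - P (tail e\<^sub>0) = c e\<^sub>0"
        using incid_edge_face[OF e0(1) f] e0(2) by auto
      define \<Theta> where "\<Theta> x = (if x \<in> e\<^sub>0 then P (tail e\<^sub>0) + c e\<^sub>0 * param e\<^sub>0 x else \<theta> x)" for x
      have \<Theta>0: "\<Theta> x = P (tail e\<^sub>0) + c e\<^sub>0 * param e\<^sub>0 x" if "x \<in> closure e\<^sub>0" for x
      proof -
        from that consider "x \<in> e\<^sub>0" | "x \<in> tail e\<^sub>0" "x \<notin> e\<^sub>0" | "x \<in> head e\<^sub>0" "x \<notin> e\<^sub>0"
          using edge_closure[OF e0(1)] by blast
        then show ?thesis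
        proof cases
          case 2 then show ?thesis using P[OF _ tail_vert] param_tail e0(1) by (simp add: \<Theta>_def)
        next
          case 3 then show ?thesis using P[OF _ head_vert] param_head dP0 e0(1) by (simp add: \<Theta>_def)
        qed (simp add: \<Theta>_def)
      qed
      have rest: "face_boundary f - e\<^sub>0
          = (\<Union>e\<in>{e\<in>E. e \<lhd>\<^sub>c f \<and> e \<noteq> e\<^sub>0}. closure e) \<union> (\<Union>v\<in>{v\<in>V. v \<lhd>\<^sub>c f \<or> v \<in> {tail e\<^sub>0, head e\<^sub>0}}. v)"
        (is "?l = ?r")
      proof
        show "?l \<subseteq> ?r"
          unfolding face_boundary_cover[OF f]
          using edge_closure[OF e0(1)] tail_vert[OF e0(1)] head_vert[OF e0(1)] by blast
        have "tail e\<^sub>0 \<union> head e\<^sub>0 \<subseteq> face_boundary f"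
          using edge_in_face_boundary[OF e0(1) f e0(2)] edge_closure[OF e0(1)] by blast
        moreover have "?r \<subseteq> face_boundary f \<union> tail e\<^sub>0 \<union> head e\<^sub>0"
          unfolding face_boundary_cover[OF f] by blast
        moreover have "?r \<inter> e\<^sub>0 = {}" using miss missv by blast
        ultimately show "?r \<subseteq> ?l" by blast
      qed
      have cont_e0: "continuous_on (closure e\<^sub>0) \<Theta>"
      proof -
        have "continuous_on (closure e\<^sub>0) (\<lambda>x. P (tail e\<^sub>0) + c e\<^sub>0 * param e\<^sub>0 x)"
          by (intro continuous_intros continuous_param e0)
        then show ?thesis using \<Theta>0 continuous_on_cong[OF refl] by (metis (no_types, lifting))
      qed
      have cont_rest: "continuous_on (face_boundary f - e\<^sub>0) \<Theta>"
      proof -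
        have "continuous_on (face_boundary f - e\<^sub>0) \<theta>"
          by (rule continuous_on_subset[OF \<theta>]) (use x0 in auto)
        then show ?thesis
          by (subst continuous_on_cong[OF refl, of _ _ \<theta>]) (auto simp: \<Theta>_def)
      qed
      have "closed (face_boundary f - e\<^sub>0)"
        unfolding rest by (rule closed_edges_verts) auto
      then have "continuous_on (closure e\<^sub>0 \<union> (face_boundary f - e\<^sub>0)) \<Theta>"
        using cont_e0 cont_rest by (intro continuous_on_closed_Un) auto
      moreover have "closure e\<^sub>0 \<union> (face_boundary f - e\<^sub>0) = face_boundary f"
        using edge_in_face_boundary[OF e0(1) f e0(2)] closure_subset by blast
      ultimately have "continuous_on (face_boundary f) \<Theta>" by simp
      moreover have "\<psi> x = cis (2 * pi * \<Theta> x)" if x: "x \<in> face_boundary f" for x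
      proof (cases "x \<in> e\<^sub>0")
        case True
        obtain y where y: "tail e\<^sub>0 = {y}" using vert_singleton tail_vert e0(1) by meson
        have "y \<in> face_boundary f - {x\<^sub>0}"
          using y edge_in_face_boundary[OF e0(1) f e0(2)] edge_closure[OF e0(1)] x0
            missv[OF tail_vert[OF e0(1)]] by auto
        then have "cis (2 * pi * P (tail e\<^sub>0)) = cis (2 * pi * 0)"
          using lift[of y] L_vert[of y "tail e\<^sub>0"] tail_vert[OF e0(1)] y by (simp add: P_def \<psi>_def)
        then have "P (tail e\<^sub>0) \<in> \<int>" by (simp only: cis_2pi_eq_iff diff_0_right)
        then have "cis (2 * pi * (c e\<^sub>0 * param e\<^sub>0 x)) = cis (2 * pi * (P (tail e\<^sub>0) + c e\<^sub>0 * param e\<^sub>0 x))"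
          by (simp add: cis_2pi_eq_iff Ints_minus)
        then show ?thesis
          using True L_edge[OF _ e0(1), of x] closure_subset by (auto simp: \<Theta>_def)
      next
        case False
        then show ?thesis using lift[of x] x x0 by (auto simp: \<Theta>_def)
      qed
      ultimately show ?thesis by blast
    qed
    then obtain \<Theta> where \<Theta>: "continuous_on (face_boundary f) \<Theta>" "\<forall>x\<in>face_boundary f. \<psi> x = cis (2 * pi * \<Theta> x)"
      by blast
    have "closedin (top_of_set (closure f)) (face_boundary f)"
      using compact_imp_closed[OF compact_face_boundary[OF f]]
      by (intro closed_subset) (auto simp: face_boundary_def)
    from Tietze_unbounded[OF \<Theta>(1) this] obtain h where
      "continuous_on (closure f) h" "\<And>x. x \<in> face_boundary f \<Longrightarrow> h x = \<Theta> x" by blast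
    then show ?thesis using \<Theta>(2) by (intro exI[of _ h]) auto
  qed
  then obtain \<Theta> where \<Theta>: "\<And>f. f \<in> F \<Longrightarrow> continuous_on (closure f) (\<Theta> f)"
    "\<And>f x. f \<in> F \<Longrightarrow> x \<in> face_boundary f \<Longrightarrow> \<psi> x = cis (2 * pi * \<Theta> f x)"
    by metis
  define \<Psi> where "\<Psi> x = (if cell_of x \<in> F then cis (2 * pi * \<Theta> (cell_of x) x) else \<psi> x)" for x
  have low: "\<Psi> x = \<psi> x" if "x \<in> c" "c \<in> V \<union> E" for x c
    using that cell_types_disjoint(2,4) by (auto simp: \<Psi>_def cell_of_eq[of c] cellI)
  have \<Psi>_edge: "\<Psi> x = \<psi> x" if "x \<in> closure e" "e \<in> E" for x e
    using that low[of x] edge_closure[OF that(2)] tail_vert[OF that(2)] head_vert[OF that(2)] by auto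
  have \<Psi>_face: "\<Psi> x = cis (2 * pi * \<Theta> f x)" if "x \<in> closure f" "f \<in> F" for x f
  proof (cases "x \<in> f")
    case True
    then show ?thesis using that by (simp add: \<Psi>_def cell_of_eq[of f] cellI)
  next
    case False
    then have x: "x \<in> face_boundary f" using that by (simp add: face_boundary_def)
    then consider e where "e \<in> E" "x \<in> closure e" | v where "v \<in> V" "x \<in> v"
      unfolding face_boundary_cover[OF \<open>f \<in> F\<close>] by blast
    then have "\<Psi> x = \<psi> x"
    proof cases
      case 1 then show ?thesis using \<Psi>_edge by blast
    next
      case 2 then show ?thesis using low by blast
    qed
    then show ?thesis using \<Theta>(2)[OF that(2) x] by simp
  qed
  have "continuous_on (sphere 0 1) \<Psi>"
  proof (rule continuous_on_sphere)
    show "continuous_on (closure e) \<Psi>" if "e \<in> E" for e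
      using \<psi>_cont[OF that] \<Psi>_edge[OF _ that] by (subst continuous_on_cong[OF refl, of _ _ \<psi>]) auto
    show "continuous_on (closure f) \<Psi>" if "f \<in> F" for f
    proof -
      have "continuous_on (closure f) (\<lambda>x. cis (2 * pi * \<Theta> f x))"
        by (intro continuous_intros continuous_on_cis \<Theta> that)
      then show ?thesis
        using \<Psi>_face[OF _ that]
        by (subst continuous_on_cong[OF refl, of _ _ "\<lambda>x. cis (2 * pi * \<Theta> f x)"]) auto
    qed
  qed
  moreover have "norm (\<Psi> x) = 1" for x by (simp add: \<Psi>_def \<psi>_def)
  moreover have "Borsukian (sphere (0::real^3) 1)" by (rule Borsukian_sphere) simp
  ultimately obtain \<theta> where \<theta>: "continuous_on (sphere 0 1) \<theta>"
    "\<And>x. x \<in> sphere 0 1 \<Longrightarrow> \<Psi> x = cis (2 * pi * \<theta> x)"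
    using Borsukian_circle_lift by metis
  show ?thesis
  proof (intro exI[of _ "\<lambda>v. \<theta> (the_elem v)"] ballI)
    fix e assume e: "e \<in> E"
    obtain x y where xy: "tail e = {x}" "head e = {y}"
      using vert_singleton tail_vert head_vert e by meson
    have "e \<subseteq> sphere 0 1" using cells_cover e cellI(2) by blast
    then have sub: "closure e \<subseteq> sphere 0 1" by (rule closure_minimal) simp
    have "\<theta> y - \<theta> x = c e"
    proof (rule jump[OF e _ _ continuous_on_subset[OF \<theta>(1) sub]])
      fix z assume z: "z \<in> closure e"
      have "\<Psi> z = cis (2 * pi * \<theta> z)" using \<theta>(2) z sub by blast
      then show "\<psi> z = cis (2 * pi * \<theta> z)" using \<Psi>_edge[OF z e] by simp
    qed (use xy in auto)
    then show "c e = \<theta> (the_elem (head e)) - \<theta> (the_elem (tail e))" using xy by simp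
  qed
qed

text \<open>
From integral to real coefficients.  Subtracting from \<open>c\<close> its orthogonal projection onto the
coboundaries leaves a cocycle \<open>z\<close> orthogonal to all coboundaries.  Approximate a multiple \<open>q z\<close> by
an integral cochain \<open>p\<close>; if the error is below the reciprocal of the number of edges then \<open>p\<close> is
itself a cocycle, since its values on faces are integers of absolute value less than 1.  So \<open>p\<close> is a
coboundary and orthogonal to \<open>z\<close>, which bounds the squared norm of \<open>z\<close> by an arbitrarily small error.
\<close>

lemma real_cocycle_is_coboundary:
  fixes c :: "(real^3) set \<Rightarrow> real"
  assumes cocycle: "\<And>f. f \<in> F \<Longrightarrow> (\<Sum>e\<in>E. of_int (incid K e f) * c e) = 0"
  shows "\<exists>\<xi>. \<forall>e\<in>E. c e = \<xi> (head e) - \<xi> (tail e)"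
proof -
  obtain \<xi> where \<xi>: "\<forall>v\<in>V. (\<Sum>e\<in>E. (c e - (\<Sum>w\<in>V. \<xi> w *\<^sub>R of_int (incid K w e))) \<bullet> of_int (incid K v e)) = (0::real)"
    using normal_equations[of V E c "\<lambda>v e. of_int (incid K v e)"] by auto
  define z where "z e = c e - (\<xi> (head e) - \<xi> (tail e))" for e
  have z_cycle: "boundary z v = 0" if "v \<in> V" for v
  proof -
    have "boundary z v
        = (\<Sum>e\<in>E. (c e - (\<Sum>w\<in>V. \<xi> w *\<^sub>R of_int (incid K w e))) \<bullet> of_int (incid K v e))"
      unfolding boundary_def
    proof (intro sum.cong refl)
      fix e assume "e \<in> E"
      from sum_incid_verts[OF this, of \<xi>]
      show "of_int (incid K v e) *\<^sub>R z e
          = (c e - (\<Sum>w\<in>V. \<xi> w *\<^sub>R of_int (incid K w e))) \<bullet> of_int (incid K v e)"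
        by (simp add: z_def mult.commute)
    qed
    then show ?thesis using \<xi> that by simp
  qed
  have z_cocycle: "(\<Sum>e\<in>E. of_int (incid K e f) * z e) = 0" if "f \<in> F" for f
    using cocycle[OF that] sum_boundary_of_coboundary[OF that, of \<xi>]
    by (simp add: z_def right_diff_distrib sum_subtractf)
  define A where "A = (\<Sum>e\<in>E. \<bar>z e\<bar>)"
  define S where "S = (\<Sum>e\<in>E. (z e)\<^sup>2)"
  have bound: "S \<le> A / real N" if N: "N > card E" for N
  proof -
    have "N > 0" using N by simp
    obtain q :: int and p :: "(real^3) set \<Rightarrow> int" where q: "q > 0"
      and p: "\<And>e. e \<in> E \<Longrightarrow> \<bar>of_int q * z e - of_int (p e)\<bar> < 1 / real N"
      using simultaneous_approximation[OF finite_edges \<open>N > 0\<close>, of z] by blast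
    have "(\<Sum>e\<in>E. incid K e f * p e) = 0" if f: "f \<in> F" for f
    proof -
      have "real_of_int (\<Sum>e\<in>E. incid K e f * p e)
          = (\<Sum>e\<in>E. of_int (incid K e f) * of_int (p e)) - of_int q * (\<Sum>e\<in>E. of_int (incid K e f) * z e)"
        using z_cocycle[OF f] by simp
      also have "\<dots> = (\<Sum>e\<in>E. of_int (incid K e f) * (of_int (p e) - of_int q * z e))"
        by (simp add: right_diff_distrib sum_subtractf sum_distrib_left mult.left_commute)
      also have "\<bar>\<dots>\<bar> \<le> (\<Sum>e\<in>E. 1 / real N)"
      proof (intro order_trans[OF sum_abs] sum_mono)
        fix e assume e: "e \<in> E"
        have "\<bar>real_of_int (incid K e f)\<bar> \<le> 1"
          using incid_range[OF cellI(2)[OF e] cellI(3)[OF f]] by auto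
        then show "\<bar>of_int (incid K e f) * (of_int (p e) - of_int q * z e)\<bar> \<le> 1 / real N"
          using mult_mono[of "\<bar>real_of_int (incid K e f)\<bar>" 1 "\<bar>of_int (p e) - of_int q * z e\<bar>" "1 / real N"]
            p[OF e] by (simp add: abs_mult abs_minus_commute)
      qed
      also have "\<dots> < 1" using N \<open>N > 0\<close> by simp
      finally have "\<bar>real_of_int (\<Sum>e\<in>E. incid K e f * p e)\<bar> < 1" .
      then show ?thesis by linarith
    qed
    then have "real_of_int (\<Sum>e\<in>E. incid K e f * p e) = 0" if "f \<in> F" for f
      using that by simp
    then have p_cocycle: "(\<Sum>e\<in>E. of_int (incid K e f) * real_of_int (p e)) = 0" if "f \<in> F" for f
      using that by simp
    obtain \<eta> where \<eta>: "\<forall>e\<in>E. real_of_int (p e) = \<eta> (head e) - \<eta> (tail e)"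
      using integer_cocycle_is_coboundary[of "\<lambda>e. real_of_int (p e)", OF Ints_of_int p_cocycle] by blast
    have "(\<Sum>e\<in>E. z e * real_of_int (p e)) = (\<Sum>e\<in>E. z e \<bullet> (\<eta> (head e) - \<eta> (tail e)))"
      using \<eta> by (intro sum.cong) auto
    also have "\<dots> = (\<Sum>v\<in>V. boundary z v \<bullet> \<eta> v)" by (rule inner_boundary)
    also have "\<dots> = 0" using z_cycle by simp
    finally have "of_int q * S = (\<Sum>e\<in>E. z e * (of_int q * z e - of_int (p e)))"
      by (simp add: S_def right_diff_distrib sum_subtractf sum_distrib_left power2_eq_square mult.left_commute)
    also have "\<dots> \<le> (\<Sum>e\<in>E. \<bar>z e\<bar> * (1 / real N))"
    proof (rule sum_mono)
      fix e assume e: "e \<in> E"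
      have "z e * (of_int q * z e - of_int (p e)) \<le> \<bar>z e\<bar> * \<bar>of_int q * z e - of_int (p e)\<bar>"
        by (metis abs_ge_self abs_mult)
      also have "\<dots> \<le> \<bar>z e\<bar> * (1 / real N)"
        using p[OF e] by (intro mult_left_mono) auto
      finally show "z e * (of_int q * z e - of_int (p e)) \<le> \<bar>z e\<bar> * (1 / real N)" .
    qed
    finally have "of_int q * S \<le> A / real N" by (simp add: A_def sum_divide_distrib)
    moreover have "1 * S \<le> of_int q * S"
      using q by (intro mult_right_mono) (auto simp: S_def intro: sum_nonneg)
    ultimately show ?thesis by simp
  qed
  have "S \<le> 0"
  proof (rule field_le_epsilon)
    fix \<epsilon> :: real assume "\<epsilon> > 0"
    obtain N :: nat where N: "real N > max (real (card E)) (A / \<epsilon>)"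
      using reals_Archimedean2 by blast
    then have "N > card E" by simp
    moreover from this have "A / real N \<le> \<epsilon>"
      using N \<open>\<epsilon> > 0\<close> by (simp add: field_simps)
    ultimately show "S \<le> 0 + \<epsilon>" using bound[of N] by simp
  qed
  then have "S = 0" by (simp add: S_def order_antisym sum_nonneg)
  then have "z e = 0" if "e \<in> E" for e
    using that by (simp add: S_def sum_nonneg_eq_0_iff)
  then show ?thesis by (intro exI[of _ \<xi>]) (simp add: z_def)
qed

lemma cocycle_is_coboundary:
  fixes c :: "(real^3) set \<Rightarrow> real^'n"
  assumes cocycle: "\<And>f. f \<in> F \<Longrightarrow> (\<Sum>e\<in>E. of_int (incid K e f) *\<^sub>R c e) = 0"
  shows "\<exists>\<xi>. \<forall>e\<in>E. c e = \<xi> (head e) - \<xi> (tail e)"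
proof -
  have "\<exists>\<xi>. \<forall>e\<in>E. (c e) $ i = \<xi> (head e) - \<xi> (tail e)" for i
  proof -
    have "(\<Sum>e\<in>E. of_int (incid K e f) * (c e) $ i) = 0" if "f \<in> F" for f
      using arg_cong[OF cocycle[OF that], of "\<lambda>x. x $ i"] by simp
    then show ?thesis by (rule real_cocycle_is_coboundary)
  qed
  then obtain \<xi> where \<xi>: "\<forall>e\<in>E. (c e) $ i = \<xi> i (head e) - \<xi> i (tail e)" for i by metis
  show ?thesis
    by (rule exI[of _ "\<lambda>v. \<chi> i. \<xi> i v"]) (simp add: vec_eq_iff \<xi>)
qed

lemma locally_constant_imp_constant:
  fixes \<xi> :: "(real^3) set \<Rightarrow> real^'n"
  assumes "\<And>e. e \<in> E \<Longrightarrow> \<xi> (head e) = \<xi> (tail e)"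
  obtains c where "\<And>v. v \<in> V \<Longrightarrow> \<xi> v = c"
proof -
  have "\<xi> u = \<xi> v" if "u \<in> V" "v \<in> V" for u v
    unfolding vec_eq_iff
    using locally_constant_imp_constant_real[OF _ that, of "\<lambda>v. \<xi> v $ i" for i] assms by simp
  then show thesis using that by metis
qed

end

section \<open>Rotation by a right angle in the plane\<close>

definition rot :: "real^2 \<Rightarrow> real^2" where
  "rot x = vector [- x $ 2, x $ 1]"

lemma rot_nth [simp]: "rot x $ 1 = - (x $ 2)" "rot x $ 2 = x $ 1"
  by (simp_all add: rot_def)

lemma vec2_eq_iff: "x = y \<longleftrightarrow> x $ 1 = y $ 1 \<and> x $ 2 = y $ 2" for x y :: "real^2"
  by (simp add: vec_eq_iff forall_2)

lemma inner_vec2: "x \<bullet> y = x $ 1 * y $ 1 + x $ 2 * y $ 2" for x y :: "real^2"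
  by (simp add: inner_vec_def sum_2)

lemma rot_linear: "linear rot"
  by (rule linearI) (simp_all add: vec2_eq_iff)

lemmas rot_add = linear_add[OF rot_linear]
  and rot_diff = linear_diff[OF rot_linear]
  and rot_scale = linear_cmul[OF rot_linear]
  and rot_sum = linear_sum[OF rot_linear]

lemma rot_rot [simp]: "rot (rot x) = - x"
  by (simp add: vec2_eq_iff)

lemma rot_minus: "rot (- x) = - rot x"
  by (simp add: vec2_eq_iff)

lemma rot_zero [simp]: "rot 0 = 0"
  by (simp add: vec2_eq_iff)

lemma rot_eq_0_iff [simp]: "rot x = 0 \<longleftrightarrow> x = 0"
  by (auto simp: vec2_eq_iff)

lemma inner_rot_rot [simp]: "rot x \<bullet> rot y = x \<bullet> y"
  by (simp add: inner_vec2)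

lemma inner_rot_self [simp]: "x \<bullet> rot x = 0" "rot x \<bullet> x = 0"
  by (simp_all add: inner_vec2)

lemma unit_frame_decomposition:
  assumes "norm t = 1"
  shows "y = (y \<bullet> t) *\<^sub>R t + (y \<bullet> rot t) *\<^sub>R rot t"
proof -
  have t: "t $ 1 * t $ 1 + t $ 2 * t $ 2 = 1"
    using assms by (simp add: norm_eq_1 inner_vec2)
  have "(y \<bullet> t) * t $ 1 + (y \<bullet> rot t) * rot t $ 1 = y $ 1 * (t $ 1 * t $ 1 + t $ 2 * t $ 2)"
    "(y \<bullet> t) * t $ 2 + (y \<bullet> rot t) * rot t $ 2 = y $ 2 * (t $ 1 * t $ 1 + t $ 2 * t $ 2)"
    by (simp_all add: inner_vec2 algebra_simps)
  then show ?thesis using t by (simp add: vec2_eq_iff)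
qed

lemma in_span_unit_iff:
  assumes "norm t = 1"
  shows "y \<in> span {t} \<longleftrightarrow> y \<bullet> rot t = 0"
proof
  assume "y \<in> span {t}"
  then show "y \<bullet> rot t = 0" by (auto simp: span_singleton)
next
  assume "y \<bullet> rot t = 0"
  then have "y = (y \<bullet> t) *\<^sub>R t" using unit_frame_decomposition[OF assms, of y] by simp
  then show "y \<in> span {t}" by (auto simp: span_singleton)
qed

section \<open>The spaces attached to one diagram\<close>

lemma real_module_plane: "real_module plane"
  by (rule real_module_vec_space) simp

lemma plane_simps [simp]:
  "carrier plane = UNIV" "zero plane = 0" "add plane = plus" "smult plane = scaleR"
  by (simp_all add: vec_space_def)

lemma restrict_eq_iff: "(\<lambda>i\<in>I. f i) = (\<lambda>i\<in>I. g i) \<longleftrightarrow> (\<forall>i\<in>I. f i = g i)"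
  by (auto simp: fun_eq_iff restrict_def)

locale sphere_diagram = sphere_complex K for K +
  fixes r :: "(real^3) set \<Rightarrow> real^2"
  assumes diagram: "diagram K r"
begin

lemma boundary_rot: "boundary (\<lambda>e. rot (y e)) v = rot (boundary y v)"
  by (simp add: boundary_def rot_sum rot_scale)

abbreviation "\<tau> \<equiv> edge_dir K r"
abbreviation "line \<equiv> edge_line K r"

lemma edge_sum_eq:
  assumes "e \<in> E"
  shows "edge_sum K x e = x (head e) - x (tail e)"
  using edge_ends(3,6,7)[OF assms] by (simp add: edge_sum_def edge_verts[OF assms])

lemma edge_sum_nonzero:
  assumes "e \<in> E"
  shows "edge_sum K r e \<noteq> 0"
  using diagram edge_ends(1-3)[OF assms] by (auto simp: edge_sum_eq[OF assms] diagram_def inj_on_def)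

lemma norm_dir: "e \<in> E \<Longrightarrow> norm (\<tau> e) = 1"
  using edge_sum_nonzero by (simp add: edge_dir_def norm_sgn)

lemma edge_vector: "r (head e) - r (tail e) = norm (edge_sum K r e) *\<^sub>R \<tau> e" if "e \<in> E"
  using edge_sum_nonzero[OF that] by (simp add: edge_dir_def sgn_div_norm edge_sum_eq[OF that])

lemma in_line_iff: "e \<in> E \<Longrightarrow> y \<in> line e \<longleftrightarrow> y \<bullet> rot (\<tau> e) = 0"
  by (simp add: edge_line_def in_span_unit_iff norm_dir)

lemma vertex_vectors_simps:
  "carrier (vertex_vectors K) = V \<rightarrow>\<^sub>E UNIV" "zero (vertex_vectors K) = (\<lambda>v\<in>V. 0)"
  "add (vertex_vectors K) = (\<lambda>x y. \<lambda>v\<in>V. x v + y v)"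
  "smult (vertex_vectors K) = (\<lambda>a x. \<lambda>v\<in>V. a *\<^sub>R x v)"
  by (simp_all add: vertex_vectors_def prod_space_def vec_space_def)

lemma edge_scalars_simps:
  "carrier (edge_scalars K) = E \<rightarrow>\<^sub>E UNIV" "zero (edge_scalars K) = (\<lambda>e\<in>E. 0)"
  "add (edge_scalars K) = (\<lambda>x y. \<lambda>e\<in>E. x e + y e)"
  "smult (edge_scalars K) = (\<lambda>a x. \<lambda>e\<in>E. a * x e)"
  by (simp_all add: edge_scalars_def prod_space_def vec_space_def)

lemma edge_normals_simps:
  "carrier (edge_normals K r) = (\<Pi>\<^sub>E e\<in>E. orthogonal_comp (line e))" "zero (edge_normals K r) = (\<lambda>e\<in>E. 0)"
  "add (edge_normals K r) = (\<lambda>x y. \<lambda>e\<in>E. x e + y e)"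
  "smult (edge_normals K r) = (\<lambda>a x. \<lambda>e\<in>E. a *\<^sub>R x e)"
  by (simp_all add: edge_normals_def prod_space_def vec_space_def)

lemma real_module_vertex_vectors: "real_module (vertex_vectors K)"
  unfolding vertex_vectors_def by (intro real_module_prod_space real_module_plane)

lemma real_module_edge_scalars: "real_module (edge_scalars K)"
  unfolding edge_scalars_def by (intro real_module_prod_space real_module_vec_space) simp

lemma real_module_edge_normals: "real_module (edge_normals K r)"
  unfolding edge_normals_def by (intro real_module_prod_space real_module_vec_space subspace_orthogonal_comp)

lemma line_subspace: "linear_subspace plane (line e)"
  by (auto simp: linear_subspace_def vec_space_def edge_line_def span_zero span_add span_scale)

lemma real_module_edge_quotients: "real_module (edge_quotients K r)"
  unfolding edge_quotients_def
  by (intro real_module_prod_space real_module_quot_space real_module_plane line_subspace)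

lemma force_boundary_eq: "force_boundary K r w = (\<lambda>v\<in>V. boundary (\<lambda>e. w e *\<^sub>R \<tau> e) v)"
  unfolding force_boundary_def by (rule restrict_ext) (simp flip: sum_star)

lemma shear_boundary_eq: "shear_boundary K s = (\<lambda>v\<in>V. boundary s v)"
  unfolding shear_boundary_def by (rule restrict_ext) (simp flip: sum_star)

lemma force_boundary_linear:
  "force_boundary K r w \<in> carrier (vertex_vectors K)"
  "force_boundary K r (w \<oplus>\<^bsub>edge_scalars K\<^esub> w') = force_boundary K r w \<oplus>\<^bsub>vertex_vectors K\<^esub> force_boundary K r w'"
  "force_boundary K r (a \<odot>\<^bsub>edge_scalars K\<^esub> w) = a \<odot>\<^bsub>vertex_vectors K\<^esub> force_boundary K r w"
proof -
  have "boundary (\<lambda>e. (w \<oplus>\<^bsub>edge_scalars K\<^esub> w') e *\<^sub>R \<tau> e) v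
      = boundary (\<lambda>e. w e *\<^sub>R \<tau> e) v + boundary (\<lambda>e. w' e *\<^sub>R \<tau> e) v" for v
    unfolding boundary_add[symmetric]
    by (rule boundary_cong) (simp add: edge_scalars_simps scaleR_add_left)
  moreover have "boundary (\<lambda>e. (a \<odot>\<^bsub>edge_scalars K\<^esub> w) e *\<^sub>R \<tau> e) v = a *\<^sub>R boundary (\<lambda>e. w e *\<^sub>R \<tau> e) v" for v
    unfolding boundary_scale[symmetric]
    by (rule boundary_cong) (simp add: edge_scalars_simps)
  ultimately show "force_boundary K r w \<in> carrier (vertex_vectors K)"
    "force_boundary K r (w \<oplus>\<^bsub>edge_scalars K\<^esub> w') = force_boundary K r w \<oplus>\<^bsub>vertex_vectors K\<^esub> force_boundary K r w'"
    "force_boundary K r (a \<odot>\<^bsub>edge_scalars K\<^esub> w) = a \<odot>\<^bsub>vertex_vectors K\<^esub> force_boundary K r w"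
    by (auto simp: force_boundary_eq vertex_vectors_simps intro!: restrict_ext)
qed

lemma shear_boundary_linear:
  "shear_boundary K s \<in> carrier (vertex_vectors K)"
  "shear_boundary K (s \<oplus>\<^bsub>edge_normals K r\<^esub> s') = shear_boundary K s \<oplus>\<^bsub>vertex_vectors K\<^esub> shear_boundary K s'"
  "shear_boundary K (a \<odot>\<^bsub>edge_normals K r\<^esub> s) = a \<odot>\<^bsub>vertex_vectors K\<^esub> shear_boundary K s"
proof -
  have "boundary (s \<oplus>\<^bsub>edge_normals K r\<^esub> s') v = boundary s v + boundary s' v" for v
    unfolding boundary_add[symmetric]
    by (rule boundary_cong) (simp add: edge_normals_simps)
  moreover have "boundary (a \<odot>\<^bsub>edge_normals K r\<^esub> s) v = a *\<^sub>R boundary s v" for v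
    unfolding boundary_scale[symmetric]
    by (rule boundary_cong) (simp add: edge_normals_simps)
  ultimately show "shear_boundary K s \<in> carrier (vertex_vectors K)"
    "shear_boundary K (s \<oplus>\<^bsub>edge_normals K r\<^esub> s') = shear_boundary K s \<oplus>\<^bsub>vertex_vectors K\<^esub> shear_boundary K s'"
    "shear_boundary K (a \<odot>\<^bsub>edge_normals K r\<^esub> s) = a \<odot>\<^bsub>vertex_vectors K\<^esub> shear_boundary K s"
    by (auto simp: shear_boundary_eq vertex_vectors_simps intro!: restrict_ext)
qed

lemma axial_simps:
  "carrier (axial_self_stresses K r) = {w \<in> E \<rightarrow>\<^sub>E UNIV. \<forall>v\<in>V. boundary (\<lambda>e. w e *\<^sub>R \<tau> e) v = 0}"
  "zero (axial_self_stresses K r) = (\<lambda>e\<in>E. 0)"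
  "add (axial_self_stresses K r) = (\<lambda>x y. \<lambda>e\<in>E. x e + y e)"
  "smult (axial_self_stresses K r) = (\<lambda>a x. \<lambda>e\<in>E. a * x e)"
  by (simp_all add: axial_self_stresses_def ker_space_def a_kernel_eq edge_scalars_simps
      vertex_vectors_simps force_boundary_eq restrict_eq_iff)

lemma real_module_axial: "real_module (axial_self_stresses K r)"
  unfolding axial_self_stresses_def
  by (intro real_module_ker_space linear_subspace_kernel real_module_edge_scalars
      real_module_vertex_vectors force_boundary_linear)

lemma normal_comp_iff: "y \<in> orthogonal_comp (line e) \<longleftrightarrow> y \<bullet> \<tau> e = 0" if "e \<in> E"
  by (auto simp: orthogonal_comp_def orthogonal_def edge_line_def span_singleton inner_commute)

lemma shear_simps:
  "carrier (pure_self_shear_stresses K r)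
    = {s \<in> (\<Pi>\<^sub>E e\<in>E. orthogonal_comp (line e)). \<forall>v\<in>V. boundary s v = 0}"
  "zero (pure_self_shear_stresses K r) = (\<lambda>e\<in>E. 0)"
  "add (pure_self_shear_stresses K r) = (\<lambda>x y. \<lambda>e\<in>E. x e + y e)"
  "smult (pure_self_shear_stresses K r) = (\<lambda>a x. \<lambda>e\<in>E. a *\<^sub>R x e)"
  by (simp_all add: pure_self_shear_stresses_def ker_space_def a_kernel_eq edge_normals_simps
      vertex_vectors_simps shear_boundary_eq restrict_eq_iff)

lemma real_module_shear: "real_module (pure_self_shear_stresses K r)"
  unfolding pure_self_shear_stresses_def
  by (intro real_module_ker_space linear_subspace_kernel real_module_edge_normals
      real_module_vertex_vectors shear_boundary_linear)

lemma boundary_rotated_stress: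
  "boundary (\<lambda>e. w e *\<^sub>R rot (\<tau> e)) v = rot (boundary (\<lambda>e. w e *\<^sub>R \<tau> e) v)"
  by (simp add: rot_scale flip: boundary_rot)

text \<open>
Turning every edge vector by a right angle turns axial forces into shear forces.
\<close>

lemma axial_iso_shear: "axial_self_stresses K r \<cong>\<^sub>V pure_self_shear_stresses K r"
proof (rule isomorphic_spacesI[OF real_module_axial real_module_shear])
  let ?\<phi> = "\<lambda>w. \<lambda>e\<in>E. w e *\<^sub>R rot (\<tau> e)"
  have bd: "boundary (?\<phi> w) v = rot (boundary (\<lambda>e. w e *\<^sub>R \<tau> e) v)" for w v
    unfolding boundary_rotated_stress[symmetric] by (rule boundary_cong) simp
  show "linear_epi (axial_self_stresses K r) (pure_self_shear_stresses K r) ?\<phi>"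
  proof (rule linear_epiI)
    fix w assume "w \<in> carrier (axial_self_stresses K r)"
    then show "?\<phi> w \<in> carrier (pure_self_shear_stresses K r)"
      by (auto simp: axial_simps shear_simps bd normal_comp_iff)
  next
    fix s assume s: "s \<in> carrier (pure_self_shear_stresses K r)"
    let ?w = "\<lambda>e\<in>E. s e \<bullet> rot (\<tau> e)"
    have eq: "s e = (s e \<bullet> rot (\<tau> e)) *\<^sub>R rot (\<tau> e)" if "e \<in> E" for e
    proof -
      have "s e \<in> orthogonal_comp (line e)" using s that by (auto simp: shear_simps)
      then show ?thesis
        using unit_frame_decomposition[OF norm_dir[OF that], of "s e"] that by (simp add: normal_comp_iff)
    qed
    have 1: "?\<phi> ?w = s"
    proof (rule extensionalityI[of _ E])
      show "s \<in> extensional E" using s by (simp add: shear_simps PiE_iff)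
    qed (simp_all add: eq[symmetric])
    have "boundary (\<lambda>e. ?w e *\<^sub>R \<tau> e) v = 0" if "v \<in> V" for v
    proof -
      have "rot (boundary (\<lambda>e. ?w e *\<^sub>R \<tau> e) v) = 0"
        using bd[of ?w v] 1 s that by (simp add: shear_simps)
      then have "rot (rot (boundary (\<lambda>e. ?w e *\<^sub>R \<tau> e) v)) = 0" by simp
      then show ?thesis by simp
    qed
    then have "?w \<in> carrier (axial_self_stresses K r)" by (simp add: axial_simps)
    with 1 show "\<exists>w\<in>carrier (axial_self_stresses K r). ?\<phi> w = s" by blast
  qed (auto simp: axial_simps shear_simps scaleR_add_left intro!: restrict_ext)
  fix w assume w: "w \<in> carrier (axial_self_stresses K r)" "?\<phi> w = \<zero>\<^bsub>pure_self_shear_stresses K r\<^esub>"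
  have "w e = 0" if "e \<in> E" for e
  proof -
    have "w e *\<^sub>R rot (\<tau> e) = 0" using w(2) that by (simp add: shear_simps restrict_eq_iff)
    then show ?thesis using norm_dir[OF that] by auto
  qed
  then show "w = \<zero>\<^bsub>axial_self_stresses K r\<^esub>"
    using w(1) by (auto simp: axial_simps PiE_iff intro: extensionalityI)
qed

lemma edge_quotients_simps:
  "carrier (edge_quotients K r) = (\<Pi>\<^sub>E e\<in>E. carrier (quot_space plane (line e)))"
  "zero (edge_quotients K r) = (\<lambda>e\<in>E. line e)"
  "add (edge_quotients K r) = (\<lambda>x y. \<lambda>e\<in>E. x e \<oplus>\<^bsub>quot_space plane (line e)\<^esub> y e)"
  "smult (edge_quotients K r) = (\<lambda>a x. \<lambda>e\<in>E. a \<odot>\<^bsub>quot_space plane (line e)\<^esub> x e)"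
  by (simp_all add: edge_quotients_def prod_space_def quot_space_def)

text \<open>
Elements of the sum of the quotients \<open>\<real>\<^sup>2 / line e\<close> are handled through vector-valued representatives.
\<close>

definition edge_class :: "((real^3) set \<Rightarrow> real^2) \<Rightarrow> (real^3) set \<Rightarrow> (real^2) set" where
  "edge_class y = (\<lambda>e\<in>E. line e +>\<^bsub>plane\<^esub> y e)"

lemma edge_class_carrier: "edge_class y \<in> carrier (edge_quotients K r)"
  by (auto simp: edge_class_def edge_quotients_simps coset_carrier[OF real_module_plane line_subspace])

lemma edge_class_add:
  "edge_class (\<lambda>e. y e + z e) = edge_class y \<oplus>\<^bsub>edge_quotients K r\<^esub> edge_class z"
  using linear_epiD(3)[OF linear_epi_coset[OF real_module_plane line_subspace]]
  by (auto simp: edge_class_def edge_quotients_simps intro!: restrict_ext)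

lemma edge_class_scale:
  "edge_class (\<lambda>e. a *\<^sub>R y e) = a \<odot>\<^bsub>edge_quotients K r\<^esub> edge_class y"
  using linear_epiD(4)[OF linear_epi_coset[OF real_module_plane line_subspace]]
  by (auto simp: edge_class_def edge_quotients_simps intro!: restrict_ext)

lemma edge_class_cong: "(\<And>e. e \<in> E \<Longrightarrow> y e = z e) \<Longrightarrow> edge_class y = edge_class z"
  by (simp add: edge_class_def cong: restrict_cong)

lemma edge_class_eq_iff: "edge_class y = edge_class z \<longleftrightarrow> (\<forall>e\<in>E. (y e - z e) \<bullet> rot (\<tau> e) = 0)"
proof -
  have "line e +>\<^bsub>plane\<^esub> y e = line e +>\<^bsub>plane\<^esub> z e \<longleftrightarrow> (y e - z e) \<bullet> rot (\<tau> e) = 0" if "e \<in> E" for e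
  proof -
    have "line e +>\<^bsub>plane\<^esub> y e = line e +>\<^bsub>plane\<^esub> z e \<longleftrightarrow> (\<exists>h\<in>line e. y e = h + z e)"
      by (subst coset_eq_iff[OF real_module_plane line_subspace]) simp_all
    also have "\<dots> \<longleftrightarrow> y e - z e \<in> line e" by (metis add_diff_cancel diff_add_cancel)
    finally show ?thesis using in_line_iff[OF that] by simp
  qed
  then show ?thesis by (simp add: edge_class_def restrict_eq_iff)
qed

lemma edge_class_zero: "edge_class (\<lambda>_. 0) = \<zero>\<^bsub>edge_quotients K r\<^esub>"
  using coset_zero[OF real_module_plane line_subspace]
  by (auto simp: edge_class_def edge_quotients_simps quot_space_def intro!: restrict_ext)

lemma edge_class_surj:
  assumes "A \<in> carrier (edge_quotients K r)"
  obtains y where "A = edge_class y"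
proof -
  have "\<exists>y. A e = line e +>\<^bsub>plane\<^esub> y" if "e \<in> E" for e
    using assms that
    by (auto simp: edge_quotients_simps coset_carrier[OF real_module_plane line_subspace] PiE_iff)
  then obtain y where y: "\<And>e. e \<in> E \<Longrightarrow> A e = line e +>\<^bsub>plane\<^esub> y e" by metis
  have "A = edge_class y"
  proof (rule extensionalityI[of _ E])
    show "A \<in> extensional E" using assms by (simp add: edge_quotients_simps PiE_iff)
  qed (simp_all add: edge_class_def y)
  then show thesis by (rule that)
qed

lemma position_coboundary_eq: "position_coboundary K r x = edge_class (\<lambda>e. x (head e) - x (tail e))"
  unfolding position_coboundary_def edge_class_def
  by (rule restrict_ext) (simp add: edge_sum_eq)

lemma position_coboundary_linear:
  "position_coboundary K r x \<in> carrier (edge_quotients K r)"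
  "position_coboundary K r (x \<oplus>\<^bsub>vertex_vectors K\<^esub> y)
    = position_coboundary K r x \<oplus>\<^bsub>edge_quotients K r\<^esub> position_coboundary K r y"
  "position_coboundary K r (a \<odot>\<^bsub>vertex_vectors K\<^esub> x) = a \<odot>\<^bsub>edge_quotients K r\<^esub> position_coboundary K r x"
proof -
  show "position_coboundary K r x \<in> carrier (edge_quotients K r)"
    unfolding position_coboundary_eq by (rule edge_class_carrier)
  show "position_coboundary K r (x \<oplus>\<^bsub>vertex_vectors K\<^esub> y)
    = position_coboundary K r x \<oplus>\<^bsub>edge_quotients K r\<^esub> position_coboundary K r y"
    unfolding position_coboundary_eq edge_class_add[symmetric]
    by (rule edge_class_cong) (simp add: vertex_vectors_simps edge_ends)
  show "position_coboundary K r (a \<odot>\<^bsub>vertex_vectors K\<^esub> x) = a \<odot>\<^bsub>edge_quotients K r\<^esub> position_coboundary K r x"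
    unfolding position_coboundary_eq edge_class_scale[symmetric]
    by (rule edge_class_cong) (simp add: vertex_vectors_simps edge_ends scaleR_diff_right)
qed

lemma parallel_simps:
  "carrier (parallel_deformations K r)
    = {x \<in> V \<rightarrow>\<^sub>E UNIV. \<forall>e\<in>E. (x (head e) - x (tail e)) \<bullet> rot (\<tau> e) = 0}"
  "zero (parallel_deformations K r) = (\<lambda>v\<in>V. 0)"
  "add (parallel_deformations K r) = (\<lambda>x y. \<lambda>v\<in>V. x v + y v)"
  "smult (parallel_deformations K r) = (\<lambda>a x. \<lambda>v\<in>V. a *\<^sub>R x v)"
  by (simp_all add: parallel_deformations_def ker_space_def a_kernel_eq vertex_vectors_simps
      position_coboundary_eq edge_class_eq_iff flip: edge_class_zero)

lemma real_module_parallel: "real_module (parallel_deformations K r)"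
  unfolding parallel_deformations_def
  by (intro real_module_ker_space linear_subspace_kernel real_module_vertex_vectors
      real_module_edge_quotients position_coboundary_linear)

text \<open>
The cokernel of the position coboundary is identified with the orthogonal complement of its image,
which by adjointness consists of the normal vectors \<open>w e *\<^sub>R rot (\<tau> e)\<close> with vanishing boundary.
Projecting an arbitrary class onto this complement gives surjectivity.
\<close>

lemma axial_iso_edge_rotations: "axial_self_stresses K r \<cong>\<^sub>V impossible_edge_rotations K r"
proof -
  let ?Q = "edge_quotients K r" and ?I = "impossible_edge_rotations K r"
  define B where "B = position_coboundary K r ` carrier (vertex_vectors K)"
  have B: "linear_subspace ?Q B"
    unfolding B_def
    by (intro linear_subspace_image real_module_vertex_vectors real_module_edge_quotients
        position_coboundary_linear)
  have I: "?I = quot_space ?Q B"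
    by (simp add: impossible_edge_rotations_def coker_space_def B_def)
  note coset = linear_epi_coset[OF real_module_edge_quotients B]
  have B_mem: "edge_class (\<lambda>e. x (head e) - x (tail e)) \<in> B" for x
  proof -
    have "position_coboundary K r (\<lambda>v\<in>V. x v) \<in> B" by (auto simp: B_def vertex_vectors_simps)
    also have "position_coboundary K r (\<lambda>v\<in>V. x v) = edge_class (\<lambda>e. x (head e) - x (tail e))"
      unfolding position_coboundary_eq by (rule edge_class_cong) (simp add: edge_ends)
    finally show ?thesis .
  qed
  let ?\<eta> = "\<lambda>w e. w e *\<^sub>R rot (\<tau> e)"
  let ?\<phi> = "\<lambda>w. B +>\<^bsub>?Q\<^esub> edge_class (?\<eta> w)"
  show ?thesis
  proof (rule isomorphic_spacesI[OF real_module_axial])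
    show "real_module ?I"
      unfolding I by (rule real_module_quot_space[OF real_module_edge_quotients B])
    show "linear_epi (axial_self_stresses K r) ?I ?\<phi>"
    proof (rule linear_epiI)
      show "?\<phi> w \<in> carrier ?I" for w
        unfolding I by (rule linear_epiD(1)[OF coset edge_class_carrier])
    next
      fix w z :: "(real^3) set \<Rightarrow> real"
      have "edge_class (?\<eta> (w \<oplus>\<^bsub>axial_self_stresses K r\<^esub> z)) = edge_class (?\<eta> w) \<oplus>\<^bsub>?Q\<^esub> edge_class (?\<eta> z)"
        unfolding edge_class_add[symmetric]
        by (rule edge_class_cong) (simp add: axial_simps scaleR_add_left)
      then show "?\<phi> (w \<oplus>\<^bsub>axial_self_stresses K r\<^esub> z) = ?\<phi> w \<oplus>\<^bsub>?I\<^esub> ?\<phi> z"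
        unfolding I using linear_epiD(3)[OF coset edge_class_carrier edge_class_carrier] by simp
    next
      fix a and w :: "(real^3) set \<Rightarrow> real"
      have "edge_class (?\<eta> (a \<odot>\<^bsub>axial_self_stresses K r\<^esub> w)) = a \<odot>\<^bsub>?Q\<^esub> edge_class (?\<eta> w)"
        unfolding edge_class_scale[symmetric]
        by (rule edge_class_cong) (simp add: axial_simps)
      then show "?\<phi> (a \<odot>\<^bsub>axial_self_stresses K r\<^esub> w) = a \<odot>\<^bsub>?I\<^esub> ?\<phi> w"
        unfolding I using linear_epiD(4)[OF coset edge_class_carrier] by simp
    next
      fix A assume "A \<in> carrier ?I"
      then obtain y where A: "A = B +>\<^bsub>?Q\<^esub> edge_class y"
        unfolding I coset_carrier[OF real_module_edge_quotients B] using edge_class_surj by blast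
      \<comment> \<open>The generators are the normal components of the displacements that move the vertex v along the
        k-th axis.\<close>
      let ?g = "\<lambda>(j :: (real^3) set \<times> 2) e. of_int (incid K (fst j) e) * rot (\<tau> e) $ snd j"
      obtain a where a: "\<forall>j\<in>V \<times> UNIV. (\<Sum>e\<in>E. (y e \<bullet> rot (\<tau> e) - (\<Sum>i\<in>V \<times> UNIV. a i *\<^sub>R ?g i e)) \<bullet> ?g j e) = 0"
        using normal_equations[of "V \<times> UNIV" E "\<lambda>e. y e \<bullet> rot (\<tau> e)" ?g] by auto
      define x where "x v = (\<chi> k. a (v, k))" for v
      define w where "w = (\<lambda>e\<in>E. (y e - (x (head e) - x (tail e))) \<bullet> rot (\<tau> e))"
      have w: "y e \<bullet> rot (\<tau> e) - (\<Sum>i\<in>V \<times> UNIV. a i *\<^sub>R ?g i e) = w e" if "e \<in> E" for e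
      proof -
        have "(\<Sum>i\<in>V \<times> UNIV. a i *\<^sub>R ?g i e) = (\<Sum>v\<in>V. (of_int (incid K v e) *\<^sub>R x v) \<bullet> rot (\<tau> e))"
        proof -
          have "(\<Sum>i\<in>V \<times> UNIV. a i *\<^sub>R ?g i e) = (\<Sum>v\<in>V. \<Sum>k\<in>UNIV. a (v, k) *\<^sub>R ?g (v, k) e)"
            by (simp add: sum.cartesian_product split_def)
          then show ?thesis
            by (simp add: sum_2 inner_vec2 x_def algebra_simps)
        qed
        also have "\<dots> = (x (head e) - x (tail e)) \<bullet> rot (\<tau> e)"
          using arg_cong[OF sum_incid_verts[OF that, of x], of "\<lambda>z. z \<bullet> rot (\<tau> e)"]
          by (simp add: inner_sum_left)
        finally show ?thesis using that by (simp add: w_def inner_diff_left)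
      qed
      have "boundary (\<lambda>e. w e *\<^sub>R rot (\<tau> e)) v $ k = 0" if "v \<in> V" for v k
      proof -
        have "boundary (\<lambda>e. w e *\<^sub>R rot (\<tau> e)) v $ k = (\<Sum>e\<in>E. w e \<bullet> ?g (v, k) e)"
          by (simp add: boundary_def mult_ac)
        also have "\<dots> = 0"
          using a[rule_format, of "(v, k)"] that w by simp
        finally show ?thesis .
      qed
      then have "rot (boundary (\<lambda>e. w e *\<^sub>R \<tau> e) v) = 0" if "v \<in> V" for v
        using that by (simp add: vec_eq_iff flip: boundary_rotated_stress)
      then have "rot (rot (boundary (\<lambda>e. w e *\<^sub>R \<tau> e) v)) = 0" if "v \<in> V" for v
        using that by simp
      then have w_axial: "w \<in> carrier (axial_self_stresses K r)"
        by (simp add: axial_simps w_def)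
      have "edge_class y = edge_class (\<lambda>e. x (head e) - x (tail e)) \<oplus>\<^bsub>?Q\<^esub> edge_class (?\<eta> w)"
        unfolding edge_class_add[symmetric] edge_class_eq_iff
        using norm_dir by (simp add: w_def inner_diff_left inner_add_left norm_eq_1)
      then have "B +>\<^bsub>?Q\<^esub> edge_class y = ?\<phi> w"
        using B_mem
        by (subst coset_eq_iff[OF real_module_edge_quotients B edge_class_carrier edge_class_carrier]) blast
      then have "?\<phi> w = A" by (simp add: A)
      with w_axial show "\<exists>w\<in>carrier (axial_self_stresses K r). ?\<phi> w = A" by blast
    qed
    fix w assume w: "w \<in> carrier (axial_self_stresses K r)" and zero: "?\<phi> w = \<zero>\<^bsub>?I\<^esub>"
    have "edge_class (?\<eta> w) \<in> B"
      using zero unfolding I coset_eq_zero_iff[OF real_module_edge_quotients B edge_class_carrier] .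
    then obtain x where "edge_class (?\<eta> w) = edge_class (\<lambda>e. x (head e) - x (tail e))"
      by (auto simp: B_def position_coboundary_eq)
    then have x: "w e = (x (head e) - x (tail e)) \<bullet> rot (\<tau> e)" if "e \<in> E" for e
      using that norm_dir by (auto simp: edge_class_eq_iff inner_diff_left norm_eq_1)
    have "(\<Sum>e\<in>E. (w e)\<^sup>2) = (\<Sum>e\<in>E. ?\<eta> w e \<bullet> (x (head e) - x (tail e)))"
      by (intro sum.cong refl) (simp add: x power2_eq_square inner_commute)
    also have "\<dots> = (\<Sum>v\<in>V. boundary (?\<eta> w) v \<bullet> x v)" by (rule inner_boundary)
    also have "\<dots> = 0"
      unfolding boundary_rotated_stress using w by (simp add: axial_simps)
    finally have "w e = 0" if "e \<in> E" for e
      using that by (simp add: sum_nonneg_eq_0_iff)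
    then show "w = \<zero>\<^bsub>axial_self_stresses K r\<^esub>"
      using w by (auto simp: axial_simps PiE_iff intro: extensionalityI)
  qed
qed

text \<open>
A class of vertex forces modulo boundaries of stresses has a unique representative orthogonal to
these boundaries.  Orthogonality means that the difference over each edge is perpendicular to the
edge, so that turning the representative by a right angle gives a parallel deformation.  The sum of
the forces is 0 exactly when the representative is centred, and centring is the normal form of a
deformation modulo translation.
\<close>

lemma mechanisms_iso_parallel:
  "mechanisms_and_rotations K r \<cong>\<^sub>V parallel_deformations_mod_translation K r"
proof -
  let ?VV = "vertex_vectors K" and ?PD = "parallel_deformations K r"
    and ?M = "mechanisms_and_rotations K r" and ?H = "force_H0 K r"
  define \<sigma> where "\<sigma> b = (\<Sum>v\<in>V. b v)" for b :: "(real^3) set \<Rightarrow> real^2"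
  define B where "B = force_boundary K r ` carrier (edge_scalars K)"
  have B: "linear_subspace ?VV B"
    unfolding B_def
    by (intro linear_subspace_image real_module_vertex_vectors real_module_edge_scalars
        force_boundary_linear)
  have H: "?H = quot_space ?VV B"
    by (simp add: force_H0_def coker_space_def B_def)
  have module_H: "real_module ?H"
    unfolding H by (rule real_module_quot_space[OF real_module_vertex_vectors B])
  note coset = linear_epi_coset[OF real_module_vertex_vectors B, folded H]
  have class_sum: "induced_map \<sigma> (B +>\<^bsub>?VV\<^esub> b) = \<sigma> b" for b
  proof (rule induced_map_coset[OF B])
    fix h assume "h \<in> B"
    then obtain w where h: "h = (\<lambda>v\<in>V. boundary (\<lambda>e. w e *\<^sub>R \<tau> e) v)"
      by (auto simp: B_def force_boundary_eq)
    show "\<sigma> (h \<oplus>\<^bsub>?VV\<^esub> b) = \<sigma> b"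
      by (simp add: \<sigma>_def vertex_vectors_simps h sum.distrib sum_boundary)
  qed
  have H_rep: "\<exists>b\<in>carrier ?VV. A = B +>\<^bsub>?VV\<^esub> b" if "A \<in> carrier ?H" for A
    using linear_epiD(2)[OF coset that] .
  have \<sigma>_add: "induced_map \<sigma> (A \<oplus>\<^bsub>?H\<^esub> A') = induced_map \<sigma> A \<oplus>\<^bsub>plane\<^esub> induced_map \<sigma> A'"
    if A: "A \<in> carrier ?H" and A': "A' \<in> carrier ?H" for A A'
  proof -
    obtain b b' where b: "b \<in> carrier ?VV" "A = B +>\<^bsub>?VV\<^esub> b" "b' \<in> carrier ?VV" "A' = B +>\<^bsub>?VV\<^esub> b'"
      using H_rep[OF A] H_rep[OF A'] by blast
    have "A \<oplus>\<^bsub>?H\<^esub> A' = B +>\<^bsub>?VV\<^esub> (b \<oplus>\<^bsub>?VV\<^esub> b')" using linear_epiD(3)[OF coset b(1,3)] b by simp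
    then show ?thesis
      by (simp add: b class_sum) (simp add: \<sigma>_def vertex_vectors_simps sum.distrib)
  qed
  have \<sigma>_scale: "induced_map \<sigma> (a \<odot>\<^bsub>?H\<^esub> A) = a \<odot>\<^bsub>plane\<^esub> induced_map \<sigma> A" if A: "A \<in> carrier ?H" for a A
  proof -
    obtain b where b: "b \<in> carrier ?VV" "A = B +>\<^bsub>?VV\<^esub> b" using H_rep[OF A] by blast
    have "a \<odot>\<^bsub>?H\<^esub> A = B +>\<^bsub>?VV\<^esub> (a \<odot>\<^bsub>?VV\<^esub> b)" using linear_epiD(4)[OF coset b(1)] b by simp
    then show ?thesis
      by (simp add: b class_sum) (simp add: \<sigma>_def vertex_vectors_simps scaleR_sum_right)
  qed
  have M_eq: "?M = ker_space ?H plane (induced_map \<sigma>)"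
    by (simp add: mechanisms_and_rotations_def \<sigma>_def[abs_def])
  have module_M: "real_module ?M"
    unfolding M_eq
    by (intro real_module_ker_space linear_subspace_kernel module_H real_module_plane)
      (use \<sigma>_add \<sigma>_scale in auto)
  have M_simps: "carrier ?M = {A \<in> carrier ?H. induced_map \<sigma> A = 0}" "zero ?M = zero ?H" "add ?M = add ?H"
    "smult ?M = smult ?H"
    by (simp_all add: M_eq ker_space_def a_kernel_eq)
  \<comment> \<open>The map sends a deformation to its turned values, centred so that they sum to 0.\<close>
  define m where "m x = (1 / real (card V)) *\<^sub>R (\<Sum>v\<in>V. rot (x v))" for x :: "(real^3) set \<Rightarrow> real^2"
  define \<beta> where "\<beta> x = (\<lambda>v\<in>V. rot (x v) - m x)" for x
  let ?\<phi> = "\<lambda>x. B +>\<^bsub>?VV\<^esub> \<beta> x"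
  have \<beta>_carrier: "\<beta> x \<in> carrier ?VV" for x by (simp add: \<beta>_def vertex_vectors_simps)
  have \<beta>_sum: "\<sigma> (\<beta> x) = 0" for x
    by (cases "V = {}")
      (simp_all add: \<sigma>_def \<beta>_def sum_subtractf m_def sum_constant_scaleR del: sum_constant)
  have epi: "linear_epi ?PD ?M ?\<phi>"
  proof (rule linear_epiI)
    show "?\<phi> x \<in> carrier ?M" for x
      using linear_epiD(1)[OF coset \<beta>_carrier] by (simp add: M_simps class_sum \<beta>_sum)
  next
    fix x y :: "(real^3) set \<Rightarrow> real^2"
    have "\<beta> (x \<oplus>\<^bsub>?PD\<^esub> y) = \<beta> x \<oplus>\<^bsub>?VV\<^esub> \<beta> y"
      unfolding \<beta>_def vertex_vectors_simps
      by (rule restrict_ext)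
        (simp add: parallel_simps m_def rot_add sum.distrib scaleR_add_right)
    then show "?\<phi> (x \<oplus>\<^bsub>?PD\<^esub> y) = ?\<phi> x \<oplus>\<^bsub>?M\<^esub> ?\<phi> y"
      using linear_epiD(3)[OF coset \<beta>_carrier \<beta>_carrier] by (simp add: M_simps)
  next
    fix a and x :: "(real^3) set \<Rightarrow> real^2"
    have "\<beta> (a \<odot>\<^bsub>?PD\<^esub> x) = a \<odot>\<^bsub>?VV\<^esub> \<beta> x"
      unfolding \<beta>_def vertex_vectors_simps
      by (rule restrict_ext)
        (simp add: parallel_simps m_def rot_scale scaleR_diff_right flip: scaleR_sum_right)
    then show "?\<phi> (a \<odot>\<^bsub>?PD\<^esub> x) = a \<odot>\<^bsub>?M\<^esub> ?\<phi> x"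
      using linear_epiD(4)[OF coset \<beta>_carrier] by (simp add: M_simps)
  next
    fix A assume A: "A \<in> carrier ?M"
    then obtain b where b: "b \<in> carrier ?VV" "A = B +>\<^bsub>?VV\<^esub> b" using H_rep by (auto simp: M_simps)
    have b_sum: "\<sigma> b = 0" using A by (simp add: M_simps b class_sum)
    let ?g = "\<lambda>e v. of_int (incid K v e) *\<^sub>R \<tau> e"
    obtain w where w: "\<forall>e\<in>E. (\<Sum>v\<in>V. (b v - (\<Sum>e'\<in>E. w e' *\<^sub>R ?g e' v)) \<bullet> ?g e v) = 0"
      using normal_equations[of E V b ?g] by auto
    define b' where "b' = (\<lambda>v\<in>V. b v - boundary (\<lambda>e. w e *\<^sub>R \<tau> e) v)"
    have b'_eq: "b v - (\<Sum>e'\<in>E. w e' *\<^sub>R ?g e' v) = b' v" if "v \<in> V" for v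
      using that by (simp add: b'_def boundary_def mult.commute)
    have b'_perp: "(b' (head e) - b' (tail e)) \<bullet> \<tau> e = 0" if "e \<in> E" for e
    proof -
      have "(b' (head e) - b' (tail e)) \<bullet> \<tau> e = (\<Sum>v\<in>V. b' v \<bullet> ?g e v)"
        using arg_cong[OF sum_incid_verts[OF that, of b'], of "\<lambda>z. z \<bullet> \<tau> e"]
        by (simp add: inner_sum_left)
      also have "\<dots> = (\<Sum>v\<in>V. (b v - (\<Sum>e'\<in>E. w e' *\<^sub>R ?g e' v)) \<bullet> ?g e v)"
        by (intro sum.cong refl) (simp only: b'_eq)
      also have "\<dots> = 0" using w that by blast
      finally show ?thesis .
    qed
    have "(\<lambda>e\<in>E. w e) \<in> carrier (edge_scalars K)" by (simp add: edge_scalars_simps)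
    moreover have "force_boundary K r (\<lambda>e\<in>E. w e) = (\<lambda>v\<in>V. boundary (\<lambda>e. w e *\<^sub>R \<tau> e) v)"
      unfolding force_boundary_eq by (intro restrict_ext boundary_cong) simp
    ultimately have h: "(\<lambda>v\<in>V. boundary (\<lambda>e. w e *\<^sub>R \<tau> e) v) \<in> B"
      unfolding B_def by (metis imageI)
    have b'_car: "b' \<in> carrier ?VV" by (simp add: b'_def vertex_vectors_simps)
    have "b = (\<lambda>v\<in>V. boundary (\<lambda>e. w e *\<^sub>R \<tau> e) v) \<oplus>\<^bsub>?VV\<^esub> b'"
    proof (rule extensionalityI[of _ V])
      show "b \<in> extensional V" using b(1) by (simp add: vertex_vectors_simps PiE_iff)
    qed (simp_all add: vertex_vectors_simps b'_def)
    then have A_b': "A = B +>\<^bsub>?VV\<^esub> b'"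
      unfolding b(2) using coset_eq_iff[OF real_module_vertex_vectors B b(1) b'_car] h by blast
    define x where "x = (\<lambda>v\<in>V. - rot (b' v))"
    have "\<sigma> b' = 0"
      using b_sum by (simp add: \<sigma>_def b'_def sum_subtractf sum_boundary)
    then have "m x = 0" by (simp add: m_def x_def rot_minus \<sigma>_def)
    then have "\<beta> x = b'"
      by (auto simp: \<beta>_def x_def b'_def rot_minus)
    moreover have "x \<in> carrier ?PD"
    proof -
      have "(x (head e) - x (tail e)) \<bullet> rot (\<tau> e) = 0" if "e \<in> E" for e
      proof -
        have "x (head e) - x (tail e) = - rot (b' (head e) - b' (tail e))"
          using edge_ends(1,2)[OF that] by (simp add: x_def rot_diff)
        then show ?thesis using b'_perp[OF that] by simp
      qed
      then show ?thesis by (simp add: parallel_simps x_def)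
    qed
    ultimately show "\<exists>x\<in>carrier ?PD. ?\<phi> x = A" using A_b' by blast
  qed
  have "range (\<lambda>c. \<lambda>v\<in>V. c) = {x \<in> carrier ?PD. ?\<phi> x = \<zero>\<^bsub>?M\<^esub>}"
  proof (intro equalityI subsetI)
    fix x assume "x \<in> range (\<lambda>c. \<lambda>v\<in>V. c :: real^2)"
    then obtain c where x: "x = (\<lambda>v\<in>V. c)" by blast
    have "\<beta> x = (\<lambda>v\<in>V. 0)"
      unfolding \<beta>_def by (rule restrict_ext) (auto simp: m_def x sum_constant_scaleR simp del: sum_constant)
    then have "?\<phi> x = \<zero>\<^bsub>?M\<^esub>"
      using coset_zero[OF real_module_vertex_vectors B] by (simp add: M_simps H vertex_vectors_simps)
    then show "x \<in> {x \<in> carrier ?PD. ?\<phi> x = \<zero>\<^bsub>?M\<^esub>}"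
      by (auto simp: parallel_simps x edge_ends)
  next
    fix x assume "x \<in> {x \<in> carrier ?PD. ?\<phi> x = \<zero>\<^bsub>?M\<^esub>}"
    then have x: "x \<in> carrier ?PD" and zero: "?\<phi> x = \<zero>\<^bsub>?M\<^esub>" by auto
    have "\<beta> x \<in> B"
      using zero coset_eq_zero_iff[OF real_module_vertex_vectors B \<beta>_carrier] by (simp add: M_simps H)
    then obtain w where w: "\<beta> x = (\<lambda>v\<in>V. boundary (\<lambda>e. w e *\<^sub>R \<tau> e) v)"
      by (auto simp: B_def force_boundary_eq)
    have "(\<Sum>v\<in>V. \<beta> x v \<bullet> \<beta> x v) = (\<Sum>v\<in>V. boundary (\<lambda>e. w e *\<^sub>R \<tau> e) v \<bullet> \<beta> x v)"
      by (intro sum.cong refl) (simp add: w)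
    also have "\<dots> = (\<Sum>e\<in>E. (w e *\<^sub>R \<tau> e) \<bullet> (\<beta> x (head e) - \<beta> x (tail e)))"
      by (rule inner_boundary[symmetric])
    also have "\<dots> = 0"
    proof (rule sum.neutral, intro ballI)
      fix e assume e: "e \<in> E"
      have "\<beta> x (head e) - \<beta> x (tail e) = rot (x (head e) - x (tail e))"
        using edge_ends(1,2)[OF e] by (simp add: \<beta>_def rot_diff)
      moreover have "(x (head e) - x (tail e)) \<bullet> rot (\<tau> e) = 0"
        using x e by (simp add: parallel_simps)
      then have "rot (x (head e) - x (tail e)) \<bullet> \<tau> e = 0"
        by (simp add: inner_vec2 algebra_simps)
      ultimately show "(w e *\<^sub>R \<tau> e) \<bullet> (\<beta> x (head e) - \<beta> x (tail e)) = 0"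
        by (simp add: inner_commute)
    qed
    finally have "\<beta> x v = 0" if "v \<in> V" for v
      using that by (simp add: sum_nonneg_eq_0_iff)
    then have "rot (rot (x v)) = rot (m x)" if "v \<in> V" for v
      using that by (simp add: \<beta>_def)
    then have "x v = - rot (m x)" if "v \<in> V" for v
      using that by (metis minus_minus rot_rot)
    then have "x = (\<lambda>v\<in>V. - rot (m x))"
      using x by (intro extensionalityI[of _ V]) (auto simp: parallel_simps PiE_iff)
    then show "x \<in> range (\<lambda>c. \<lambda>v\<in>V. c)" by blast
  qed
  then have "quot_space ?PD (range (\<lambda>c. \<lambda>v\<in>V. c)) \<cong>\<^sub>V ?M"
    by (rule first_isomorphism[OF real_module_parallel module_M epi])
  then show ?thesis
    unfolding parallel_deformations_mod_translation_def by (rule isomorphic_spaces_sym)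
qed

end

section \<open>Reciprocal diagrams\<close>

definition grad :: "(real^2 \<Rightarrow> real) \<Rightarrow> real^2" where
  "grad h = (\<chi> k. h (axis k 1) - h 0)"

lemma affine_function_eq:
  assumes "h \<in> carrier affine_functions"
  shows "h x = grad h \<bullet> x + h 0"
proof -
  obtain l c where l: "linear l" and h: "h = (\<lambda>x. l x + c)"
    using assms by (auto simp: affine_functions_def)
  have x: "x = x $ 1 *\<^sub>R axis 1 1 + x $ 2 *\<^sub>R axis 2 1"
    by (simp add: vec2_eq_iff axis_def)
  have "l x = x $ 1 * l (axis 1 1) + x $ 2 * l (axis 2 1)"
    by (subst x) (simp add: linear_add[OF l] linear_cmul[OF l])
  moreover have "l 0 = 0" by (rule linear_0[OF l])
  ultimately show ?thesis by (simp add: h grad_def inner_vec2)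
qed

lemma inner_affine: "(\<lambda>x. g \<bullet> x + k) \<in> carrier affine_functions"
  by (auto simp: affine_functions_def intro!: exI[of _ "\<lambda>x. g \<bullet> x"] exI[of _ k]
      bounded_linear.linear bounded_linear_inner_right)

lemma grad_inner [simp]: "grad (\<lambda>x. g \<bullet> x + k) = g"
  by (simp add: grad_def vec_eq_iff inner_axis)

lemma affine_simps:
  "zero affine_functions = (\<lambda>x. 0)" "add affine_functions = (\<lambda>h k x. h x + k x)"
  "smult affine_functions = (\<lambda>a h x. a * h x)"
  by (simp_all add: affine_functions_def)

lemma grad_add: "grad (\<lambda>x. h x + k x) = grad h + grad k"
  by (simp add: grad_def vec_eq_iff)

lemma grad_scale: "grad (\<lambda>x. a * h x) = a *\<^sub>R grad h"
  by (simp add: grad_def vec_eq_iff right_diff_distrib)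

locale reciprocal_spheres = X: sphere_diagram K p + Y: sphere_diagram K' q
  for K p K' q +
  fixes dual :: "(real^3) set \<Rightarrow> (real^3) set"
  assumes dual: "poincare_dual K K' dual"
    and reciprocal: "reciprocal_diagrams K p K' q dual"
begin

lemma dual_bij: "bij_betw dual (faces K) (verts K')" "bij_betw dual (edges K) (edges K')"
  "bij_betw dual (verts K) (faces K')"
  using dual by (auto simp: poincare_dual_def)

lemma dual_incid: "c \<in> cells K \<Longrightarrow> d \<in> cells K \<Longrightarrow> incid K' (dual d) (dual c) = incid K c d"
  and dual_in_boundary: "c \<in> cells K \<Longrightarrow> d \<in> cells K \<Longrightarrow> dual d \<lhd>\<^sub>c dual c \<longleftrightarrow> c \<lhd>\<^sub>c d"
  using dual by (simp_all add: poincare_dual_def)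

lemma dual_cells: "f \<in> faces K \<Longrightarrow> dual f \<in> verts K'" "e \<in> edges K \<Longrightarrow> dual e \<in> edges K'"
  "v \<in> verts K \<Longrightarrow> dual v \<in> faces K'"
  using dual_bij by (auto simp: bij_betw_def)

lemma dual_vertE: assumes "v' \<in> verts K'" obtains f where "f \<in> faces K" "v' = dual f"
  using dual_bij(1) assms by (auto simp: bij_betw_def)

lemma dual_edgeE: assumes "e' \<in> edges K'" obtains e where "e \<in> edges K" "e' = dual e"
  using dual_bij(2) assms by (auto simp: bij_betw_def)

lemma dual_faceE: assumes "f' \<in> faces K'" obtains v where "v \<in> verts K" "f' = dual v"
  using dual_bij(3) assms by (auto simp: bij_betw_def)

definition primal_edge :: "(real^3) set \<Rightarrow> (real^3) set" where
  "primal_edge = inv_into (edges K) dual"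

definition primal_vert :: "(real^3) set \<Rightarrow> (real^3) set" where
  "primal_vert = inv_into (verts K) dual"

lemma primal_edge_dual [simp]: "e \<in> edges K \<Longrightarrow> primal_edge (dual e) = e"
  unfolding primal_edge_def using dual_bij(2) by (simp add: bij_betw_def)

lemma primal_vert_dual [simp]: "v \<in> verts K \<Longrightarrow> primal_vert (dual v) = v"
  unfolding primal_vert_def using dual_bij(3) by (simp add: bij_betw_def)

lemma dual_boundary:
  assumes "f \<in> faces K"
  shows "Y.boundary y (dual f) = (\<Sum>e\<in>edges K. of_int (incid K e f) *\<^sub>R y (dual e))"
  unfolding Y.boundary_def sum.reindex_bij_betw[OF dual_bij(2), symmetric]
  using assms by (intro sum.cong refl) (simp add: dual_incid X.cellI)

lemma dual_endpoint:
  assumes "e \<in> edges K" "f \<in> faces K" "e \<lhd>\<^sub>c f"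
  shows "dual f = Y.head (dual e) \<or> dual f = Y.tail (dual e)"
  using Y.edge_verts[OF dual_cells(2)[OF assms(1)]] dual_cells(1)[OF assms(2)]
    dual_in_boundary[of e f] assms by (auto simp: X.cellI)

lemma dual_edge_faces:
  assumes "e \<in> edges K"
  obtains f g where "f \<in> faces K" "g \<in> faces K" "e \<lhd>\<^sub>c f" "e \<lhd>\<^sub>c g"
    "Y.head (dual e) = dual f" "Y.tail (dual e) = dual g"
proof -
  note ends = Y.edge_ends[OF dual_cells(2)[OF assms]]
  obtain f where f: "f \<in> faces K" "Y.head (dual e) = dual f" using dual_vertE[OF ends(2)] .
  obtain g where g: "g \<in> faces K" "Y.tail (dual e) = dual g" using dual_vertE[OF ends(1)] .
  have "dual f \<lhd>\<^sub>c dual e" "dual g \<lhd>\<^sub>c dual e" using ends(5) f g by auto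
  then have "e \<lhd>\<^sub>c f" "e \<lhd>\<^sub>c g" using dual_in_boundary f g assms by (simp_all add: X.cellI)
  then show thesis using that f g by blast
qed

text \<open>
Reciprocity: an edge and its dual edge span the same line.  Membership in a line is expressed
throughout as orthogonality to the rotated direction.
\<close>

lemma parallel_edges:
  assumes "e \<in> edges K"
  shows "x \<bullet> rot (X.\<tau> e) = 0 \<longleftrightarrow> x \<bullet> rot (Y.\<tau> (dual e)) = 0"
proof -
  obtain f g where fg: "f \<in> faces K" "g \<in> faces K" "e \<lhd>\<^sub>c f" "e \<lhd>\<^sub>c g"
    "Y.head (dual e) = dual f" "Y.tail (dual e) = dual g"
    using dual_edge_faces[OF assms] .
  have "q (dual f) - q (dual g) \<in> X.line e"
    using reciprocal assms fg(1-4) by (simp add: reciprocal_diagrams_def)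
  then obtain k where k: "q (dual f) - q (dual g) = k *\<^sub>R X.\<tau> e"
    by (auto simp: edge_line_def span_singleton)
  define n where "n = norm (edge_sum K' q (dual e))"
  have n: "n \<noteq> 0" using Y.edge_sum_nonzero[OF dual_cells(2)[OF assms]] by (simp add: n_def)
  have eq: "n *\<^sub>R Y.\<tau> (dual e) = k *\<^sub>R X.\<tau> e"
    using Y.edge_vector[OF dual_cells(2)[OF assms]] k by (simp add: n_def fg)
  then have "k \<noteq> 0"
    using n Y.norm_dir[OF dual_cells(2)[OF assms]] by auto
  have "n * (x \<bullet> rot (Y.\<tau> (dual e))) = k * (x \<bullet> rot (X.\<tau> e))"
    using arg_cong[OF eq, of "\<lambda>t. x \<bullet> rot t"] by (simp add: rot_scale)
  with n \<open>k \<noteq> 0\<close> show ?thesis by (metis mult_eq_0_iff)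
qed

lemma axial_dual_iff:
  "w \<in> carrier (axial_self_stresses K' q) \<longleftrightarrow> w \<in> edges K' \<rightarrow>\<^sub>E UNIV \<and>
    (\<forall>f\<in>faces K. (\<Sum>e\<in>edges K. of_int (incid K e f) *\<^sub>R w (dual e) *\<^sub>R Y.\<tau> (dual e)) = 0)"
proof -
  have "(\<forall>v\<in>verts K'. Y.boundary (\<lambda>e. w e *\<^sub>R Y.\<tau> e) v = 0) \<longleftrightarrow>
      (\<forall>f\<in>faces K. Y.boundary (\<lambda>e. w e *\<^sub>R Y.\<tau> e) (dual f) = 0)"
    unfolding bij_betw_imp_surj_on[OF dual_bij(1), symmetric] by simp
  then show ?thesis by (simp add: Y.axial_simps dual_boundary)
qed

text \<open>
A parallel deformation of the primal diagram changes each edge along its own direction, which is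
the direction of the dual edge; the signed amount of the change is the stress on the dual edge.
\<close>

definition stress_of :: "((real^3) set \<Rightarrow> real^2) \<Rightarrow> (real^3) set \<Rightarrow> real" where
  "stress_of x = (\<lambda>e'\<in>edges K'. (x (X.head (primal_edge e')) - x (X.tail (primal_edge e'))) \<bullet> Y.\<tau> e')"

lemma stress_of_dual:
  "e \<in> edges K \<Longrightarrow> stress_of x (dual e) = (x (X.head e) - x (X.tail e)) \<bullet> Y.\<tau> (dual e)"
  by (simp add: stress_of_def dual_cells)

lemma edge_difference:
  assumes "x \<in> carrier (parallel_deformations K p)" "e \<in> edges K"
  shows "x (X.head e) - x (X.tail e) = stress_of x (dual e) *\<^sub>R Y.\<tau> (dual e)"
proof -
  have "(x (X.head e) - x (X.tail e)) \<bullet> rot (X.\<tau> e) = 0"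
    using assms by (simp add: X.parallel_simps)
  then have "(x (X.head e) - x (X.tail e)) \<bullet> rot (Y.\<tau> (dual e)) = 0"
    using parallel_edges[OF assms(2)] by blast
  then show ?thesis
    using unit_frame_decomposition[OF Y.norm_dir[OF dual_cells(2)[OF assms(2)]], of "x (X.head e) - x (X.tail e)"]
    by (simp add: stress_of_dual[OF assms(2)])
qed

lemma primal_edge_edge: "e' \<in> edges K' \<Longrightarrow> primal_edge e' \<in> edges K"
  unfolding primal_edge_def using dual_bij(2) by (auto simp: bij_betw_def intro: inv_into_into)

text \<open>
Equilibrium at the dual vertex of a face \<open>f\<close> says that the edge changes around \<open>f\<close> add up to 0.
They do so for every deformation, and vanishing of the first cohomology is the converse.
\<close>

lemma linear_epi_stress_of:
  "linear_epi (parallel_deformations K p) (axial_self_stresses K' q) stress_of"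
proof (rule linear_epiI)
  fix x assume x: "x \<in> carrier (parallel_deformations K p)"
  have "(\<Sum>e\<in>edges K. of_int (incid K e f) *\<^sub>R stress_of x (dual e) *\<^sub>R Y.\<tau> (dual e)) = 0"
    if "f \<in> faces K" for f
  proof -
    have "(\<Sum>e\<in>edges K. of_int (incid K e f) *\<^sub>R stress_of x (dual e) *\<^sub>R Y.\<tau> (dual e))
        = (\<Sum>e\<in>edges K. of_int (incid K e f) *\<^sub>R (x (X.head e) - x (X.tail e)))"
      by (intro sum.cong refl) (simp only: edge_difference[OF x])
    also have "\<dots> = 0" by (rule X.sum_boundary_of_coboundary[OF that])
    finally show ?thesis .
  qed
  then show "stress_of x \<in> carrier (axial_self_stresses K' q)"
    unfolding axial_dual_iff by (simp add: stress_of_def)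
next
  fix w assume w: "w \<in> carrier (axial_self_stresses K' q)"
  then obtain x where x: "\<forall>e\<in>edges K. w (dual e) *\<^sub>R Y.\<tau> (dual e) = x (X.head e) - x (X.tail e)"
    using X.cocycle_is_coboundary[of "\<lambda>e. w (dual e) *\<^sub>R Y.\<tau> (dual e)"] unfolding axial_dual_iff by blast
  let ?x = "\<lambda>v\<in>verts K. x v"
  have diff: "?x (X.head e) - ?x (X.tail e) = w (dual e) *\<^sub>R Y.\<tau> (dual e)" if "e \<in> edges K" for e
    using x that X.edge_ends(1,2)[OF that] by simp
  have "?x \<in> carrier (parallel_deformations K p)"
  proof -
    have "(?x (X.head e) - ?x (X.tail e)) \<bullet> rot (X.\<tau> e) = 0" if "e \<in> edges K" for e
      unfolding parallel_edges[OF that] diff[OF that] by simp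
    then show ?thesis unfolding X.parallel_simps by simp
  qed
  moreover have "stress_of ?x = w"
  proof (rule extensionalityI[of _ "edges K'"])
    show "w \<in> extensional (edges K')" using w by (simp add: Y.axial_simps PiE_iff)
    fix e' assume "e' \<in> edges K'"
    then obtain e where e: "e \<in> edges K" "e' = dual e" by (rule dual_edgeE)
    show "stress_of ?x e' = w e'"
      unfolding e(2) stress_of_dual[OF e(1)] diff[OF e(1)]
      using Y.norm_dir[OF dual_cells(2)[OF e(1)]] by (simp add: norm_eq_1)
  qed (simp add: stress_of_def)
  ultimately show "\<exists>x\<in>carrier (parallel_deformations K p). stress_of x = w" by blast
next
  fix x y :: "(real^3) set \<Rightarrow> real^2"
  show "stress_of (x \<oplus>\<^bsub>parallel_deformations K p\<^esub> y) = stress_of x \<oplus>\<^bsub>axial_self_stresses K' q\<^esub> stress_of y"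
    unfolding stress_of_def Y.axial_simps
    by (rule restrict_ext)
      (simp add: X.parallel_simps X.edge_ends primal_edge_edge inner_diff_left inner_add_left)
next
  fix a and x :: "(real^3) set \<Rightarrow> real^2"
  show "stress_of (a \<odot>\<^bsub>parallel_deformations K p\<^esub> x) = a \<odot>\<^bsub>axial_self_stresses K' q\<^esub> stress_of x"
    unfolding stress_of_def Y.axial_simps
    by (rule restrict_ext)
      (simp add: X.parallel_simps X.edge_ends primal_edge_edge inner_diff_left right_diff_distrib)
qed

lemma stress_of_zero_iff:
  assumes x: "x \<in> carrier (parallel_deformations K p)"
  shows "stress_of x = \<zero>\<^bsub>axial_self_stresses K' q\<^esub> \<longleftrightarrow> (\<exists>c. x = (\<lambda>v\<in>verts K. c))"
proof
  assume "stress_of x = \<zero>\<^bsub>axial_self_stresses K' q\<^esub>"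
  then have "stress_of x (dual e) = 0" if "e \<in> edges K" for e
    using dual_cells(2)[OF that] by (simp add: Y.axial_simps)
  then have "x (X.head e) = x (X.tail e)" if "e \<in> edges K" for e
    using edge_difference[OF x that] that by simp
  then obtain c where "\<And>v. v \<in> verts K \<Longrightarrow> x v = c"
    using X.locally_constant_imp_constant[of x] by blast
  then have "x = (\<lambda>v\<in>verts K. c)"
    using x by (intro extensionalityI[of _ "verts K"]) (auto simp: X.parallel_simps PiE_iff)
  then show "\<exists>c. x = (\<lambda>v\<in>verts K. c)" ..
next
  assume "\<exists>c. x = (\<lambda>v\<in>verts K. c)"
  then show "stress_of x = \<zero>\<^bsub>axial_self_stresses K' q\<^esub>"
    by (auto simp: stress_of_def Y.axial_simps X.edge_ends primal_edge_edge intro!: restrict_ext)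
qed

lemma parallel_iso_axial:
  "parallel_deformations_mod_translation K p \<cong>\<^sub>V axial_self_stresses K' q"
  unfolding parallel_deformations_mod_translation_def
proof (rule first_isomorphism[OF X.real_module_parallel Y.real_module_axial linear_epi_stress_of])
  have "(\<lambda>v\<in>verts K. c) \<in> carrier (parallel_deformations K p)" for c
    by (simp add: X.parallel_simps X.edge_ends)
  then show "range (\<lambda>c. \<lambda>v\<in>verts K. c)
      = {x \<in> carrier (parallel_deformations K p). stress_of x = \<zero>\<^bsub>axial_self_stresses K' q\<^esub>}"
    using stress_of_zero_iff by auto
qed

definition lift_space :: "((real^3) set \<Rightarrow> real^2 \<Rightarrow> real) real_space" where
  "lift_space = prod_space (faces K') (\<lambda>_. affine_functions)"

lemma lift_space_simps:
  "carrier lift_space = faces K' \<rightarrow>\<^sub>E carrier affine_functions"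
  "zero lift_space = (\<lambda>f\<in>faces K'. (\<lambda>x. 0))"
  "add lift_space = (\<lambda>h k. \<lambda>f\<in>faces K'. (\<lambda>x. h f x + k f x))"
  "smult lift_space = (\<lambda>a h. \<lambda>f\<in>faces K'. (\<lambda>x. a * h f x))"
  by (simp_all add: lift_space_def prod_space_def affine_simps)

text \<open>
An edge of the dual complex has precisely two incident faces, the duals of the two endpoints of the
primal edge, so one equation per edge and endpoint suffices.
\<close>

lemma lift_condition_iff:
  "(\<forall>e\<in>edges K'. \<forall>f\<in>faces K'. \<forall>g\<in>faces K'. \<forall>v\<in>verts K'.
      e \<lhd>\<^sub>c f \<longrightarrow> e \<lhd>\<^sub>c g \<longrightarrow> v \<lhd>\<^sub>c e \<longrightarrow> h f (q v) = h g (q v)) \<longleftrightarrow>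
   (\<forall>e\<in>edges K. \<forall>v\<in>{Y.tail (dual e), Y.head (dual e)}.
      h (dual (X.head e)) (q v) = h (dual (X.tail e)) (q v))" (is "?L \<longleftrightarrow> ?R")
proof
  assume L: ?L
  show ?R
  proof (intro ballI)
    fix e v assume e: "e \<in> edges K" and v: "v \<in> {Y.tail (dual e), Y.head (dual e)}"
    note ends = X.edge_ends[OF e]
    have "v \<in> verts K'" "v \<lhd>\<^sub>c dual e"
      using v Y.edge_verts[OF dual_cells(2)[OF e]] by auto
    moreover have "X.head e \<lhd>\<^sub>c e" "X.tail e \<lhd>\<^sub>c e" using ends(5) by auto
    then have "dual e \<lhd>\<^sub>c dual (X.head e)" "dual e \<lhd>\<^sub>c dual (X.tail e)"
      using dual_in_boundary ends(1,2) e by (simp_all add: X.cellI)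
    ultimately show "h (dual (X.head e)) (q v) = h (dual (X.tail e)) (q v)"
      using L dual_cells(2)[OF e] dual_cells(3)[OF ends(1)] dual_cells(3)[OF ends(2)] by blast
  qed
next
  assume R: ?R
  show ?L
  proof (intro ballI impI)
    fix e' f g v assume e': "e' \<in> edges K'" and f: "f \<in> faces K'" and g: "g \<in> faces K'"
      and v: "v \<in> verts K'" and inc: "e' \<lhd>\<^sub>c f" "e' \<lhd>\<^sub>c g" "v \<lhd>\<^sub>c e'"
    obtain e where e: "e \<in> edges K" "e' = dual e" using dual_edgeE[OF e'] .
    have "f = dual (X.head e) \<or> f = dual (X.tail e)" if f: "f \<in> faces K'" "e' \<lhd>\<^sub>c f" for f
    proof -
      obtain c where c: "c \<in> verts K" "f = dual c" using dual_faceE[OF f(1)] .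
      then have "c \<lhd>\<^sub>c e" using dual_in_boundary f(2) e by (simp add: X.cellI)
      with c(1) have "c \<in> {w \<in> verts K. w \<lhd>\<^sub>c e}" by simp
      then have "c \<in> {X.tail e, X.head e}" by (simp only: X.edge_verts[OF e(1)])
      then show ?thesis using c(2) by auto
    qed
    then have "f = dual (X.head e) \<or> f = dual (X.tail e)" "g = dual (X.head e) \<or> g = dual (X.tail e)"
      using f g inc by blast+
    moreover have "v \<in> {Y.tail (dual e), Y.head (dual e)}"
      using Y.edge_verts[OF e'] v inc(3) e(2) by blast
    then have "h (dual (X.head e)) (q v) = h (dual (X.tail e)) (q v)" using R e(1) by blast
    ultimately show "h f (q v) = h g (q v)" by auto
  qed
qed

lemma lifts_simps:
  "carrier (polyhedral_lifts K' q) = {h \<in> carrier lift_space.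
     \<forall>e\<in>edges K. \<forall>v\<in>{Y.tail (dual e), Y.head (dual e)}.
       h (dual (X.head e)) (q v) = h (dual (X.tail e)) (q v)}"
  "zero (polyhedral_lifts K' q) = zero lift_space"
  "add (polyhedral_lifts K' q) = add lift_space"
  "smult (polyhedral_lifts K' q) = smult lift_space"
  unfolding polyhedral_lifts_def Let_def lift_space_def[symmetric] lift_condition_iff by simp_all

lemma real_module_lifts: "real_module (polyhedral_lifts K' q)"
proof -
  have module: "real_module lift_space"
    unfolding lift_space_def by (intro real_module_prod_space real_module_affine_functions)
  have "polyhedral_lifts K' q = lift_space\<lparr>carrier := carrier (polyhedral_lifts K' q)\<rparr>"
    by (simp add: polyhedral_lifts_def Let_def flip: lift_space_def)
  also have "real_module \<dots>"
  proof (rule real_module_subspace[OF module])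
    show "carrier (polyhedral_lifts K' q) \<subseteq> carrier lift_space" by (auto simp: lifts_simps)
    show "\<zero>\<^bsub>lift_space\<^esub> \<in> carrier (polyhedral_lifts K' q)"
      using real_moduleD(1)[OF module]
      by (auto simp: lifts_simps lift_space_simps dual_cells X.edge_ends)
    show "h \<oplus>\<^bsub>lift_space\<^esub> k \<in> carrier (polyhedral_lifts K' q)"
      if "h \<in> carrier (polyhedral_lifts K' q)" "k \<in> carrier (polyhedral_lifts K' q)" for h k
    proof -
      have "h \<oplus>\<^bsub>lift_space\<^esub> k \<in> carrier lift_space"
        using that by (intro real_moduleD(2)[OF module]) (auto simp: lifts_simps)
      then show ?thesis
        using that by (auto simp: lifts_simps) (auto simp: lift_space_simps dual_cells X.edge_ends)
    qed
    show "a \<odot>\<^bsub>lift_space\<^esub> h \<in> carrier (polyhedral_lifts K' q)"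
      if "h \<in> carrier (polyhedral_lifts K' q)" for a h
    proof -
      have "a \<odot>\<^bsub>lift_space\<^esub> h \<in> carrier lift_space"
        using that by (intro real_moduleD(3)[OF module]) (auto simp: lifts_simps)
      then show ?thesis
        using that by (auto simp: lifts_simps) (auto simp: lift_space_simps dual_cells X.edge_ends)
    qed
  qed
  finally show ?thesis .
qed

definition gradients :: "((real^3) set \<Rightarrow> real^2 \<Rightarrow> real) \<Rightarrow> (real^3) set \<Rightarrow> real^2" where
  "gradients h = (\<lambda>v\<in>verts K. rot (grad (h (dual v))))"

lemma lift_affine:
  assumes "h \<in> carrier (polyhedral_lifts K' q)" "v \<in> verts K"
  shows "h (dual v) x = grad (h (dual v)) \<bullet> x + h (dual v) 0"
proof (rule affine_function_eq)
  show "h (dual v) \<in> carrier affine_functions"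
    using assms(1) dual_cells(3)[OF assms(2)] by (auto simp: lifts_simps lift_space_simps)
qed

text \<open>
Two affine pieces of a lift agree at both ends of the edge separating them exactly when their
gradients differ perpendicularly to the edge and their constant terms are matched accordingly.
Turned gradients therefore form a parallel deformation of the primal diagram.  Conversely, the
required jumps of the constant terms form a cocycle: along the edges around a face \<open>f\<close> they can all
be computed at the single point \<open>q (dual f)\<close>.
\<close>

lemma linear_epi_gradients:
  "linear_epi (polyhedral_lifts K' q) (parallel_deformations K p) gradients"
proof (rule linear_epiI)
  fix h assume h: "h \<in> carrier (polyhedral_lifts K' q)"
  have "(gradients h (X.head e) - gradients h (X.tail e)) \<bullet> rot (X.\<tau> e) = 0" if e: "e \<in> edges K" for e
  proof -
    note ends = X.edge_ends[OF e]
    let ?d = "grad (h (dual (X.head e))) - grad (h (dual (X.tail e)))"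
    have "h (dual (X.head e)) (q v) = h (dual (X.tail e)) (q v)"
      if "v \<in> {Y.tail (dual e), Y.head (dual e)}" for v
      using h e that by (auto simp: lifts_simps)
    then have "?d \<bullet> q v = h (dual (X.tail e)) 0 - h (dual (X.head e)) 0"
      if "v \<in> {Y.tail (dual e), Y.head (dual e)}" for v
      using that lift_affine[OF h ends(1), of "q v"] lift_affine[OF h ends(2), of "q v"]
      by (auto simp: inner_diff_left)
    then have "?d \<bullet> (q (Y.head (dual e)) - q (Y.tail (dual e))) = 0"
      by (simp add: inner_diff_right)
    then have "?d \<bullet> Y.\<tau> (dual e) = 0"
      using Y.edge_vector[OF dual_cells(2)[OF e]] Y.edge_sum_nonzero[OF dual_cells(2)[OF e]] by simp
    then have "rot ?d \<bullet> rot (Y.\<tau> (dual e)) = 0" by simp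
    then show ?thesis
      unfolding parallel_edges[OF e] using ends(1,2) by (simp add: gradients_def rot_diff)
  qed
  then show "gradients h \<in> carrier (parallel_deformations K p)"
    by (simp add: X.parallel_simps) (simp add: gradients_def)
next
  fix x assume x: "x \<in> carrier (parallel_deformations K p)"
  define G where "G v = - rot (x v)" for v
  define c where "c e = - ((G (X.head e) - G (X.tail e)) \<bullet> q (Y.head (dual e)))" for e
  have c: "c e = - ((G (X.head e) - G (X.tail e)) \<bullet> q v)"
    if e: "e \<in> edges K" and v: "v \<in> {Y.tail (dual e), Y.head (dual e)}" for e v
  proof -
    have "rot (G (X.head e) - G (X.tail e)) = x (X.head e) - x (X.tail e)"
      by (simp add: G_def rot_diff rot_minus)
    then have "rot (G (X.head e) - G (X.tail e)) \<bullet> rot (Y.\<tau> (dual e)) = 0"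
      using x e by (simp add: X.parallel_simps flip: parallel_edges)
    then have "(G (X.head e) - G (X.tail e)) \<bullet> (q (Y.head (dual e)) - q (Y.tail (dual e))) = 0"
      by (simp add: Y.edge_vector[OF dual_cells(2)[OF e]])
    then show ?thesis using v by (auto simp: c_def inner_diff_right)
  qed
  have "(\<Sum>e\<in>edges K. of_int (incid K e f) * c e) = 0" if f: "f \<in> faces K" for f
  proof -
    have "(\<Sum>e\<in>edges K. of_int (incid K e f) * c e)
        = - ((\<Sum>e\<in>edges K. of_int (incid K e f) *\<^sub>R (G (X.head e) - G (X.tail e))) \<bullet> q (dual f))"
      unfolding inner_sum_left sum_negf[symmetric]
    proof (rule sum.cong[OF refl])
      fix e assume e: "e \<in> edges K"
      show "of_int (incid K e f) * c e
          = - ((of_int (incid K e f) *\<^sub>R (G (X.head e) - G (X.tail e))) \<bullet> q (dual f))"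
      proof (cases "e \<lhd>\<^sub>c f")
        case True
        then have "dual f \<in> {Y.tail (dual e), Y.head (dual e)}" using dual_endpoint[OF e f] by blast
        then show ?thesis using c[OF e] by simp
      next
        case False
        then have "incid K e f = 0" using X.incid_edge_face[OF e f] by blast
        then show ?thesis by simp
      qed
    qed
    also have "\<dots> = 0" using X.sum_boundary_of_coboundary[OF f, of G] by simp
    finally show ?thesis .
  qed
  then obtain k where k: "\<forall>e\<in>edges K. c e = k (X.head e) - k (X.tail e)"
    using X.real_cocycle_is_coboundary[of c] by blast
  define h where "h = (\<lambda>f\<in>faces K'. (\<lambda>x. G (primal_vert f) \<bullet> x + k (primal_vert f)))"
  have h_dual: "h (dual v) = (\<lambda>x. G v \<bullet> x + k v)" if "v \<in> verts K" for v
    using that by (simp add: h_def dual_cells)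
  have "h \<in> carrier (polyhedral_lifts K' q)"
    unfolding lifts_simps
  proof (intro CollectI conjI ballI)
    show "h \<in> carrier lift_space" by (simp add: h_def lift_space_simps inner_affine)
    fix e v assume e: "e \<in> edges K" and v: "v \<in> {Y.tail (dual e), Y.head (dual e)}"
    show "h (dual (X.head e)) (q v) = h (dual (X.tail e)) (q v)"
      using c[OF e v] k e X.edge_ends(1,2)[OF e] by (simp add: h_dual inner_diff_left)
  qed
  moreover have "gradients h = x"
  proof (rule extensionalityI[of _ "verts K"])
    show "x \<in> extensional (verts K)" using x by (simp add: X.parallel_simps PiE_iff)
    fix v assume v: "v \<in> verts K"
    have "grad (h (dual v)) = G v" unfolding h_dual[OF v] by (rule grad_inner)
    then show "gradients h v = x v" using v by (simp add: gradients_def G_def rot_minus)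
  qed (simp add: gradients_def)
  ultimately show "\<exists>h\<in>carrier (polyhedral_lifts K' q). gradients h = x" by blast
next
  fix h k
  show "gradients (h \<oplus>\<^bsub>polyhedral_lifts K' q\<^esub> k)
      = gradients h \<oplus>\<^bsub>parallel_deformations K p\<^esub> gradients k"
    unfolding gradients_def X.parallel_simps
    by (rule restrict_ext) (simp add: lifts_simps lift_space_simps dual_cells grad_add rot_add)
next
  fix a h
  show "gradients (a \<odot>\<^bsub>polyhedral_lifts K' q\<^esub> h) = a \<odot>\<^bsub>parallel_deformations K p\<^esub> gradients h"
    unfolding gradients_def X.parallel_simps
    by (rule restrict_ext) (simp add: lifts_simps lift_space_simps dual_cells grad_scale rot_scale)
qed

text \<open>
A lift with zero stress has constant gradient; its constant terms then agree across every edge,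
and connectedness makes it a global affine function.
\<close>

lemma lifts_iso_axial: "polyhedral_lifts_mod_affine K' q \<cong>\<^sub>V axial_self_stresses K' q"
  unfolding polyhedral_lifts_mod_affine_def
proof (rule first_isomorphism[OF real_module_lifts Y.real_module_axial
      linear_epi_compose[OF linear_epi_gradients linear_epi_stress_of]], intro equalityI subsetI)
  fix h assume "h \<in> (\<lambda>h. \<lambda>f\<in>faces K'. h) ` carrier affine_functions"
  then obtain h\<^sub>0 where h0: "h\<^sub>0 \<in> carrier affine_functions" and h: "h = (\<lambda>f\<in>faces K'. h\<^sub>0)" by blast
  have mem: "h \<in> carrier (polyhedral_lifts K' q)"
    using h0 by (auto simp: lifts_simps lift_space_simps h dual_cells X.edge_ends)
  have "gradients h = (\<lambda>v\<in>verts K. rot (grad h\<^sub>0))"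
    unfolding gradients_def by (rule restrict_ext) (simp add: h dual_cells)
  then have "stress_of (gradients h) = \<zero>\<^bsub>axial_self_stresses K' q\<^esub>"
    using stress_of_zero_iff[OF linear_epiD(1)[OF linear_epi_gradients mem]] by blast
  with mem show "h \<in> {h \<in> carrier (polyhedral_lifts K' q).
      (stress_of \<circ> gradients) h = \<zero>\<^bsub>axial_self_stresses K' q\<^esub>}" by simp
next
  fix h assume "h \<in> {h \<in> carrier (polyhedral_lifts K' q).
      (stress_of \<circ> gradients) h = \<zero>\<^bsub>axial_self_stresses K' q\<^esub>}"
  then have h: "h \<in> carrier (polyhedral_lifts K' q)"
    and zero: "stress_of (gradients h) = \<zero>\<^bsub>axial_self_stresses K' q\<^esub>" by auto
  obtain c where c: "gradients h = (\<lambda>v\<in>verts K. c)"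
    using zero stress_of_zero_iff[OF linear_epiD(1)[OF linear_epi_gradients h]] by blast
  have g: "grad (h (dual v)) = - rot c" if "v \<in> verts K" for v
  proof -
    have "rot (grad (h (dual v))) = c" using fun_cong[OF c, of v] that by (simp add: gradients_def)
    then have "rot (rot (grad (h (dual v)))) = rot c" by simp
    then show ?thesis by (metis minus_minus rot_rot)
  qed
  have "h (dual (X.head e)) 0 = h (dual (X.tail e)) 0" if e: "e \<in> edges K" for e
  proof -
    note ends = X.edge_ends[OF e]
    have "h (dual (X.head e)) (q (Y.head (dual e))) = h (dual (X.tail e)) (q (Y.head (dual e)))"
      using h e by (simp add: lifts_simps)
    then show ?thesis
      using lift_affine[OF h ends(1), of "q (Y.head (dual e))"] lift_affine[OF h ends(2), of "q (Y.head (dual e))"]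
        g[OF ends(1)] g[OF ends(2)] by simp
  qed
  then obtain k where k: "h (dual v) 0 = k" if "v \<in> verts K" for v
    using X.locally_constant_imp_constant_real[of "\<lambda>v. h (dual v) 0"] by metis
  have "h = (\<lambda>f\<in>faces K'. (\<lambda>x. - rot c \<bullet> x + k))"
  proof (rule extensionalityI[of _ "faces K'"])
    show "h \<in> extensional (faces K')" using h by (simp add: lifts_simps lift_space_simps PiE_iff)
    fix f assume f: "f \<in> faces K'"
    obtain v where v: "v \<in> verts K" "f = dual v" using dual_faceE[OF f] .
    show "h f = (\<lambda>f\<in>faces K'. (\<lambda>x. - rot c \<bullet> x + k)) f"
      using f lift_affine[OF h v(1)] g[OF v(1)] k[OF v(1)] v(2) by auto
  qed simp
  then show "h \<in> (\<lambda>h. \<lambda>f\<in>faces K'. h) ` carrier affine_functions"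
    using inner_affine by blast
qed

end

theorem mainTheorem1:
  fixes K K' :: "(real^3) cell_complex"
    and dual :: "(real^3) set \<Rightarrow> (real^3) set"
    and p q :: "(real^3) set \<Rightarrow> real^2"
  assumes "sphere_decomposition K"
    and "sphere_decomposition K'"
    and "poincare_dual K K' dual"
    and "reciprocal_diagrams K p K' q dual"
  shows "mechanisms_and_rotations K p \<cong>\<^sub>V parallel_deformations_mod_translation K p \<and>
         parallel_deformations_mod_translation K p \<cong>\<^sub>V impossible_edge_rotations K' q \<and>
         impossible_edge_rotations K' q \<cong>\<^sub>V axial_self_stresses K' q \<and>
         axial_self_stresses K' q \<cong>\<^sub>V pure_self_shear_stresses K' q \<and>
         pure_self_shear_stresses K' q \<cong>\<^sub>V polyhedral_lifts_mod_affine K' q"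
proof -
  have "sphere_diagram K p" "sphere_diagram K' q"
    using assms by (auto simp: sphere_diagram_def sphere_complex_def sphere_diagram_axioms_def
        reciprocal_diagrams_def)
  then interpret reciprocal_spheres K p K' q dual
    using assms(3,4) by (intro reciprocal_spheres.intro reciprocal_spheres_axioms.intro)
  note iv_sym = isomorphic_spaces_sym[OF Y.axial_iso_edge_rotations]
  show ?thesis
    using X.mechanisms_iso_parallel
      isomorphic_spaces_trans[OF parallel_iso_axial Y.axial_iso_edge_rotations] iv_sym
      Y.axial_iso_shear
      isomorphic_spaces_trans[OF isomorphic_spaces_sym[OF Y.axial_iso_shear]
        isomorphic_spaces_sym[OF lifts_iso_axial]]
    by blast
qed

end
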